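(* Let $\mathsf L$ be a logic above $\mathsf{S4}$. There exists a nonzero ordinal $\gamma$ such that $\mathsf L=\mathsf L(\beta(\gamma))$ and the least exponent $\alpha_1$ in the Cantor normal form of $\gamma$ is finite if and only if $\mathsf L$ is one of the following logics: (1) $\mathsf L_m$ for some $0<m<\omega$; (2) $\mathsf{S4.Grz}$, or $\mathsf{S4.Grz}_n$ for some $0<n<\omega$; (3) $\mathsf{S4.Grz}\cap\mathsf L_m$ for some $0<m<\omega$, or $\mathsf{S4.Grz}_n\cap\mathsf L_m$ for some $0<m<n<\omega$.
   Context: Modal formulas are evaluated in a topological space $X$ by assigning subsets of $X$ to variables, with Boolean connectives as set operations, $\Box$ as interior and $\Diamond$ as closure; $X\vDash\varphi$ iff $\varphi$ evaluates to $X$ under every assignment, and $\mathsf L(X)=\{\varphi\mid X\vDash\varphi\}$. A logic above $\mathsf{S4}$ is a normal modal logic containing $\mathsf{S4}$. Ordinals carry the interval topology and $\beta(\gamma)$ is the Čech–Stone compactification of the ordinal space $\gamma$. For nonzero $n\in\omega$, $\mathsf L_n:=\mathsf L(\beta(\omega^n))$. Every nonzero ordinal $\gamma$ is uniquely written in Cantor normal form $\gamma=\omega^{\alpha_k}n_k+\cdots+\omega^{\alpha_1}n_1$ with $0\neq k\in\omega$, each $n_i$ nonzero and finite, and ordinals $0\le\alpha_1<\cdots<\alpha_k$. $\mathsf{S4.Grz}$ is the least normal modal logic containing $\mathsf{S4}$ and $\Box(\Box(p\to\Box p)\to p)\to p$. For nonzero $n\in\omega$, $\mathsf{S4.Grz}_n$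 is the least normal modal logic containing $\mathsf{S4.Grz}$ and $\mathsf{bd}_n$, where $\mathsf{bd}_1=\Diamond\Box p_1\to p_1$ and $\mathsf{bd}_{n+1}=\Diamond(\Box p_{n+1}\wedge\neg\mathsf{bd}_n)\to p_{n+1}$. *)

theory Defs
  imports "HOL-Analysis.Analysis"
begin

section \<open>Modal formulas and normal modal logics\<close>

datatype fm = Var nat | Bot | Imp fm fm | Box fm

abbreviation Neg :: "fm \<Rightarrow> fm" where "Neg a \<equiv> Imp a Bot"
abbreviation And :: "fm \<Rightarrow> fm \<Rightarrow> fm" where "And a b \<equiv> Neg (Imp a (Neg b))"
abbreviation Dia :: "fm \<Rightarrow> fm" where "Dia a \<equiv> Neg (Box (Neg a))"

primrec subst :: "(nat \<Rightarrow> fm) \<Rightarrow> fm \<Rightarrow> fm" where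
  "subst \<sigma> (Var p) = \<sigma> p"
| "subst \<sigma> Bot = Bot"
| "subst \<sigma> (Imp a b) = Imp (subst \<sigma> a) (subst \<sigma> b)"
| "subst \<sigma> (Box a) = Box (subst \<sigma> a)"

text \<open>Truth value when variables and boxed formulas are treated as propositional atoms.\<close>

primrec prop_true :: "(fm \<Rightarrow> bool) \<Rightarrow> fm \<Rightarrow> bool" where
  "prop_true v (Var p) \<longleftrightarrow> v (Var p)"
| "prop_true v Bot \<longleftrightarrow> False"
| "prop_true v (Imp a b) \<longleftrightarrow> (prop_true v a \<longrightarrow> prop_true v b)"
| "prop_true v (Box a) \<longleftrightarrow> v (Box a)"

definition tautology :: "fm \<Rightarrow> bool" where
  "tautology a \<longleftrightarrow> (\<forall>v. prop_true v a)"

definition normal_logic :: "fm set \<Rightarrow> bool" where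
  "normal_logic L \<longleftrightarrow>
     (\<forall>a. tautology a \<longrightarrow> a \<in> L) \<and>
     (\<forall>a b. Imp (Box (Imp a b)) (Imp (Box a) (Box b)) \<in> L) \<and>
     (\<forall>a b. a \<in> L \<longrightarrow> Imp a b \<in> L \<longrightarrow> b \<in> L) \<and>
     (\<forall>a. a \<in> L \<longrightarrow> Box a \<in> L) \<and>
     (\<forall>\<sigma> a. a \<in> L \<longrightarrow> subst \<sigma> a \<in> L)"

definition least_normal_logic :: "fm set \<Rightarrow> fm set" where
  "least_normal_logic A = \<Inter>{L. normal_logic L \<and> A \<subseteq> L}"

definition S4 :: "fm set" where
  "S4 = least_normal_logic
     {Imp (Box (Var 0)) (Var 0), Imp (Box (Var 0)) (Box (Box (Var 0)))}"

definition logic_above_S4 :: "fm set \<Rightarrow> bool" where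
  "logic_above_S4 L \<longleftrightarrow> normal_logic L \<and> S4 \<subseteq> L"

definition grz :: fm where
  "grz = Imp (Box (Imp (Box (Imp (Var 0) (Box (Var 0)))) (Var 0))) (Var 0)"

definition S4Grz :: "fm set" where
  "S4Grz = least_normal_logic (insert grz S4)"

text \<open>Only \<^term>\<open>bd n\<close> with \<^term>\<open>n > 0\<close> is meaningful; the value at \<^term>\<open>0::nat\<close> is a dummy.\<close>

fun bd :: "nat \<Rightarrow> fm" where
  "bd 0 = Bot"
| "bd (Suc 0) = Imp (Dia (Box (Var 1))) (Var 1)"
| "bd (Suc (Suc n)) =
     Imp (Dia (And (Box (Var (Suc (Suc n)))) (Neg (bd (Suc n))))) (Var (Suc (Suc n)))"

definition S4Grz_bd :: "nat \<Rightarrow> fm set" where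
  "S4Grz_bd n = least_normal_logic (insert (bd n) S4Grz)"


section \<open>Topological semantics\<close>

primrec eval :: "'a topology \<Rightarrow> (nat \<Rightarrow> 'a set) \<Rightarrow> fm \<Rightarrow> 'a set" where
  "eval X V (Var p) = V p"
| "eval X V Bot = {}"
| "eval X V (Imp a b) = (topspace X - eval X V a) \<union> eval X V b"
| "eval X V (Box a) = X interior_of (eval X V a)"

lemma eval_subset_topspace:
  assumes "\<And>p. V p \<subseteq> topspace X"
  shows "eval X V a \<subseteq> topspace X"
  using assms by (induction a) (auto simp: interior_of_subset_topspace)

lemma eval_Dia:
  "eval X V (Dia a) = X closure_of (eval X V a)"
  by (simp add: closure_of_interior_of)

definition logic_of :: "'a topology \<Rightarrow> fm set" where
  "logic_of X = {a. \<forall>V. (\<forall>p. V p \<subseteq> topspace X) \<longrightarrow> eval X V a = topspace X}"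


section \<open>Ordinals, represented by well-orders\<close>

text \<open>
  An ordinal is given by a well-order \<^term>\<open>r\<close> on its field, considered up to the order
  isomorphism \<^term>\<open>ordIso\<close> of the library; \<^term>\<open>ordLess\<close> is the strict order of ordinals.
  The interval topology is generated by the open rays.

  HOL has no type of all ordinals: well-orders on a type \<open>'a\<close> represent exactly the ordinals of
  cardinality at most that of \<open>'a\<close>.  A statement about all ordinals has to be polymorphic in \<open>'a\<close>;
  infinite \<open>'a\<close> suffice, as they provide all finite and all countable ordinals.
\<close>

definition interval_topology :: "'a rel \<Rightarrow> 'a topology" where
  "interval_topology r = topology_generated_by
     (insert (Field r) (Order_Relation.underS r ` Field r \<union> Order_Relation.aboveS r ` Field r))"

text \<open>Ordinal sum of a finite list of ordinals, the first summand being the initial segment.\<close>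

definition ord_sum :: "'a rel list \<Rightarrow> (nat \<times> 'a) rel" where
  "ord_sum rs = {((i, x), (j, y)). i < length rs \<and> j < length rs \<and>
     x \<in> Field (rs ! i) \<and> y \<in> Field (rs ! j) \<and> (i < j \<or> i = j \<and> (x, y) \<in> rs ! i)}"

definition ord_times :: "'a rel \<Rightarrow> nat \<Rightarrow> (nat \<times> 'a) rel" where
  "ord_times r n = ord_sum (replicate n r)"

text \<open>
  The power of \<open>\<omega>\<close> with exponent \<^term>\<open>r\<close>: functions of finite support from \<^term>\<open>Field r\<close>
  to the natural numbers (extended by zero), compared at the largest argument where they differ.
\<close>

definition omega_power :: "'a rel \<Rightarrow> ('a \<Rightarrow> nat) rel" where
  "omega_power r = {(f, g).
     (\<forall>h\<in>{f, g}. finite {x. h x \<noteq> 0} \<and> {x. h x \<noteq> 0} \<subseteq> Field r) \<and>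
     (f = g \<or> (\<exists>z\<in>Field r. f z < g z \<and> (\<forall>x. (z, x) \<in> r \<and> x \<noteq> z \<longrightarrow> f x = g x)))}"

text \<open>
  \<^term>\<open>cs\<close> lists the pairs of exponents and coefficients from left to right, so the exponents
  decrease and the least one is \<^term>\<open>fst (last cs)\<close>.  The exponents of an ordinal do not exceed
  it, so they can be taken to be well-orders on the same type.
\<close>

definition cantor_normal_form :: "'a rel \<Rightarrow> ('a rel \<times> nat) list \<Rightarrow> bool" where
  "cantor_normal_form \<gamma> cs \<longleftrightarrow>
     cs \<noteq> [] \<and>
     (\<forall>(\<alpha>, n)\<in>set cs. Well_order \<alpha> \<and> 0 < n) \<and>
     sorted_wrt (\<lambda>c c'. (fst c', fst c) \<in> ordLess) cs \<and>
     (\<gamma>, ord_sum (map (\<lambda>(\<alpha>, n). ord_times (omega_power \<alpha>) n) cs)) \<in> ordIso"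

definition least_exponent_finite :: "'a rel \<Rightarrow> bool" where
  "least_exponent_finite \<gamma> \<longleftrightarrow> (\<exists>cs. cantor_normal_form \<gamma> cs \<and> finite (Field (fst (last cs))))"


section \<open>The Cech-Stone compactification\<close>

text \<open>
  The closure of the image of a space in the cube \<open>[0,1]\<^sup>C\<close> under evaluation, where \<open>C\<close> is the set of
  continuous functions into the unit interval.  Functions are taken to be extensional, so that
  each continuous function on the space gives exactly one coordinate.
\<close>

definition unit_functions :: "'a topology \<Rightarrow> ('a \<Rightarrow> real) set" where
  "unit_functions X = {f \<in> extensional (topspace X). continuous_map X (top_of_set {0..1}) f}"

definition stone_cech :: "'a topology \<Rightarrow> (('a \<Rightarrow> real) \<Rightarrow> real) topology" where
  "stone_cech X =
     (let cube = product_topology (\<lambda>_. top_of_set {0..1}) (unit_functions X)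
      in subtopology cube
           (cube closure_of ((\<lambda>x. \<lambda>f\<in>unit_functions X. f x) ` topspace X)))"

abbreviation \<beta> :: "'a rel \<Rightarrow> (('a \<Rightarrow> real) \<Rightarrow> real) topology" where
  "\<beta> \<gamma> \<equiv> stone_cech (interval_topology \<gamma>)"

definition L_omega :: "nat \<Rightarrow> fm set" where
  "L_omega n = logic_of (\<beta> (omega_power (natLeq_on n)))"

end

theory Submission
  imports Defs
begin

text \<open>
  The compactifications \<open>\<beta>(\<omega>\<^sup>m)\<close> never have to be understood. Let the last block of an ordinal, in its
  Cantor normal form, be a copy of \<open>\<omega>\<^sup>m\<close> that starts at the point \<open>p\<close>. The ordinal is the topological sum
  of \<open>[0, p]\<close> and the points above \<open>p\<close>. The Cech-Stone compactification preserves such sums, the logic of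
  a sum is the intersection of the logics of its parts, and \<open>[0, p]\<close> is compact. So the logic in
  question is \<open>L([0, p]) \<inter> L(\<beta>(B))\<close>, where \<open>B\<close> is \<open>\<omega>\<^sup>m\<close> without its least element. Splitting \<open>\<omega>\<^sup>m\<close> itself
  at its least element shows that \<open>L_omega m\<close> is the logic of a point intersected with \<open>L(\<beta>(B))\<close>. As
  \<open>L([0, p])\<close> is contained in the logic of a point, the logic in question is \<open>L([0, p]) \<inter> L_omega m\<close>
  (\<open>logic_of_final_block\<close>).

  What remains are the logics of the interval topologies of arbitrary nonempty well-orders
  (\<open>logic_of_cases\<close>). Such a space is scattered, so it validates \<open>S4Grz\<close>, and it validates \<open>bd n\<close> if its
  \<open>n\<close>-th Cantor-Bendixson derivative is empty. Conversely, if the \<open>k\<close>-th derivative is nonempty, every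
  formula outside \<open>S4Grz_bd (k + 1)\<close> is refuted: starting from a maximal consistent theory at a point of
  rank \<open>k\<close>, maximal consistent theories are assigned to the points below by recursion on the rank
  (\<open>realize\<close>), a failing box at a limit point being witnessed cofinally often. The axiom \<open>bd (k + 1)\<close>
  bounds the number of nested witnesses by \<open>k\<close>; without it, Grzegorczyk's axiom bounds the number by
  the number of boxed subformulas, which suffices if all derivatives are nonempty.

  Finally, the point at the end of a block \<open>\<omega>\<^sup>a\<close> has rank \<open>a\<close> if \<open>a\<close> is finite, and it belongs to all finite
  derivatives otherwise (\<open>block_end_derived\<close>, \<open>derived_block_empty\<close>). Since the exponents of a normal form
  decrease, this gives \<open>m < n\<close> in the mixed case, and \<open>\<omega>\<^sup>a + \<omega>\<^sup>m\<close> realizes all logics in the list except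
  \<open>L_omega m\<close>, which belongs to \<open>\<omega>\<^sup>m\<close>.
\<close>

section \<open>Maximal consistent theories\<close>

lemma normal_least_normal_logic: "normal_logic (least_normal_logic A)"
  unfolding normal_logic_def least_normal_logic_def by blast

lemma least_normal_logic_upper: "A \<subseteq> least_normal_logic A"
  unfolding least_normal_logic_def by blast

lemma least_normal_logic_least:
  "normal_logic L \<Longrightarrow> A \<subseteq> L \<Longrightarrow> least_normal_logic A \<subseteq> L"
  unfolding least_normal_logic_def by blast

definition theory_over :: "fm set \<Rightarrow> fm set \<Rightarrow> bool" where
  "theory_over L T \<longleftrightarrow> L \<subseteq> T \<and> (\<forall>a b. a \<in> T \<longrightarrow> Imp a b \<in> T \<longrightarrow> b \<in> T)"

definition mcs :: "fm set \<Rightarrow> fm set \<Rightarrow> bool" where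
  "mcs L w \<longleftrightarrow> theory_over L w \<and> Bot \<notin> w \<and> (\<forall>a. a \<in> w \<or> Neg a \<in> w)"

definition acc :: "fm set \<Rightarrow> fm set \<Rightarrow> bool" where
  "acc w x \<longleftrightarrow> (\<forall>a. Box a \<in> w \<longrightarrow> a \<in> x)"

lemma theory_over_mp: "theory_over L T \<Longrightarrow> Imp a b \<in> T \<Longrightarrow> a \<in> T \<Longrightarrow> b \<in> T"
  unfolding theory_over_def by blast

locale grz_logic =
  fixes L :: "fm set"
  assumes normal: "normal_logic L" and S4Grz_subset: "S4Grz \<subseteq> L"
begin

lemma taut: "tautology a \<Longrightarrow> a \<in> L"
  and K: "Imp (Box (Imp a b)) (Imp (Box a) (Box b)) \<in> L"
  and mp: "Imp a b \<in> L \<Longrightarrow> a \<in> L \<Longrightarrow> b \<in> L"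
  and nec: "a \<in> L \<Longrightarrow> Box a \<in> L"
  and subst: "a \<in> L \<Longrightarrow> subst \<sigma> a \<in> L"
  using normal unfolding normal_logic_def by blast+

lemma axioms_mem:
  "Imp (Box (Var 0)) (Var 0) \<in> L" "Imp (Box (Var 0)) (Box (Box (Var 0))) \<in> L" "grz \<in> L"
proof -
  have "insert grz S4 \<subseteq> L"
    using least_normal_logic_upper S4Grz_subset unfolding S4Grz_def by (rule order_trans)
  moreover have "{Imp (Box (Var 0)) (Var 0), Imp (Box (Var 0)) (Box (Box (Var 0)))} \<subseteq> S4"
    unfolding S4_def by (rule least_normal_logic_upper)
  ultimately show "Imp (Box (Var 0)) (Var 0) \<in> L"
    "Imp (Box (Var 0)) (Box (Box (Var 0))) \<in> L" "grz \<in> L" by blast+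
qed

lemma T: "Imp (Box a) a \<in> L"
  using subst[OF axioms_mem(1), of "\<lambda>_. a"] by simp

lemma four: "Imp (Box a) (Box (Box a)) \<in> L"
  using subst[OF axioms_mem(2), of "\<lambda>_. a"] by simp

lemma Grz: "Imp (Box (Imp (Box (Imp a (Box a))) a)) a \<in> L"
  using subst[OF axioms_mem(3), of "\<lambda>_. a"] by (simp add: grz_def)

lemma theory_taut: "theory_over L T \<Longrightarrow> tautology a \<Longrightarrow> a \<in> T"
  using taut unfolding theory_over_def by blast

text \<open>
  Adjoining \<open>a\<close> to a theory \<open>T\<close> gives \<open>{b. Imp a b \<in> T}\<close>; in this form the deduction
  theorem is built in.
\<close>

lemma theory_adjoin:
  assumes T: "theory_over L T"
  shows "theory_over L {b. Imp a b \<in> T}" "T \<subseteq> {b. Imp a b \<in> T}" "Imp a a \<in> T"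
proof -
  show sub: "T \<subseteq> {b. Imp a b \<in> T}"
  proof
    fix b assume b: "b \<in> T"
    have "Imp b (Imp a b) \<in> T" by (rule theory_taut[OF T]) (simp add: tautology_def)
    then show "b \<in> {b. Imp a b \<in> T}" using theory_over_mp[OF T] b by blast
  qed
  have "Imp a c \<in> T" if "Imp a b \<in> T" "Imp a (Imp b c) \<in> T" for b c
  proof -
    have "Imp (Imp a (Imp b c)) (Imp (Imp a b) (Imp a c)) \<in> T"
      by (rule theory_taut[OF T]) (simp add: tautology_def)
    then show ?thesis using theory_over_mp[OF T] that by blast
  qed
  then show "theory_over L {b. Imp a b \<in> T}"
    using sub T unfolding theory_over_def by blast
  show "Imp a a \<in> T" by (rule theory_taut[OF T]) (simp add: tautology_def)
qed

text \<open>
  A maximal theory omitting \<open>a\<close> is complete: if it contained neither \<open>b\<close> nor its negation, adjoining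
  either would yield \<open>a\<close>, and then \<open>a\<close> would follow outright.
\<close>

lemma lindenbaum:
  assumes T: "theory_over L T" and a: "a \<notin> T"
  obtains w where "mcs L w" "T \<subseteq> w" "a \<notin> w"
proof -
  let ?A = "{S. theory_over L S \<and> T \<subseteq> S \<and> a \<notin> S}"
  have "\<exists>M\<in>?A. \<forall>X\<in>?A. M \<subseteq> X \<longrightarrow> X = M"
  proof (rule subset_Zorn_nonempty)
    show "?A \<noteq> {}" using T a by blast
    fix C assume C: "C \<noteq> {}" "subset.chain ?A C"
    have mem: "S \<in> C \<Longrightarrow> theory_over L S \<and> T \<subseteq> S \<and> a \<notin> S" for S
      using C(2) by (auto simp: subset_chain_def)
    have "c \<in> \<Union>C" if b: "b \<in> \<Union>C" and bc: "Imp b c \<in> \<Union>C" for b c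
    proof -
      obtain S S' where S: "S \<in> C" "b \<in> S" "S' \<in> C" "Imp b c \<in> S'" using b bc by blast
      then have "S \<subseteq> S' \<or> S' \<subseteq> S" using C(2) by (auto simp: subset_chain_def)
      then obtain S'' where "S'' \<in> C" "b \<in> S''" "Imp b c \<in> S''" using S by blast
      then show ?thesis using mem theory_over_mp by blast
    qed
    moreover have "L \<subseteq> \<Union>C" "T \<subseteq> \<Union>C" "a \<notin> \<Union>C"
      using C(1) mem unfolding theory_over_def by blast+
    ultimately show "\<Union>C \<in> ?A" unfolding theory_over_def by blast
  qed
  then obtain M where "M \<in> ?A" and max: "\<forall>X\<in>?A. M \<subseteq> X \<longrightarrow> X = M" by (elim bexE)
  then have M: "theory_over L M" "T \<subseteq> M" "a \<notin> M" by simp_all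
  have imp: "Imp b a \<in> M" if "b \<notin> M" for b
  proof (rule ccontr)
    assume a: "Imp b a \<notin> M"
    note adj = theory_adjoin[OF M(1), of b]
    have "{c. Imp b c \<in> M} \<in> ?A" using adj(1,2) M(2) a by simp
    then have "{c. Imp b c \<in> M} = M" using bspec[OF max] adj(2) by simp
    then show False using adj(3) that by blast
  qed
  have "Neg b \<in> M" if "b \<notin> M" for b
  proof (rule ccontr)
    assume "Neg b \<notin> M"
    moreover have "Imp (Imp b a) (Imp (Imp (Neg b) a) a) \<in> M"
      by (rule theory_taut[OF M(1)]) (auto simp: tautology_def)
    ultimately show False using imp that theory_over_mp[OF M(1)] M(3) by blast
  qed
  moreover have "Bot \<notin> M"
  proof
    assume "Bot \<in> M"
    moreover have "Imp Bot a \<in> M"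
      by (rule theory_taut[OF M(1)]) (simp add: tautology_def)
    ultimately show False using theory_over_mp[OF M(1)] M(3) by blast
  qed
  ultimately have "mcs L M" using M(1) by (auto simp: mcs_def)
  then show ?thesis using that M by blast
qed

context
  fixes w assumes w: "mcs L w"
begin

lemma mcs_theory: "theory_over L w" using w by (simp add: mcs_def)

lemma mcs_L: "a \<in> L \<Longrightarrow> a \<in> w" using mcs_theory unfolding theory_over_def by blast

lemma mcs_mp: "Imp a b \<in> w \<Longrightarrow> a \<in> w \<Longrightarrow> b \<in> w" using mcs_theory theory_over_mp by blast

lemma mcs_Bot: "Bot \<notin> w" using w by (simp add: mcs_def)

lemma mcs_Imp: "Imp a b \<in> w \<longleftrightarrow> (a \<in> w \<longrightarrow> b \<in> w)"
proof
  assume *: "a \<in> w \<longrightarrow> b \<in> w"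
  show "Imp a b \<in> w"
  proof (cases "a \<in> w")
    case True
    moreover have "Imp b (Imp a b) \<in> w"
      by (rule theory_taut[OF mcs_theory]) (simp add: tautology_def)
    ultimately show ?thesis using * mcs_mp by blast
  next
    case False
    moreover have "Imp (Neg a) (Imp a b) \<in> w"
      by (rule theory_taut[OF mcs_theory]) (simp add: tautology_def)
    ultimately show ?thesis using w mcs_mp unfolding mcs_def by blast
  qed
qed (use mcs_mp in blast)

lemma mcs_T: "Box a \<in> w \<Longrightarrow> a \<in> w"
  using mcs_mp mcs_L[OF T] by blast

lemma mcs_four: "Box a \<in> w \<Longrightarrow> Box (Box a) \<in> w"
  using mcs_mp mcs_L[OF four] by blast

lemma theory_unbox: "theory_over L {a. Box a \<in> w}"
  unfolding theory_over_def
proof (intro conjI allI impI subsetI)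
  show "a \<in> {a. Box a \<in> w}" if "a \<in> L" for a using mcs_L[OF nec[OF that]] by simp
  show "b \<in> {a. Box a \<in> w}" if "a \<in> {a. Box a \<in> w}" "Imp a b \<in> {a. Box a \<in> w}" for a b
    using mcs_mp[OF mcs_mp[OF mcs_L[OF K]]] that by simp
qed

text \<open>
  Where \<open>Box B\<close> fails, Grzegorczyk's axiom provides a successor at which the argument \<open>B\<close> fails for
  the last time: no world above it can lose \<open>B\<close> again.
\<close>

lemma grz_witness:
  assumes B: "Box B \<notin> w"
  obtains x where "mcs L x" "acc w x" "B \<notin> x" "Box (Imp B (Box B)) \<in> x"
proof -
  let ?T = "{a. Box a \<in> w}" and ?G = "Box (Imp B (Box B))"
  have "Imp ?G B \<notin> ?T"
  proof
    assume "Imp ?G B \<in> ?T"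
    then have "Box (Box (Imp ?G B)) \<in> w" using mcs_four by simp
    moreover have "Box (Imp (Box (Imp ?G B)) B) \<in> w" by (intro mcs_L nec Grz)
    ultimately show False using mcs_mp[OF mcs_mp[OF mcs_L[OF K]]] B by blast
  qed
  then have "B \<notin> {b. Imp ?G b \<in> ?T}" by simp
  from lindenbaum[OF theory_adjoin(1)[OF theory_unbox] this]
  obtain x where x: "mcs L x" "{b. Imp ?G b \<in> ?T} \<subseteq> x" "B \<notin> x" by blast
  moreover have "acc w x"
    using x(2) theory_adjoin(2)[OF theory_unbox, of ?G] unfolding acc_def by blast
  moreover have "?G \<in> x" using x(2) theory_adjoin(3)[OF theory_unbox, of ?G] by blast
  ultimately show ?thesis using that by blast
qed

end

lemma acc_refl: "mcs L w \<Longrightarrow> acc w w"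
  using mcs_T by (auto simp: acc_def)

lemma acc_trans: "mcs L w \<Longrightarrow> acc w x \<Longrightarrow> acc x y \<Longrightarrow> acc w y"
  using mcs_four by (auto simp: acc_def)


subsection \<open>Chains of selected successors\<close>

text \<open>
  A step from \<open>w\<close> to \<open>x\<close> explains the failure of one box \<open>Box B\<close> with \<open>B \<in> \<Phi>\<close>, by a successor as in
  \<open>grz_witness\<close>. Such a step cannot be undone: \<open>B \<rightarrow> \<box>B\<close> is necessary at \<open>x\<close> but false at \<open>w\<close>, so
  for finite \<open>\<Phi>\<close> chains of steps are finite even where the canonical accessibility relation has
  proper clusters.
\<close>

definition selects :: "fm set \<Rightarrow> fm set \<Rightarrow> fm set \<Rightarrow> bool" where
  "selects \<Phi> w x \<longleftrightarrow> mcs L x \<and> acc w x \<and>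
     (\<exists>B\<in>\<Phi>. B \<in> w \<and> Box B \<notin> w \<and> B \<notin> x \<and> Box (Imp B (Box B)) \<in> x)"

fun height_le :: "fm set \<Rightarrow> nat \<Rightarrow> fm set \<Rightarrow> bool" where
  "height_le \<Phi> 0 w \<longleftrightarrow> (\<forall>x. \<not> selects \<Phi> w x)"
| "height_le \<Phi> (Suc k) w \<longleftrightarrow> (\<forall>x. selects \<Phi> w x \<longrightarrow> height_le \<Phi> k x)"

text \<open>
  Each step adds a formula \<open>\<box>(B \<rightarrow> \<box>B)\<close> with \<open>B \<in> \<Phi>\<close>, which all later worlds keep.
\<close>

lemma height_le_card:
  assumes "finite \<Phi>" "mcs L w" "card {B\<in>\<Phi>. Box (Imp B (Box B)) \<notin> w} \<le> k"
  shows "height_le \<Phi> k w"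
  using assms(2,3)
proof (induction k arbitrary: w)
  case 0
  have "Box (Imp B (Box B)) \<in> w" if "B \<in> \<Phi>" for B using 0(2) assms(1) that by auto
  then have "\<not> selects \<Phi> w x" for x
    using mcs_T[OF 0(1)] mcs_Imp[OF 0(1)] unfolding selects_def by blast
  then show ?case by simp
next
  case (Suc k)
  show ?case unfolding height_le.simps
  proof (intro allI impI)
    fix x assume x: "selects \<Phi> w x"
    then obtain B where B: "B \<in> \<Phi>" "B \<in> w" "Box B \<notin> w" "Box (Imp B (Box B)) \<in> x"
      and acc: "mcs L x" "acc w x"
      unfolding selects_def by blast
    let ?S = "\<lambda>w. {B\<in>\<Phi>. Box (Imp B (Box B)) \<notin> w}"
    have "B \<in> ?S w" using B mcs_T[OF Suc(2)] mcs_Imp[OF Suc(2)] by blast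
    moreover have "?S x \<subseteq> ?S w" using acc(2) mcs_four[OF Suc(2)] by (auto simp: acc_def)
    ultimately have "?S x \<subset> ?S w" using B by blast
    then have "card (?S x) < card (?S w)" using assms(1) by (intro psubset_card_mono) auto
    then show "height_le \<Phi> k x" using Suc acc by auto
  qed
qed

lemma subst_bd_cong:
  "(\<And>p. p \<le> n \<Longrightarrow> \<sigma> p = \<tau> p) \<Longrightarrow> subst \<sigma> (bd n) = subst \<tau> (bd n)"
  by (induction n rule: bd.induct) auto

lemma selects_diamond:
  assumes w: "mcs L w" and x: "selects \<Phi> w x"
  obtains A where "Box A \<in> x" "A \<notin> w"
  using assms mcs_Imp[OF w] unfolding selects_def by blast

text \<open>
  A chain of \<open>n\<close> selection steps refutes an instance of \<open>bd n\<close>: for a step from \<open>w\<close> to \<open>x\<close> by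
  \<open>B\<close>, the formula \<open>B \<rightarrow> \<box>B\<close> is necessary at \<open>x\<close> but false at \<open>w\<close>.
\<close>

lemma bd_fails:
  assumes "mcs L w" "\<not> height_le \<Phi> k w"
  shows "\<exists>\<sigma>. subst \<sigma> (bd (Suc k)) \<notin> w"
  using assms
proof (induction k arbitrary: w)
  case 0
  then obtain x where x: "selects \<Phi> w x" by auto
  then have m: "mcs L x" and acc: "acc w x" by (auto simp: selects_def)
  obtain A where A: "Box A \<in> x" "A \<notin> w" by (rule selects_diamond[OF 0(1) x])
  have "Box (Neg (Box A)) \<notin> w"
    using acc A(1) mcs_Imp[OF m] mcs_Bot[OF m] by (auto simp: acc_def)
  then have "subst (\<lambda>_. A) (bd (Suc 0)) \<notin> w"
    using A mcs_Imp[OF 0(1)] by auto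
  then show ?case by blast
next
  case (Suc k)
  then obtain x where x: "selects \<Phi> w x" "\<not> height_le \<Phi> k x" by auto
  then have m: "mcs L x" and acc: "acc w x" by (auto simp: selects_def)
  obtain A where A: "Box A \<in> x" "A \<notin> w" by (rule selects_diamond[OF Suc(2) x(1)])
  obtain \<sigma> where \<sigma>: "subst \<sigma> (bd (Suc k)) \<notin> x" using Suc.IH[OF m x(2)] by blast
  let ?\<tau> = "\<sigma>(Suc (Suc k) := A)"
  have "subst ?\<tau> (bd (Suc k)) = subst \<sigma> (bd (Suc k))" by (rule subst_bd_cong) auto
  then have "subst ?\<tau> (Neg (And (Box (Var (Suc (Suc k)))) (Neg (bd (Suc k))))) \<notin> x"
    using A \<sigma> mcs_Imp[OF m] mcs_Bot[OF m] by simp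
  then have "Box (subst ?\<tau> (Neg (And (Box (Var (Suc (Suc k)))) (Neg (bd (Suc k)))))) \<notin> w"
    using acc by (auto simp: acc_def)
  then have "subst ?\<tau> (bd (Suc (Suc k))) \<notin> w"
    using A(2) mcs_Imp[OF Suc(2)] by simp
  then show ?case by blast
qed

corollary height_le_bd:
  assumes "bd (Suc k) \<in> L" "mcs L w"
  shows "height_le \<Phi> k w"
proof (rule ccontr)
  assume "\<not> height_le \<Phi> k w"
  then obtain \<sigma> where "subst \<sigma> (bd (Suc k)) \<notin> w" using bd_fails[OF assms(2)] by blast
  then show False using mcs_L[OF assms(2) subst[OF assms(1)]] by blast
qed

end


section \<open>Logics of topological spaces\<close>

lemma prop_true_eval:
  "x \<in> topspace X \<Longrightarrow> prop_true (\<lambda>a. x \<in> eval X V a) a \<longleftrightarrow> x \<in> eval X V a"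
  by (induction a) auto

lemma eval_subst: "eval X V (subst \<sigma> a) = eval X (\<lambda>p. eval X V (\<sigma> p)) a"
  by (induction a) auto

lemma logic_of_iff:
  "a \<in> logic_of X \<longleftrightarrow>
     (\<forall>V x. (\<forall>p. V p \<subseteq> topspace X) \<longrightarrow> x \<in> topspace X \<longrightarrow> x \<in> eval X V a)"
  unfolding logic_of_def using eval_subset_topspace by blast

lemma normal_logic_of: "normal_logic (logic_of X)"
  unfolding normal_logic_def
proof (intro conjI allI impI)
  show "a \<in> logic_of X" if "tautology a" for a
    unfolding logic_of_iff using that prop_true_eval unfolding tautology_def by metis
  show "Imp (Box (Imp a b)) (Imp (Box a) (Box b)) \<in> logic_of X" for a b
  proof -
    have "X interior_of S \<inter> X interior_of T \<subseteq> X interior_of (S \<inter> T)" for S T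
      by (simp add: interior_of_Int)
    moreover have "((topspace X - A) \<union> B) \<inter> A \<subseteq> B" for A B by auto
    ultimately have "X interior_of ((topspace X - A) \<union> B) \<inter> X interior_of A \<subseteq> X interior_of B" for A B
      by (metis interior_of_mono order_trans)
    then show ?thesis by (auto simp: logic_of_iff)
  qed
  show "b \<in> logic_of X" if "a \<in> logic_of X" "Imp a b \<in> logic_of X" for a b
    using that unfolding logic_of_iff by auto
  show "Box a \<in> logic_of X" if "a \<in> logic_of X" for a
    using that by (simp add: logic_of_def)
  show "subst \<sigma> a \<in> logic_of X" if "a \<in> logic_of X" for \<sigma> a
    unfolding logic_of_def
  proof (intro CollectI allI impI)
    fix V :: "nat \<Rightarrow> 'a set" assume "\<forall>p. V p \<subseteq> topspace X"
    then have "eval X V (\<sigma> p) \<subseteq> topspace X" for p using eval_subset_topspace by metis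
    then show "eval X V (subst \<sigma> a) = topspace X" using that by (simp add: logic_of_def eval_subst)
  qed
qed

lemma S4_subset_logic_of: "S4 \<subseteq> logic_of X"
  unfolding S4_def
proof (rule least_normal_logic_least[OF normal_logic_of])
  show "{Imp (Box (Var 0)) (Var 0), Imp (Box (Var 0)) (Box (Box (Var 0)))} \<subseteq> logic_of X"
    using interior_of_subset by (fastforce simp: logic_of_iff)
qed

lemma eval_open_subspace:
  assumes "openin X U"
  shows "eval (subtopology X U) (\<lambda>p. V p \<inter> U) a = U \<inter> eval X V a"
proof (induction a)
  case (Imp a b)
  then show ?case using openin_subset[OF assms] by auto
next
  case (Box a)
  have "X interior_of (U \<inter> eval X V a) = U \<inter> X interior_of eval X V a"
    using assms by (simp add: interior_of_Int interior_of_openin)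
  then show ?case using Box interior_of_subtopology_open[OF assms] by simp
qed auto

lemma logic_of_open_subspace:
  assumes "openin X U"
  shows "logic_of X \<subseteq> logic_of (subtopology X U)"
proof
  fix a assume a: "a \<in> logic_of X"
  show "a \<in> logic_of (subtopology X U)"
    unfolding logic_of_iff
  proof (intro allI impI)
    fix V :: "nat \<Rightarrow> 'a set" and x
    assume V: "\<forall>p. V p \<subseteq> topspace (subtopology X U)" and x: "x \<in> topspace (subtopology X U)"
    have "V = (\<lambda>p. V p \<inter> U)" using V by auto
    then have "eval (subtopology X U) V a = U \<inter> eval X V a"
      using eval_open_subspace[OF assms, of V a] by simp
    then show "x \<in> eval (subtopology X U) V a" using a V x by (simp add: logic_of_iff)
  qed
qed

lemma logic_of_open_cover:
  assumes "openin X U" "openin X W" "U \<union> W = topspace X"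
  shows "logic_of X = logic_of (subtopology X U) \<inter> logic_of (subtopology X W)"
proof
  show "logic_of X \<subseteq> logic_of (subtopology X U) \<inter> logic_of (subtopology X W)"
    using logic_of_open_subspace[OF assms(1)] logic_of_open_subspace[OF assms(2)] by simp
next
  have *: "x \<in> eval X V a"
    if S: "openin X S" "a \<in> logic_of (subtopology X S)" "x \<in> S" and V: "\<forall>p. V p \<subseteq> topspace X" for a S x and V :: "nat \<Rightarrow> 'a set"
  proof -
    have "x \<in> eval (subtopology X S) (\<lambda>p. V p \<inter> S) a"
      using S(2)[unfolded logic_of_iff, THEN spec[of _ "\<lambda>p. V p \<inter> S"], THEN spec[of _ x]]
        V S(3) openin_subset[OF S(1)] by auto
    then show ?thesis using eval_open_subspace[OF S(1), of V a] by simp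
  qed
  show "logic_of (subtopology X U) \<inter> logic_of (subtopology X W) \<subseteq> logic_of X"
  proof
    fix a assume a: "a \<in> logic_of (subtopology X U) \<inter> logic_of (subtopology X W)"
    have "x \<in> eval X V a" if V: "\<forall>p. V p \<subseteq> topspace X" and x: "x \<in> topspace X"
      for x and V :: "nat \<Rightarrow> 'a set"
    proof (cases "x \<in> U")
      case True
      then show ?thesis using *[OF assms(1) _ _ V] a by blast
    next
      case False
      then have "x \<in> W" using x assms(3) by blast
      then show ?thesis using *[OF assms(2) _ _ V] a by blast
    qed
    then show "a \<in> logic_of X" by (simp add: logic_of_iff)
  qed
qed

lemma logic_of_homeomorphic_subset:
  assumes f: "homeomorphic_map X Y f"
  shows "logic_of Y \<subseteq> logic_of X"
proof
  fix a assume a: "a \<in> logic_of Y"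
  have inj: "inj_on f (topspace X)" and surj: "f ` topspace X = topspace Y"
    using f by (auto simp: homeomorphic_eq_everything_map)
  show "a \<in> logic_of X" unfolding logic_of_def
  proof (intro CollectI allI impI)
    fix V :: "nat \<Rightarrow> 'a set" assume V: "\<forall>p. V p \<subseteq> topspace X"
    then have sub: "eval X V b \<subseteq> topspace X" for b using eval_subset_topspace by metis
    have eq: "eval Y (\<lambda>p. f ` V p) b = f ` eval X V b" for b
    proof (induction b)
      case (Imp b c)
      have "f ` (topspace X - eval X V b) = topspace Y - f ` eval X V b"
        using inj_on_image_set_diff[OF inj] sub surj by (metis Diff_subset)
      then show ?case using Imp by (simp add: image_Un)
    next
      case (Box b)
      then show ?case using homeomorphic_map_interior_of[OF f sub] by simp
    qed auto
    have "\<forall>p. f ` V p \<subseteq> topspace Y" using V surj by (metis image_mono)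
    then have "eval Y (\<lambda>p. f ` V p) a = topspace Y" using a by (simp add: logic_of_def)
    then have "f ` eval X V a = f ` topspace X" using eq surj by simp
    then show "eval X V a = topspace X"
      using inj_on_image_eq_iff[OF inj sub order_refl] by blast
  qed
qed

lemma logic_of_homeomorphic:
  assumes "X homeomorphic_space Y" shows "logic_of X = logic_of Y"
proof -
  obtain f where "homeomorphic_map X Y f" using assms unfolding homeomorphic_space ..
  moreover obtain g where "homeomorphic_map Y X g"
    using iffD1[OF homeomorphic_space_sym assms] unfolding homeomorphic_space ..
  ultimately show ?thesis by (intro subset_antisym logic_of_homeomorphic_subset)
qed


section \<open>The Cech-Stone compactification of a topological sum\<close>

definition cube :: "'a topology \<Rightarrow> (('a \<Rightarrow> real) \<Rightarrow> real) topology" where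
  "cube X = product_topology (\<lambda>_. top_of_set {0..1}) (unit_functions X)"

definition evaluation :: "'a topology \<Rightarrow> 'a \<Rightarrow> ('a \<Rightarrow> real) \<Rightarrow> real" where
  "evaluation X x = (\<lambda>f\<in>unit_functions X. f x)"

lemma stone_cech_eq:
  "stone_cech X = subtopology (cube X) (cube X closure_of (evaluation X ` topspace X))"
  by (simp add: stone_cech_def cube_def evaluation_def Let_def)

lemma Hausdorff_cube: "Hausdorff_space (cube X)"
  by (simp add: cube_def Hausdorff_space_product_topology Hausdorff_space_subtopology)

lemma unit_function_continuous:
  "f \<in> unit_functions X \<Longrightarrow> continuous_map X (top_of_set {0..1}) f"
  by (simp add: unit_functions_def)

lemma continuous_evaluation: "continuous_map X (cube X) (evaluation X)"
  by (auto simp: cube_def evaluation_def continuous_map_componentwise unit_function_continuous)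

lemma continuous_cube_projection:
  "f \<in> unit_functions X \<Longrightarrow> continuous_map (cube X) (top_of_set {0..1}) (\<lambda>h. h f)"
  unfolding cube_def by (rule continuous_map_product_projection)

lemma clopen_unit_function:
  assumes A: "openin X A" "closedin X A"
    and g: "continuous_map (subtopology X A) (top_of_set {0..1}) g"
  shows "(\<lambda>x\<in>topspace X. if x \<in> A then g x else (0::real)) \<in> unit_functions X"
proof -
  have sub: "A \<subseteq> topspace X" using A openin_subset by blast
  then have eq: "{x \<in> topspace X. x \<in> A} = A" "{x \<in> topspace X. x \<notin> A} = topspace X - A" by auto
  have "continuous_map X (top_of_set {0..1}) (\<lambda>x. if x \<in> A then g x else 0)"
  proof (rule continuous_map_cases_alt)
    show "continuous_map (subtopology X (X closure_of {x \<in> topspace X. x \<in> A})) (top_of_set {0..1}) g"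
      unfolding eq using g A(2) by (simp add: closure_of_closedin)
    show "continuous_map (subtopology X (X closure_of {x \<in> topspace X. x \<notin> A}))
            (top_of_set {0..1}) (\<lambda>x. 0::real)"
      by simp
    show "g x = 0" if "x \<in> X frontier_of {x \<in> topspace X. x \<in> A}" for x
      using that A unfolding eq by (metis clopenin_eq_frontier_of empty_iff)
  qed
  then have "continuous_map X (top_of_set {0..1}) (\<lambda>x\<in>topspace X. if x \<in> A then g x else 0)"
    by (rule continuous_map_eq) auto
  then show ?thesis by (simp add: unit_functions_def)
qed

text \<open>
  Unit functions on a clopen part extend by zero, and unit functions on the whole space restrict.
  Both operations induce continuous maps between the cubes, which are inverse to each other on the
  images of the part and hence, the cubes being Hausdorff, on the closures of these images.
\<close>

lemma stone_cech_clopen_part: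
  assumes A: "openin X A" "closedin X A"
    and k: "homeomorphic_maps (subtopology X A) Y k k'"
  shows "subtopology (cube X) (cube X closure_of (evaluation X ` A)) homeomorphic_space stone_cech Y"
proof -
  define ext where "ext g = (\<lambda>x\<in>topspace X. if x \<in> A then g (k x) else (0::real))" for g
  define res where "res f = (\<lambda>y\<in>topspace Y. f (k' y) :: real)" for f
  have sub: "A \<subseteq> topspace X" using A openin_subset by blast
  then have top: "topspace (subtopology X A) = A" by auto
  have kc: "continuous_map (subtopology X A) Y k" and kc': "continuous_map Y (subtopology X A) k'"
    and kk': "\<And>x. x \<in> A \<Longrightarrow> k' (k x) = x" and k'k: "\<And>y. y \<in> topspace Y \<Longrightarrow> k (k' y) = y"
    using k top by (auto simp: homeomorphic_maps_def)
  have kA: "\<And>x. x \<in> A \<Longrightarrow> k x \<in> topspace Y" and k'A: "\<And>y. y \<in> topspace Y \<Longrightarrow> k' y \<in> A"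
    using kc kc' top by (fastforce simp: continuous_map_def)+
  have ext: "ext g \<in> unit_functions X" if "g \<in> unit_functions Y" for g
    unfolding ext_def
    using clopen_unit_function[OF A, of "g \<circ> k"]
      continuous_map_compose[OF kc unit_function_continuous[OF that]] unfolding comp_def by simp
  have res: "res f \<in> unit_functions Y" if "f \<in> unit_functions X" for f
  proof -
    have "continuous_map Y X k'" using kc' continuous_map_in_subtopology by blast
    then have "continuous_map Y (top_of_set {0..1}) (f \<circ> k')"
      using continuous_map_compose unit_function_continuous[OF that] by blast
    then have "continuous_map Y (top_of_set {0..1}) (res f)"
      by (rule continuous_map_eq) (auto simp: res_def)
    then show ?thesis by (auto simp: unit_functions_def res_def)
  qed
  define \<Phi> where "\<Phi> h = (\<lambda>g\<in>unit_functions Y. h (ext g))" for h :: "('a \<Rightarrow> real) \<Rightarrow> real"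
  define \<Psi> where "\<Psi> h = (\<lambda>f\<in>unit_functions X. h (res f))" for h :: "('b \<Rightarrow> real) \<Rightarrow> real"
  have \<Phi>c: "continuous_map (cube X) (cube Y) \<Phi>"
    unfolding cube_def[of Y] continuous_map_componentwise
    using continuous_cube_projection ext by (auto simp: \<Phi>_def)
  have \<Psi>c: "continuous_map (cube Y) (cube X) \<Psi>"
    unfolding cube_def[of X] continuous_map_componentwise
    using continuous_cube_projection res by (auto simp: \<Psi>_def)
  have \<Phi>e: "\<Phi> (evaluation X x) = evaluation Y (k x)" if "x \<in> A" for x
    using that ext sub by (auto simp: \<Phi>_def evaluation_def ext_def fun_eq_iff restrict_def)
  have \<Psi>e: "\<Psi> (evaluation Y y) = evaluation X (k' y)" if "y \<in> topspace Y" for y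
    using that res by (auto simp: \<Psi>_def evaluation_def res_def fun_eq_iff restrict_def)
  let ?CA = "cube X closure_of (evaluation X ` A)"
  let ?CY = "cube Y closure_of (evaluation Y ` topspace Y)"
  have "\<Phi> ` ?CA \<subseteq> cube Y closure_of \<Phi> ` evaluation X ` A"
    by (rule continuous_map_image_closure_subset[OF \<Phi>c])
  also have "\<dots> \<subseteq> ?CY" using \<Phi>e kA by (intro closure_of_mono) auto
  finally have \<Phi>CA: "\<Phi> ` ?CA \<subseteq> ?CY" .
  have "\<Psi> ` ?CY \<subseteq> cube X closure_of \<Psi> ` evaluation Y ` topspace Y"
    by (rule continuous_map_image_closure_subset[OF \<Psi>c])
  also have "\<dots> \<subseteq> ?CA" using \<Psi>e k'A by (intro closure_of_mono) auto
  finally have \<Psi>CY: "\<Psi> ` ?CY \<subseteq> ?CA" .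
  have \<Psi>\<Phi>: "\<Psi> (\<Phi> h) = h" if "h \<in> ?CA" for h
    using forall_in_closure_of_eq[OF that Hausdorff_cube continuous_map_compose[OF \<Phi>c \<Psi>c]
        continuous_map_id] \<Phi>e \<Psi>e kA kk' by force
  have \<Phi>\<Psi>: "\<Phi> (\<Psi> h) = h" if "h \<in> ?CY" for h
    using forall_in_closure_of_eq[OF that Hausdorff_cube continuous_map_compose[OF \<Psi>c \<Phi>c]
        continuous_map_id] \<Phi>e \<Psi>e k'A k'k by force
  have "homeomorphic_maps (subtopology (cube X) ?CA) (subtopology (cube Y) ?CY) \<Phi> \<Psi>"
    unfolding homeomorphic_maps_def
    using \<Phi>c \<Psi>c \<Phi>CA \<Psi>CY \<Psi>\<Phi> \<Phi>\<Psi>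
    by (auto simp: continuous_map_in_subtopology continuous_map_from_subtopology)
  then show ?thesis unfolding stone_cech_eq homeomorphic_space_def by blast
qed

text \<open>
  This is the case where the clopen part is the whole space.
\<close>

lemma stone_cech_homeomorphic:
  assumes "X homeomorphic_space Y"
  shows "stone_cech X homeomorphic_space stone_cech Y"
proof -
  obtain k k' where "homeomorphic_maps (subtopology X (topspace X)) Y k k'"
    using assms by (auto simp: homeomorphic_space_def)
  from stone_cech_clopen_part[OF openin_topspace closedin_topspace this]
  show ?thesis by (simp add: stone_cech_eq)
qed

text \<open>
  The coordinate of the indicator function of \<open>A\<close> separates the closures of the two images, so that
  the compactification is their disjoint union.
\<close>

lemma logic_of_stone_cech_clopen:
  assumes A: "openin X A" "closedin X A"
  shows "logic_of (stone_cech X) =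
    logic_of (stone_cech (subtopology X A)) \<inter>
    logic_of (stone_cech (subtopology X (topspace X - A)))"
proof -
  let ?B = "topspace X - A" and ?cl = "\<lambda>S. cube X closure_of (evaluation X ` S)"
  have sub: "A \<subseteq> topspace X" using A openin_subset by blast
  have B: "openin X ?B" "closedin X ?B" using A by auto
  define ind where "ind = (\<lambda>x\<in>topspace X. if x \<in> A then 1 else (0::real))"
  have ind: "ind \<in> unit_functions X"
    unfolding ind_def using clopen_unit_function[OF A, of "\<lambda>_. 1"] by simp
  have closed: "closedin (cube X) {h \<in> topspace (cube X). h ind = c}" if "c \<in> {0..1}" for c
  proof -
    have "closedin (top_of_set {0..1}) {c}" using that by (intro closed_subset) auto
    from closedin_continuous_map_preimage[OF continuous_cube_projection[OF ind] this]
    show ?thesis by simp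
  qed
  have evt: "evaluation X x \<in> topspace (cube X)" if "x \<in> topspace X" for x
    using continuous_evaluation that by (fastforce simp: continuous_map_def)
  have "?cl A \<subseteq> {h \<in> topspace (cube X). h ind = 1}"
    by (rule closure_of_minimal[OF _ closed]) (use sub evt ind in \<open>auto simp: evaluation_def ind_def\<close>)
  moreover have "?cl ?B \<subseteq> {h \<in> topspace (cube X). h ind = 0}"
    by (rule closure_of_minimal[OF _ closed]) (use evt ind in \<open>auto simp: evaluation_def ind_def\<close>)
  ultimately have disj: "?cl A \<inter> ?cl ?B = {}" by fastforce
  have "topspace X = A \<union> ?B" using sub by auto
  then have un: "?cl (topspace X) = ?cl A \<union> ?cl ?B" by (metis closure_of_Un image_Un)
  have top: "topspace (stone_cech X) = ?cl (topspace X)"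
    unfolding stone_cech_eq by (auto simp: closure_of_subset_topspace subsetD[OF closure_of_subset_topspace])
  have clo: "closedin (stone_cech X) (?cl A)" "closedin (stone_cech X) (?cl ?B)"
    unfolding stone_cech_eq using un by (auto intro!: closedin_subset_topspace)
  have op: "openin (stone_cech X) (?cl A)" "openin (stone_cech X) (?cl ?B)"
    using clo disj un top unfolding openin_closedin_eq by (metis Diff_Un Diff_cancel Diff_triv
        Int_commute Un_Diff Un_upper1 Un_upper2 sup_bot.left_neutral sup_bot.right_neutral)+
  have part: "logic_of (subtopology (stone_cech X) (?cl S)) = logic_of (stone_cech (subtopology X S))"
    if S: "openin X S" "closedin X S" for S
  proof -
    have "S \<subseteq> topspace X" using S openin_subset by blast
    then have "subtopology (stone_cech X) (?cl S) = subtopology (cube X) (?cl S)"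
      unfolding stone_cech_eq subtopology_subtopology
      by (metis closure_of_mono image_mono inf.absorb_iff2)
    moreover have "homeomorphic_maps (subtopology X S) (subtopology X S) id id"
      by (simp add: homeomorphic_maps_id)
    ultimately show ?thesis using logic_of_homeomorphic stone_cech_clopen_part[OF S] by metis
  qed
  show ?thesis
    using logic_of_open_cover[OF op] un top part[OF A] part[OF B] by simp
qed

text \<open>
  From a compact space into the Hausdorff cube, evaluation is a closed map, and it is injective
  because the unit functions separate points.
\<close>

lemma stone_cech_compact:
  assumes "compact_space X"
    and sep: "\<And>x y. x \<in> topspace X \<Longrightarrow> y \<in> topspace X \<Longrightarrow> x \<noteq> y \<Longrightarrow>
      \<exists>f\<in>unit_functions X. f x \<noteq> f y"
  shows "X homeomorphic_space stone_cech X"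
proof -
  let ?e = "evaluation X"
  have closed: "closed_map X (cube X) ?e"
    using continuous_imp_closed_map assms(1) Hausdorff_cube continuous_evaluation by blast
  have inj: "inj_on ?e (topspace X)"
  proof (rule inj_onI, rule ccontr)
    fix x y assume xy: "x \<in> topspace X" "y \<in> topspace X" "?e x = ?e y" "x \<noteq> y"
    then obtain f where "f \<in> unit_functions X" "f x \<noteq> f y" using sep by blast
    then show False using fun_cong[OF xy(3), of f] by (simp add: evaluation_def)
  qed
  have "closedin (cube X) (?e ` topspace X)" using closed by (simp add: closed_map_def)
  then have "stone_cech X = subtopology (cube X) (?e ` topspace X)"
    by (simp add: stone_cech_eq closure_of_closedin)
  then show ?thesis
    using embedding_map_imp_homeomorphic_space[OF
        injective_closed_imp_embedding_map[OF continuous_evaluation closed inj]] by simp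
qed


section \<open>The interval topology of a well-order\<close>

locale well_ordered_space =
  fixes r :: "'a rel"
  assumes well_order: "Well_order r"
begin

abbreviation le (infix "\<sqsubseteq>" 50) where "x \<sqsubseteq> y \<equiv> (x, y) \<in> r"

definition less (infix "\<sqsubset>" 50) where "x \<sqsubset> y \<longleftrightarrow> x \<sqsubseteq> y \<and> x \<noteq> y"

abbreviation T :: "'a topology" where "T \<equiv> interval_topology r"

lemma linear: "Linear_order r" using well_order by (simp add: well_order_on_def)

lemma le_trans: "x \<sqsubseteq> y \<Longrightarrow> y \<sqsubseteq> z \<Longrightarrow> x \<sqsubseteq> z"
  using linear unfolding order_on_defs trans_on_def by blast

lemma le_antisym: "x \<sqsubseteq> y \<Longrightarrow> y \<sqsubseteq> x \<Longrightarrow> x = y"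
  using linear unfolding order_on_defs antisym_on_def by blast

lemma le_refl: "x \<in> Field r \<Longrightarrow> x \<sqsubseteq> x"
  using linear unfolding order_on_defs refl_on_def by blast

lemma le_Field: "x \<sqsubseteq> y \<Longrightarrow> x \<in> Field r \<and> y \<in> Field r"
  by (auto simp: Field_def)

lemma less_Field: "x \<sqsubset> y \<Longrightarrow> x \<in> Field r \<and> y \<in> Field r"
  by (auto simp: less_def Field_def)

lemma le_total: "x \<in> Field r \<Longrightarrow> y \<in> Field r \<Longrightarrow> x \<sqsubseteq> y \<or> y \<sqsubset> x"
  using linear le_refl unfolding order_on_defs total_on_def less_def by metis

lemma less_trans: "x \<sqsubset> y \<Longrightarrow> y \<sqsubset> z \<Longrightarrow> x \<sqsubset> z"
  and le_less_trans: "x \<sqsubseteq> y \<Longrightarrow> y \<sqsubset> z \<Longrightarrow> x \<sqsubset> z"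
  and less_le_trans: "x \<sqsubset> y \<Longrightarrow> y \<sqsubseteq> z \<Longrightarrow> x \<sqsubset> z"
  unfolding less_def using le_trans le_antisym by metis+

lemma less_irrefl: "\<not> x \<sqsubset> x" by (simp add: less_def)

lemma less_imp_le: "x \<sqsubset> y \<Longrightarrow> x \<sqsubseteq> y" by (simp add: less_def)

lemma le_less: "x \<sqsubseteq> y \<longleftrightarrow> x \<sqsubset> y \<or> x = y \<and> x \<in> Field r"
  using le_refl le_Field unfolding less_def by blast

lemma not_less_le: "x \<sqsubset> y \<Longrightarrow> \<not> y \<sqsubseteq> x"
  using less_le_trans less_irrefl by blast

lemma ex_min:
  assumes "A \<subseteq> Field r" "A \<noteq> {}"
  obtains m where "m \<in> A" "\<And>a. a \<in> A \<Longrightarrow> m \<sqsubseteq> a"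
  using assms Linear_order_Well_order_iff[OF linear] well_order by metis

lemma less_induct [consumes 1, case_names less]:
  assumes "x \<in> Field r" "\<And>x. x \<in> Field r \<Longrightarrow> (\<And>y. y \<sqsubset> x \<Longrightarrow> P y) \<Longrightarrow> P x"
  shows "P x"
proof (rule ccontr)
  assume "\<not> P x"
  then have "{z \<in> Field r. \<not> P z} \<noteq> {}" using assms(1) by blast
  then obtain m where m: "m \<in> {z \<in> Field r. \<not> P z}" "\<And>a. a \<in> {z \<in> Field r. \<not> P z} \<Longrightarrow> m \<sqsubseteq> a"
    using ex_min[of "{z \<in> Field r. \<not> P z}"] by blast
  then have "P y" if "y \<sqsubset> m" for y using that less_Field not_less_le by blast
  then show False using m(1) assms(2) by blast
qed

lemma ex_max:
  assumes "y \<sqsubset> x" "z \<sqsubset> x"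
  obtains u where "y \<sqsubseteq> u" "z \<sqsubseteq> u" "u \<sqsubset> x" "u = y \<or> u = z"
  using assms le_total[of y z] le_refl less_Field less_imp_le by metis

lemma finite_max:
  assumes "finite A" "A \<noteq> {}" "A \<subseteq> Field r"
  shows "\<exists>m\<in>A. \<forall>a\<in>A. a \<sqsubseteq> m"
  using assms
proof (induction A rule: finite_ne_induct)
  case (singleton x)
  then show ?case using le_refl by auto
next
  case (insert x F)
  then obtain m where m: "m \<in> F" "\<forall>a\<in>F. a \<sqsubseteq> m" by auto
  then show ?case
    using insert.prems le_total[of x m] le_refl less_imp_le le_trans by (metis insert_iff subset_iff)
qed

lemma topspace [simp]: "topspace T = Field r"
  by (auto simp: interval_topology_def topology_generated_by_topspace underS_def aboveS_def Field_def)

lemma open_below: "y \<in> Field r \<Longrightarrow> openin T {z. z \<sqsubset> y}"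
  and open_above: "y \<in> Field r \<Longrightarrow> openin T {z. y \<sqsubset> z}"
proof -
  have "{z. z \<sqsubset> y} = underS r y" "{z. y \<sqsubset> z} = aboveS r y"
    by (auto simp: less_def underS_def aboveS_def)
  then show "y \<in> Field r \<Longrightarrow> openin T {z. z \<sqsubset> y}" "y \<in> Field r \<Longrightarrow> openin T {z. y \<sqsubset> z}"
    unfolding interval_topology_def by (auto intro!: topology_generated_by_Basis)
qed

lemma open_le: "x \<in> Field r \<Longrightarrow> openin T {z. z \<sqsubseteq> x}"
proof (cases "{z. x \<sqsubset> z} = {}")
  case True
  moreover assume x: "x \<in> Field r"
  ultimately have "{z. z \<sqsubseteq> x} = topspace T" using le_total le_Field by auto
  then show ?thesis by (simp only: openin_topspace)
next
  case False
  assume x: "x \<in> Field r"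
  have "{z. x \<sqsubset> z} \<subseteq> Field r" using less_Field by auto
  then obtain s where "s \<in> {z. x \<sqsubset> z}" "\<And>a. a \<in> {z. x \<sqsubset> z} \<Longrightarrow> s \<sqsubseteq> a"
    using False by (rule ex_min) blast
  then have s: "x \<sqsubset> s" "\<And>a. x \<sqsubset> a \<Longrightarrow> s \<sqsubseteq> a" by auto
  have "z \<sqsubseteq> x \<longleftrightarrow> z \<sqsubset> s" for z
    using le_less_trans[OF _ s(1)] s(2)[of z] not_less_le[of z s] le_total[OF _ x] less_Field[of z s] by metis
  then show ?thesis using open_below[of s] less_Field[OF s(1)] by simp
qed

lemma closed_le: "x \<in> Field r \<Longrightarrow> closedin T {z. z \<sqsubseteq> x}"
proof -
  assume x: "x \<in> Field r"
  have "topspace T - {z. z \<sqsubseteq> x} = {z. x \<sqsubset> z}"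
  proof (rule set_eqI)
    fix z show "z \<in> topspace T - {z. z \<sqsubseteq> x} \<longleftrightarrow> z \<in> {z. x \<sqsubset> z}"
      using le_total[OF _ x, of z] not_less_le[of x z] less_Field[of x z] by auto
  qed
  moreover have "{z. z \<sqsubseteq> x} \<subseteq> topspace T" using le_Field by auto
  ultimately show ?thesis using open_above[OF x] by (simp add: closedin_def)
qed

text \<open>
  The interval topology has a base of intervals \<open>(y, x]\<close>, together with the singleton of the least
  element.
\<close>

lemma openin_iff:
  "openin T U \<longleftrightarrow> U \<subseteq> Field r \<and>
     (\<forall>x\<in>U. (\<exists>y. y \<sqsubset> x) \<longrightarrow> (\<exists>y. y \<sqsubset> x \<and> (\<forall>z. y \<sqsubset> z \<longrightarrow> z \<sqsubseteq> x \<longrightarrow> z \<in> U)))"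
    (is "_ \<longleftrightarrow> ?R U")
proof
  assume "openin T U"
  then have "generate_topology_on (insert (Field r)
      (Order_Relation.underS r ` Field r \<union> Order_Relation.aboveS r ` Field r)) U"
    by (simp add: interval_topology_def openin_topology_generated_by_iff)
  then show "?R U"
  proof induction
    case Empty
    then show ?case by simp
  next
    case (Int a b)
    show ?case
    proof (intro conjI ballI impI)
      show "a \<inter> b \<subseteq> Field r" using Int by blast
      fix x assume x: "x \<in> a \<inter> b" "\<exists>y. y \<sqsubset> x"
      obtain y where y: "y \<sqsubset> x" "\<And>z. y \<sqsubset> z \<Longrightarrow> z \<sqsubseteq> x \<Longrightarrow> z \<in> a" using Int x by blast
      obtain y' where y': "y' \<sqsubset> x" "\<And>z. y' \<sqsubset> z \<Longrightarrow> z \<sqsubseteq> x \<Longrightarrow> z \<in> b" using Int x by blast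
      obtain u where "y \<sqsubseteq> u" "y' \<sqsubseteq> u" "u \<sqsubset> x" using ex_max[OF y(1) y'(1)] by metis
      then show "\<exists>y. y \<sqsubset> x \<and> (\<forall>z. y \<sqsubset> z \<longrightarrow> z \<sqsubseteq> x \<longrightarrow> z \<in> a \<inter> b)"
        using y y' le_less_trans by (metis IntI)
    qed
  next
    case (UN K)
    show ?case
    proof (intro conjI ballI impI)
      show "\<Union>K \<subseteq> Field r" using UN by blast
      fix x assume x: "x \<in> \<Union>K" "\<exists>y. y \<sqsubset> x"
      then obtain k where k: "k \<in> K" "x \<in> k" by blast
      then obtain y where "y \<sqsubset> x" "\<forall>z. y \<sqsubset> z \<longrightarrow> z \<sqsubseteq> x \<longrightarrow> z \<in> k" using UN(2)[OF k(1)] x by blast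
      then show "\<exists>y. y \<sqsubset> x \<and> (\<forall>z. y \<sqsubset> z \<longrightarrow> z \<sqsubseteq> x \<longrightarrow> z \<in> \<Union>K)" using k(1) by blast
    qed
  next
    case (Basis s)
    then consider "s = Field r" | a where "a \<in> Field r" "s = {z. z \<sqsubset> a}"
      | a where "a \<in> Field r" "s = {z. a \<sqsubset> z}"
      by (auto simp: underS_def aboveS_def less_def conj_commute)
    then show ?case
    proof cases
      case 1
      then show ?thesis using le_Field by auto
    next
      case 2
      have "z \<in> s" if "x \<in> s" "z \<sqsubseteq> x" for x z
        using that le_less_trans[of z x a] unfolding 2(2) by simp
      then show ?thesis using less_Field unfolding 2(2) by blast
    next
      case 3
      then show ?thesis using less_Field by blast
    qed
  qed
next
  assume U: "?R U"
  show "openin T U"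
  proof (subst openin_subopen, intro ballI)
    fix x assume x: "x \<in> U"
    then have xF: "x \<in> Field r" using U by blast
    show "\<exists>W. openin T W \<and> x \<in> W \<and> W \<subseteq> U"
    proof (cases "\<exists>y. y \<sqsubset> x")
      case True
      then obtain y where y: "y \<sqsubset> x" "\<And>z. y \<sqsubset> z \<Longrightarrow> z \<sqsubseteq> x \<Longrightarrow> z \<in> U" using U x by blast
      have "openin T ({z. y \<sqsubset> z} \<inter> {z. z \<sqsubseteq> x})"
        using open_above open_le xF y(1) less_Field by (intro openin_Int) auto
      moreover have "x \<in> {z. y \<sqsubset> z} \<inter> {z. z \<sqsubseteq> x}" using y(1) le_refl[OF xF] by simp
      moreover have "{z. y \<sqsubset> z} \<inter> {z. z \<sqsubseteq> x} \<subseteq> U" using y(2) by blast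
      ultimately show ?thesis by (intro exI conjI)
    next
      case False
      then have "{z. z \<sqsubseteq> x} = {x}" using le_less xF by auto
      then have "openin T {x}" using open_le[OF xF] by simp
      then show ?thesis using x by (intro exI[of _ "{x}"]) simp
    qed
  qed
qed

text \<open>
  Lower bounds of neighbourhoods can be moved into a convex set. The exception is a least element of
  \<open>A\<close>, which is isolated in \<open>A\<close> for either topology, as \<open>A\<close> is open.
\<close>

lemma subspace_eq_Restr:
  assumes A: "openin T A" and convex: "\<And>x y z. x \<in> A \<Longrightarrow> z \<in> A \<Longrightarrow> x \<sqsubseteq> y \<Longrightarrow> y \<sqsubseteq> z \<Longrightarrow> y \<in> A"
  shows "subtopology T A = interval_topology (Restr r A)"
proof -
  interpret A: well_ordered_space "Restr r A"
    by (simp add: well_ordered_space_def Well_order_Restr well_order)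
  have AF: "A \<subseteq> Field r" using openin_subset[OF A] by simp
  have FA: "Field (Restr r A) = A" using Refl_Field_Restr2 AF linear by (auto simp: order_on_defs)
  have less: "A.less x y \<longleftrightarrow> x \<sqsubset> y \<and> x \<in> A \<and> y \<in> A" for x y by (auto simp: A.less_def less_def)
  have "openin T S \<and> S \<subseteq> A \<longleftrightarrow> openin A.T S" for S
  proof
    assume S: "openin T S \<and> S \<subseteq> A"
    show "openin A.T S" unfolding A.openin_iff FA
    proof (intro conjI ballI impI)
      show "S \<subseteq> A" using S by blast
      fix x assume x: "x \<in> S" "\<exists>y. A.less y x"
      then obtain y where y: "y \<sqsubset> x" "y \<in> A" "x \<in> A" using less by blast
      obtain y1 where y1: "y1 \<sqsubset> x" "\<And>z. y1 \<sqsubset> z \<Longrightarrow> z \<sqsubseteq> x \<Longrightarrow> z \<in> S"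
        using S x(1) y(1) unfolding openin_iff by blast
      obtain u where u: "y \<sqsubseteq> u" "y1 \<sqsubseteq> u" "u \<sqsubset> x" using ex_max[OF y(1) y1(1)] by metis
      have "u \<in> A" using convex[OF y(2,3) u(1)] u(3) less_imp_le by blast
      then show "\<exists>y. A.less y x \<and> (\<forall>z. A.less y z \<longrightarrow> A.le z x \<longrightarrow> z \<in> S)"
        using u y y1 less le_less_trans by (intro exI[of _ u]) auto
    qed
  next
    assume S: "openin A.T S"
    then have SA: "S \<subseteq> A" using A.openin_iff FA by blast
    have "openin T S" unfolding openin_iff
    proof (intro conjI ballI impI)
      show "S \<subseteq> Field r" using SA AF by blast
      fix x assume x: "x \<in> S" "\<exists>y. y \<sqsubset> x"
      show "\<exists>y. y \<sqsubset> x \<and> (\<forall>z. y \<sqsubset> z \<longrightarrow> z \<sqsubseteq> x \<longrightarrow> z \<in> S)"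
      proof (cases "\<exists>y. A.less y x")
        case True
        then obtain y where y: "A.less y x" "\<And>z. A.less y z \<Longrightarrow> A.le z x \<Longrightarrow> z \<in> S"
          using S x(1) unfolding A.openin_iff by blast
        have "z \<in> S" if z: "y \<sqsubset> z" "z \<sqsubseteq> x" for z
        proof -
          have "z \<in> A" using convex[of y x z] y(1) z less less_imp_le by blast
          then show ?thesis using y z less by auto
        qed
        then show ?thesis using y(1) less by blast
      next
        case False
        obtain y1 where y1: "y1 \<sqsubset> x" "\<And>z. y1 \<sqsubset> z \<Longrightarrow> z \<sqsubseteq> x \<Longrightarrow> z \<in> A"
          using A x SA unfolding openin_iff by blast
        have "z \<in> S" if "y1 \<sqsubset> z" "z \<sqsubseteq> x" for z
        proof -
          have "z \<in> A" using y1 that by blast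
          then have "\<not> z \<sqsubset> x" using False less x(1) SA by blast
          then show ?thesis using that(2) x(1) by (auto simp: less_def)
        qed
        then show ?thesis using y1(1) by blast
      qed
    qed
    then show "openin T S \<and> S \<subseteq> A" using SA by blast
  qed
  then show ?thesis unfolding topology_eq using openin_open_subtopology[OF A] by blast
qed

lemma separating_unit_function:
  assumes "x \<in> Field r" "y \<in> Field r" "x \<noteq> y"
  shows "\<exists>f\<in>unit_functions T. f x \<noteq> f y"
proof -
  have *: "\<exists>f\<in>unit_functions T. f x \<noteq> f y" if xy: "x \<sqsubset> y" for x y
  proof -
    have F: "x \<in> Field r" "y \<in> Field r" using less_Field[OF xy] by blast+
    have "(\<lambda>z\<in>topspace T. if z \<in> {z. z \<sqsubseteq> x} then 1 else (0::real)) \<in> unit_functions T"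
      by (rule clopen_unit_function[OF open_le[OF F(1)] closed_le[OF F(1)]]) simp
    then show ?thesis
      by (rule bexI[rotated]) (use F not_less_le[OF xy] le_refl in auto)
  qed
  show ?thesis
  proof (cases "x \<sqsubset> y")
    case False
    then have "y \<sqsubset> x" using le_total assms by (auto simp: less_def)
    then show ?thesis using *[of y x] by metis
  qed (use * in blast)
qed

text \<open>
  By induction on \<open>x\<close>, the interval \<open>[0, x]\<close> is covered by finitely many members of an open cover: one
  that contains \<open>(y, x]\<close>, and finitely many for \<open>[0, y]\<close>.
\<close>

lemma compact_if_greatest:
  assumes p: "p \<in> Field r" "\<And>x. x \<in> Field r \<Longrightarrow> x \<sqsubseteq> p"
  shows "compact_space T"
  unfolding compact_space
proof (intro allI impI)
  fix \<U> assume U: "(\<forall>U\<in>\<U>. openin T U) \<and> \<Union>\<U> = topspace T"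
  have "\<exists>\<F>. finite \<F> \<and> \<F> \<subseteq> \<U> \<and> {z. z \<sqsubseteq> x} \<subseteq> \<Union>\<F>" if "x \<in> Field r" for x
    using that
  proof (induction rule: less_induct)
    case (less x)
    obtain W where W: "W \<in> \<U>" "x \<in> W" using U less(1) by auto
    show ?case
    proof (cases "\<exists>y. y \<sqsubset> x")
      case True
      then obtain y where y: "y \<sqsubset> x" "\<And>z. y \<sqsubset> z \<Longrightarrow> z \<sqsubseteq> x \<Longrightarrow> z \<in> W"
        using U W unfolding openin_iff by blast
      obtain \<F> where F: "finite \<F>" "\<F> \<subseteq> \<U>" "{z. z \<sqsubseteq> y} \<subseteq> \<Union>\<F>" using less(2)[OF y(1)] by blast
      have "{z. z \<sqsubseteq> x} \<subseteq> \<Union>(insert W \<F>)"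
      proof
        fix z assume "z \<in> {z. z \<sqsubseteq> x}"
        then show "z \<in> \<Union>(insert W \<F>)"
          using F(3) y(2)[of z] le_total[of z y] le_Field[of z x] less_Field[OF y(1)] by blast
      qed
      then show ?thesis using F(1,2) W(1) by (intro exI[of _ "insert W \<F>"]) auto
    next
      case False
      then have "{z. z \<sqsubseteq> x} \<subseteq> \<Union>{W}" using W le_less by auto
      then show ?thesis using W(1) by (intro exI[of _ "{W}"]) auto
    qed
  qed
  from this[OF p(1)] obtain \<F> where F: "finite \<F>" "\<F> \<subseteq> \<U>" "{z. z \<sqsubseteq> p} \<subseteq> \<Union>\<F>" by blast
  have "\<Union>\<F> \<subseteq> topspace T" using F(2) U by blast
  moreover have "topspace T \<subseteq> \<Union>\<F>" using p(2) F(3) by auto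
  ultimately have "\<Union>\<F> = topspace T" by (rule subset_antisym)
  then show "\<exists>\<F>. finite \<F> \<and> \<F> \<subseteq> \<U> \<and> \<Union>\<F> = topspace T" using F by blast
qed

lemma logic_of_stone_cech_compact:
  assumes "p \<in> Field r" "\<And>x. x \<in> Field r \<Longrightarrow> x \<sqsubseteq> p"
  shows "logic_of (stone_cech T) = logic_of T"
  using logic_of_homeomorphic[OF stone_cech_compact[OF compact_if_greatest[OF assms]]]
    separating_unit_function by simp


subsection \<open>Iterated derived sets\<close>

text \<open>
  These are the Cantor-Bendixson derivatives: \<open>x\<close> is in the next one if it is a limit of points of the
  present one, which in a well-order can only be a limit from below.
\<close>

primrec derived :: "nat \<Rightarrow> 'a set" where
  "derived 0 = Field r"
| "derived (Suc k) = {x. (\<exists>y. y \<sqsubset> x) \<and> (\<forall>y. y \<sqsubset> x \<longrightarrow> (\<exists>z\<in>derived k. y \<sqsubset> z \<and> z \<sqsubset> x))}"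

lemma derived_Field: "derived k \<subseteq> Field r"
  by (cases k) (use less_Field in auto)

lemma grz_valid: "grz \<in> logic_of T"
  unfolding logic_of_iff
proof (intro allI impI, rule ccontr)
  fix V x
  assume x: "x \<in> topspace T" "x \<notin> eval T V grz"
  let ?p = "V 0"
  let ?q = "(Field r - ?p) \<union> T interior_of ?p"
  let ?S = "(Field r - T interior_of ?q) \<union> ?p"
  have xp: "x \<notin> ?p" and "x \<in> T interior_of ?S"
    using x by (auto simp: grz_def)
  then obtain U where U: "openin T U" "x \<in> U" "U \<subseteq> ?S" by (auto simp: interior_of_def)
  have UF: "U \<subseteq> Field r" using openin_subset[OF U(1)] by simp
  have "U - ?p \<subseteq> Field r" "U - ?p \<noteq> {}" using UF U(2) xp by blast+
  then obtain m where m: "m \<in> U - ?p" "\<And>a. a \<in> U - ?p \<Longrightarrow> m \<sqsubseteq> a"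
    by (rule ex_min) blast
  have mF: "m \<in> Field r" using m UF by blast
  \<comment> \<open>Below its least point outside \<open>p\<close>, the open set lies in \<open>p\<close>, so \<open>p \<rightarrow> \<box>p\<close> holds around \<open>m\<close>.\<close>
  define W where "W = U \<inter> {z. z \<sqsubset> m}"
  have Wo: "openin T W" unfolding W_def using U(1) open_below[OF mF] by blast
  have Wp: "W \<subseteq> ?p" unfolding W_def using m(2) not_less_le by blast
  have "U \<inter> {z. z \<sqsubseteq> m} \<subseteq> ?q"
  proof
    fix z assume z: "z \<in> U \<inter> {z. z \<sqsubseteq> m}"
    show "z \<in> ?q"
    proof (cases "z = m")
      case True
      then show ?thesis using m mF by blast
    next
      case False
      then have "z \<in> W" using z by (auto simp: W_def less_def)
      then show ?thesis using Wo Wp unfolding interior_of_def by blast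
    qed
  qed
  moreover have "openin T (U \<inter> {z. z \<sqsubseteq> m})" using U(1) open_le[OF mF] by blast
  moreover have "m \<in> U \<inter> {z. z \<sqsubseteq> m}" using m le_refl[OF mF] by blast
  ultimately have "m \<in> T interior_of ?q" unfolding interior_of_def by blast
  then show False using m(1) U(3) by blast
qed

text \<open>
  As the value of \<open>bd 0\<close> is empty, the first formula is an instance of the general recursion.
\<close>

lemma eval_bd_Suc:
  assumes V: "\<And>p. V p \<subseteq> topspace T"
  shows "eval T V (bd (Suc n)) =
    (Field r - T closure_of (T interior_of V (Suc n) - eval T V (bd n))) \<union> V (Suc n)"
proof -
  have sub: "eval T V a \<subseteq> Field r" for a using eval_subset_topspace[OF V] by simp
  have int: "T interior_of V (Suc n) \<subseteq> Field r" using interior_of_subset_topspace[of T] by simp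
  show ?thesis
  proof (cases n)
    case 0
    have "eval T V (bd (Suc n)) = (Field r - eval T V (Dia (Box (Var 1)))) \<union> V 1"
      using 0 by simp
    then show ?thesis unfolding eval_Dia using 0 by simp
  next
    case (Suc m)
    have "eval T V (And (Box (Var (Suc n))) (Neg (bd n))) = T interior_of V (Suc n) - eval T V (bd n)"
      using sub int by auto
    moreover have "eval T V (bd (Suc n)) =
        (Field r - eval T V (Dia (And (Box (Var (Suc n))) (Neg (bd n))))) \<union> V (Suc n)"
      using Suc by simp
    ultimately show ?thesis unfolding eval_Dia by simp
  qed
qed

text \<open>
  A point outside \<open>derived (Suc n)\<close> has a neighbourhood whose other points are outside \<open>derived n\<close>, where
  \<open>bd n\<close> holds by induction. So the diamond in \<open>bd (Suc n)\<close> could only be witnessed by the point itself.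
\<close>

lemma bd_holds_outside_derived:
  assumes V: "\<And>p. V p \<subseteq> topspace T" and x: "x \<in> Field r" "x \<notin> derived n"
  shows "x \<in> eval T V (bd n)"
  using x
proof (induction n arbitrary: x)
  case 0
  then show ?case by simp
next
  case (Suc n)
  show ?case
  proof (rule ccontr)
    assume "x \<notin> eval T V (bd (Suc n))"
    then have xV: "x \<notin> V (Suc n)"
      and cl: "x \<in> T closure_of (T interior_of V (Suc n) - eval T V (bd n))"
      unfolding eval_bd_Suc[OF V] using Suc.prems(1) by auto
    have "\<exists>U. openin T U \<and> x \<in> U \<and> (\<forall>z\<in>U. z \<noteq> x \<longrightarrow> z \<notin> derived n)"
    proof (cases "\<exists>y. y \<sqsubset> x")
      case True
      then obtain y where y: "y \<sqsubset> x" "\<And>z. y \<sqsubset> z \<Longrightarrow> z \<sqsubset> x \<Longrightarrow> z \<notin> derived n"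
        using Suc.prems by auto
      have "openin T ({z. y \<sqsubset> z} \<inter> {z. z \<sqsubseteq> x})"
        using open_above open_le Suc.prems(1) y(1) less_Field by (intro openin_Int) auto
      then show ?thesis
        using y le_refl[OF Suc.prems(1)] by (intro exI[of _ "{z. y \<sqsubset> z} \<inter> {z. z \<sqsubseteq> x}"]) (auto simp: less_def)
    next
      case False
      then have "{z. z \<sqsubseteq> x} = {x}" using le_less Suc.prems(1) by auto
      then show ?thesis using open_le[OF Suc.prems(1)] by (intro exI[of _ "{x}"]) auto
    qed
    then obtain U where U: "openin T U" "x \<in> U" "\<And>z. z \<in> U \<Longrightarrow> z \<noteq> x \<Longrightarrow> z \<notin> derived n" by blast
    from cl U(1,2) obtain z where z: "z \<in> U" "z \<in> T interior_of V (Suc n)" "z \<notin> eval T V (bd n)"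
      unfolding in_closure_of by blast
    have "z \<noteq> x" using xV z(2) interior_of_subset[of T "V (Suc n)"] by blast
    moreover have "z \<in> Field r" using z(1) openin_subset[OF U(1)] by auto
    ultimately show False using Suc.IH U(3) z(1,3) by blast
  qed
qed

lemma bd_valid: "derived n = {} \<Longrightarrow> bd n \<in> logic_of T"
  unfolding logic_of_iff using bd_holds_outside_derived by auto

end


section \<open>Realizing canonical worlds on a well-order\<close>

primrec boxed :: "fm \<Rightarrow> fm set" where
  "boxed (Var p) = {}"
| "boxed Bot = {}"
| "boxed (Imp a b) = boxed a \<union> boxed b"
| "boxed (Box a) = insert a (boxed a)"

lemma finite_boxed: "finite (boxed a)"
  by (induction a) auto

text \<open>
  With this, each of finitely many selected worlds can be put at infinitely many, hence cofinally many,
  of the points that converge to a limit point.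
\<close>

lemma ex_colouring_infinite_fibres:
  assumes E: "infinite E" and C: "finite C" "C \<noteq> {}"
  obtains c where "\<And>e. c e \<in> C" "\<And>b. b \<in> C \<Longrightarrow> infinite {e \<in> E. c e = b}"
proof -
  obtain h :: "nat \<Rightarrow> 'a" where h: "inj h" "range h \<subseteq> E" using E infinite_countable_subset by blast
  define N where "N = card C"
  have N: "N > 0" using C by (simp add: N_def card_gt_0_iff)
  obtain g where g: "bij_betw g {0..<N} C" using ex_bij_betw_nat_finite[OF C(1)] N_def by blast
  define c where "c e = g (inv h e mod N)" for e
  have "c e \<in> C" for e using g N by (auto simp: c_def bij_betw_def)
  moreover have "infinite {e \<in> E. c e = b}" if b: "b \<in> C" for b
  proof -
    obtain i where i: "i < N" "g i = b" using b g by (auto simp: bij_betw_def)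
    have "inj (\<lambda>j. h (i + N * j))" using N by (auto intro!: injI dest!: injD[OF h(1)])
    then have "infinite (range (\<lambda>j. h (i + N * j)))" by (rule range_inj_infinite)
    moreover have "range (\<lambda>j. h (i + N * j)) \<subseteq> {e \<in> E. c e = b}"
      using h i by (auto simp: c_def inv_f_f)
    ultimately show ?thesis using finite_subset by blast
  qed
  ultimately show ?thesis using that by blast
qed

locale canonical_realization = well_ordered_space r + grz_logic L
  for r :: "'a rel" and L :: "fm set"
begin

text \<open>
  A map of points to worlds for which truth of the formulas with boxed parts in \<open>\<Phi>\<close> is membership: it
  is continuous for the topology of upward closed sets of worlds, and failures of boxes are witnessed
  arbitrarily close to the point.
\<close>

definition realizes :: "fm set \<Rightarrow> 'a set \<Rightarrow> ('a \<Rightarrow> fm set) \<Rightarrow> bool" where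
  "realizes \<Phi> I f \<longleftrightarrow>
     (\<forall>z\<in>I. mcs L (f z) \<and>
        (\<exists>U. openin T U \<and> z \<in> U \<and> U \<subseteq> I \<and> (\<forall>u\<in>U. acc (f z) (f u))) \<and>
        (\<forall>B\<in>\<Phi>. Box B \<notin> f z \<longrightarrow> (\<forall>U. openin T U \<longrightarrow> z \<in> U \<longrightarrow> (\<exists>u\<in>U \<inter> I. B \<notin> f u))))"

lemma realizesI:
  assumes "\<And>z. z \<in> I \<Longrightarrow> mcs L (f z)"
    and "\<And>z. z \<in> I \<Longrightarrow> \<exists>U. openin T U \<and> z \<in> U \<and> U \<subseteq> I \<and> (\<forall>u\<in>U. acc (f z) (f u))"
    and "\<And>z B U. z \<in> I \<Longrightarrow> B \<in> \<Phi> \<Longrightarrow> Box B \<notin> f z \<Longrightarrow> openin T U \<Longrightarrow> z \<in> U \<Longrightarrow> \<exists>u\<in>U \<inter> I. B \<notin> f u"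
  shows "realizes \<Phi> I f"
  using assms unfolding realizes_def by metis

lemma realizesD:
  assumes "realizes \<Phi> I f" "z \<in> I"
  shows "mcs L (f z)"
    and "\<exists>U. openin T U \<and> z \<in> U \<and> U \<subseteq> I \<and> (\<forall>u\<in>U. acc (f z) (f u))"
    and "B \<in> \<Phi> \<Longrightarrow> Box B \<notin> f z \<Longrightarrow> openin T U \<Longrightarrow> z \<in> U \<Longrightarrow> \<exists>u\<in>U \<inter> I. B \<notin> f u"
  using assms unfolding realizes_def by metis+

lemma eval_realizes:
  assumes f: "realizes \<Phi> I f" and \<Phi>: "boxed a \<subseteq> \<Phi>" and z: "z \<in> I" and I: "I \<subseteq> Field r"
  shows "z \<in> eval T (\<lambda>p. {z \<in> I. Var p \<in> f z}) a \<longleftrightarrow> a \<in> f z"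
  using \<Phi> z
proof (induction a arbitrary: z)
  case (Var p)
  then show ?case by simp
next
  case Bot
  then show ?case using mcs_Bot realizesD(1)[OF f] by simp
next
  case (Imp a b)
  then show ?case using mcs_Imp[OF realizesD(1)[OF f Imp.prems(2)]] I by auto
next
  case (Box a)
  let ?e = "eval T (\<lambda>p. {z \<in> I. Var p \<in> f z}) a"
  have IH: "\<And>u. u \<in> I \<Longrightarrow> u \<in> ?e \<longleftrightarrow> a \<in> f u" using Box by simp
  show ?case
  proof
    assume "z \<in> eval T (\<lambda>p. {z \<in> I. Var p \<in> f z}) (Box a)"
    then obtain U where U: "openin T U" "z \<in> U" "U \<subseteq> ?e" by (auto simp: interior_of_def)
    show "Box a \<in> f z"
    proof (rule ccontr)
      assume "Box a \<notin> f z"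
      then obtain u where "u \<in> U \<inter> I" "a \<notin> f u"
        using realizesD(3)[OF f Box.prems(2) _ _ U(1,2)] Box.prems(1) by auto
      then show False using IH U(3) by auto
    qed
  next
    assume bz: "Box a \<in> f z"
    obtain U where U: "openin T U" "z \<in> U" "U \<subseteq> I" "\<forall>u\<in>U. acc (f z) (f u)"
      using realizesD(2)[OF f Box.prems(2)] by blast
    then have "U \<subseteq> ?e" using bz IH by (auto simp: acc_def)
    then show "z \<in> eval T (\<lambda>p. {z \<in> I. Var p \<in> f z}) (Box a)"
      using U(1,2) by (auto simp: interior_of_def)
  qed
qed

text \<open>
  If \<open>x\<close> is the only limit in the convex set \<open>I\<close> of points of \<open>derived k\<close>, these points have no limit
  below \<open>x\<close>; by induction on \<open>z\<close> there are only finitely many up to \<open>z\<close>.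
\<close>

lemma finite_derived_below:
  assumes I: "\<And>a b z. a \<in> I \<Longrightarrow> b \<in> I \<Longrightarrow> a \<sqsubseteq> z \<Longrightarrow> z \<sqsubseteq> b \<Longrightarrow> z \<in> I"
    and x: "x \<in> I" "I \<inter> derived (Suc k) = {x}"
    and z: "z \<sqsubset> x"
  shows "finite {e \<in> I \<inter> derived k. e \<sqsubseteq> z}"
proof -
  have "z \<in> Field r" using z less_Field by blast
  then show ?thesis using z
  proof (induction rule: less_induct)
    case (less z)
    show ?case
    proof (cases "z \<in> derived (Suc k)")
      case True
      then have "z \<notin> I" using x(2) less.prems less_irrefl by (metis IntI singletonD)
      then have "{e \<in> I \<inter> derived k. e \<sqsubseteq> z} = {}"
        using I[OF _ x(1) _ less_imp_le[OF less.prems]] by blast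
      then show ?thesis by (simp only: finite.emptyI)
    next
      case False
      show ?thesis
      proof (cases "\<exists>y. y \<sqsubset> z")
        case True
        then obtain y where y: "y \<sqsubset> z" "\<And>u. u \<in> derived k \<Longrightarrow> y \<sqsubset> u \<Longrightarrow> \<not> u \<sqsubset> z"
          using False by auto
        have "e \<in> insert z {e \<in> I \<inter> derived k. e \<sqsubseteq> y}" if e: "e \<in> I \<inter> derived k" "e \<sqsubseteq> z" for e
          using e y(2)[of e] le_total[of e y] le_Field[OF e(2)] less_Field[OF y(1)]
          by (auto simp: less_def)
        then have "{e \<in> I \<inter> derived k. e \<sqsubseteq> z} \<subseteq> insert z {e \<in> I \<inter> derived k. e \<sqsubseteq> y}" by blast
        moreover have "finite {e \<in> I \<inter> derived k. e \<sqsubseteq> y}"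
          using less.IH[OF y(1)] less_trans[OF y(1) less.prems] by blast
        ultimately show ?thesis by (meson finite_insert finite_subset)
      next
        case False
        then have "{e \<in> I \<inter> derived k. e \<sqsubseteq> z} \<subseteq> {z}" using le_less by auto
        then show ?thesis using finite_subset by blast
      qed
    qed
  qed
qed

lemma realize_constant:
  assumes I: "openin T I" and w: "mcs L w"
    and no: "\<And>B. B \<in> \<Phi> \<Longrightarrow> B \<in> w \<Longrightarrow> Box B \<in> w"
  shows "realizes \<Phi> I (\<lambda>_. w)"
proof (rule realizesI)
  show "\<exists>U. openin T U \<and> z \<in> U \<and> U \<subseteq> I \<and> (\<forall>u\<in>U. acc w w)" if "z \<in> I" for z
    using that I acc_refl[OF w] by blast
qed (use w no in blast)+

text \<open>
  The idea behind the completeness proof. Let \<open>x\<close> be the only point of \<open>derived (Suc k)\<close> in \<open>I\<close>. The points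
  \<open>e\<close> of \<open>derived k\<close> in \<open>I\<close> below \<open>x\<close> form a sequence with limit \<open>x\<close>, and they cut \<open>I\<close> below \<open>x\<close> into open
  pieces \<open>P e\<close>, each with greatest element \<open>e\<close>. The world \<open>w\<close> is put at \<open>x\<close>. For each box that fails at \<open>w\<close>
  although its argument holds there, a successor is selected, and the pieces are distributed over the
  selected successors so that each successor is put at the tops of pieces arbitrarily close to \<open>x\<close>.
\<close>

lemma realize_step:
  assumes I: "openin T I" "\<And>a b z. a \<in> I \<Longrightarrow> b \<in> I \<Longrightarrow> a \<sqsubseteq> z \<Longrightarrow> z \<sqsubseteq> b \<Longrightarrow> z \<in> I"
      "\<And>z. z \<in> I \<Longrightarrow> z \<sqsubseteq> x"
    and x: "I \<inter> derived (Suc k) = {x}" and w: "mcs L w"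
    and C: "C = {B \<in> \<Phi>. B \<in> w \<and> Box B \<notin> w}" "finite C" "C \<noteq> {}"
    and s: "\<And>B. B \<in> C \<Longrightarrow> acc w (s B) \<and> B \<notin> s B"
    and IH: "\<And>J e B. \<lbrakk>openin T J; \<And>a b z. a \<in> J \<Longrightarrow> b \<in> J \<Longrightarrow> a \<sqsubseteq> z \<Longrightarrow> z \<sqsubseteq> b \<Longrightarrow> z \<in> J;
      \<And>z. z \<in> J \<Longrightarrow> z \<sqsubseteq> e; J \<inter> derived k = {e}; B \<in> C\<rbrakk> \<Longrightarrow>
      \<exists>f. f e = s B \<and> realizes \<Phi> J f \<and> (\<forall>z\<in>J. acc (s B) (f z))"
  shows "\<exists>f. f x = w \<and> realizes \<Phi> I f \<and> (\<forall>z\<in>I. acc w (f z))"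
proof -
  have IF: "I \<subseteq> Field r" using openin_subset[OF I(1)] by simp
  have xI: "x \<in> I" and xd: "x \<in> derived (Suc k)" using x by auto
  define E where "E = I \<inter> derived k - {x}"
  have Ex: "e \<sqsubset> x" if "e \<in> E" for e using that I(3) by (auto simp: E_def less_def)
  have EI: "e \<in> I" if "e \<in> E" for e using that by (simp add: E_def)
  have EF: "E \<subseteq> Field r" using EI IF by blast
  have finE: "finite {e \<in> E. e \<sqsubseteq> z}" if "z \<sqsubset> x" for z
    by (rule finite_subset[OF _ finite_derived_below[OF I(2) xI x that]]) (auto simp: E_def)
  have cofinal: "\<exists>e\<in>E. z \<sqsubset> e" if z: "z \<sqsubset> x" for z
  proof -
    obtain y where y: "y \<sqsubset> x" "\<And>u. y \<sqsubset> u \<Longrightarrow> u \<sqsubseteq> x \<Longrightarrow> u \<in> I"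
      using I(1) xI z unfolding openin_iff by blast
    obtain v where v: "y \<sqsubseteq> v" "z \<sqsubseteq> v" "v \<sqsubset> x" using ex_max[OF y(1) z] by metis
    then obtain e where e: "e \<in> derived k" "v \<sqsubset> e" "e \<sqsubset> x" using xd by auto
    have "e \<in> I" using y(2)[of e] le_less_trans[OF v(1) e(2)] e(3) less_imp_le by blast
    then have "e \<in> E" using e(1,3) less_irrefl by (auto simp: E_def)
    then show ?thesis using le_less_trans[OF v(2) e(2)] by blast
  qed
  have "infinite E"
  proof
    assume "finite E"
    moreover have "E \<noteq> {}" using cofinal xd by auto
    ultimately obtain m where m: "m \<in> E" "\<And>e. e \<in> E \<Longrightarrow> e \<sqsubseteq> m" using finite_max[OF _ _ EF] by blast
    obtain e where "e \<in> E" "m \<sqsubset> e" using cofinal[OF Ex[OF m(1)]] by blast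
    then show False using m(2)[of e] not_less_le[of m e] by blast
  qed
  from ex_colouring_infinite_fibres[OF this C(2,3)]
  obtain c where c: "\<And>e. c e \<in> C" "\<And>B. B \<in> C \<Longrightarrow> infinite {e \<in> E. c e = B}" by metis
  have cofinal_colour: "\<exists>e\<in>E. z \<sqsubset> e \<and> c e = B" if z: "z \<sqsubset> x" and B: "B \<in> C" for z B
  proof (rule ccontr)
    assume no: "\<not> ?thesis"
    have "e \<sqsubseteq> z" if "e \<in> E" "c e = B" for e
      using no that le_total[of e z] EF less_Field[OF z] by blast
    then have "{e \<in> E. c e = B} \<subseteq> {e \<in> E. e \<sqsubseteq> z}" by blast
    then have "finite {e \<in> E. c e = B}" using finE[OF z] by (rule finite_subset)
    then show False using c(2)[OF B] by blast
  qed
  \<comment> \<open>\<open>P e\<close> consists of the points whose least upper bound in \<open>E\<close> is \<open>e\<close>.\<close>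
  define P where "P e = {z \<in> I. z \<sqsubseteq> e \<and> (\<forall>e'\<in>E. e' \<sqsubset> e \<longrightarrow> e' \<sqsubset> z)}" for e
  have PI: "P e \<subseteq> I" for e by (auto simp: P_def)
  have Px: "z \<sqsubset> x" if "z \<in> P e" "e \<in> E" for z e
    using that le_less_trans[of z e x] Ex[of e] by (simp add: P_def)
  have eP: "e \<in> P e" if "e \<in> E" for e
    using that EI le_refl EF by (auto simp: P_def)
  have P_ex: "\<exists>e\<in>E. z \<in> P e" if z: "z \<in> I" "z \<noteq> x" for z
  proof -
    have zx: "z \<sqsubset> x" using z I(3) by (simp add: less_def)
    then obtain e0 where e0: "e0 \<in> E" "z \<sqsubset> e0" using cofinal by blast
    have "{e \<in> E. z \<sqsubseteq> e} \<subseteq> Field r" "{e \<in> E. z \<sqsubseteq> e} \<noteq> {}"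
      using EF e0 less_imp_le by blast+
    then obtain e where e: "e \<in> {e \<in> E. z \<sqsubseteq> e}" "\<And>a. a \<in> {e \<in> E. z \<sqsubseteq> e} \<Longrightarrow> e \<sqsubseteq> a"
      by (rule ex_min) blast
    have "e' \<sqsubset> z" if e': "e' \<in> E" "e' \<sqsubset> e" for e'
    proof (rule ccontr)
      assume "\<not> e' \<sqsubset> z"
      then have "z \<sqsubseteq> e'" using le_total z(1) IF e'(1) EF by blast
      then show False using e(2)[of e'] e' not_less_le by blast
    qed
    then show ?thesis using e(1) z(1) by (auto simp: P_def)
  qed
  have P_unique: "e = e'" if "e \<in> E" "e' \<in> E" "z \<in> P e" "z \<in> P e'" for e e' z
  proof -
    have "\<not> e \<sqsubset> e'" if "e \<in> E" "e' \<in> E" "z \<in> P e" "z \<in> P e'" for e e'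
      using that not_less_le[of e z] by (auto simp: P_def)
    then show ?thesis using that le_total[of e e'] EF unfolding less_def by blast
  qed
  have P_open: "openin T (P e)" if e: "e \<in> E" for e
    unfolding openin_iff
  proof (intro conjI ballI impI)
    show "P e \<subseteq> Field r" using PI IF by blast
    fix z assume z: "z \<in> P e" "\<exists>y. y \<sqsubset> z"
    then obtain y1 where y1: "y1 \<sqsubset> z" "\<And>u. y1 \<sqsubset> u \<Longrightarrow> u \<sqsubseteq> z \<Longrightarrow> u \<in> I"
      using I(1) PI unfolding openin_iff by blast
    have "z \<notin> derived (Suc k)" using x PI z(1) Px[OF z(1) e] less_irrefl by (metis IntI singletonD subsetD)
    then obtain y2 where y2: "y2 \<sqsubset> z" "\<And>u. u \<in> derived k \<Longrightarrow> y2 \<sqsubset> u \<Longrightarrow> \<not> u \<sqsubset> z"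
      using z(2) by auto
    obtain y where y: "y1 \<sqsubseteq> y" "y2 \<sqsubseteq> y" "y \<sqsubset> z" using ex_max[OF y1(1) y2(1)] by metis
    have "u \<in> P e" if u: "y \<sqsubset> u" "u \<sqsubseteq> z" for u
    proof -
      have "u \<in> I" using y1(2) le_less_trans[OF y(1) u(1)] u(2) by blast
      moreover have "u \<sqsubseteq> e" using u(2) z(1) le_trans by (auto simp: P_def)
      moreover have "e' \<sqsubset> u" if e': "e' \<in> E" "e' \<sqsubset> e" for e'
      proof (rule ccontr)
        assume "\<not> e' \<sqsubset> u"
        then have "u \<sqsubseteq> e'" using le_total le_Field[OF u(2)] e'(1) EF by blast
        then have "y2 \<sqsubset> e'" using y(2) u(1) le_less_trans less_le_trans by metis
        moreover have "e' \<sqsubset> z" using z(1) e' by (auto simp: P_def)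
        ultimately show False using y2(2) e'(1) by (auto simp: E_def)
      qed
      ultimately show ?thesis by (simp add: P_def)
    qed
    then show "\<exists>y. y \<sqsubset> z \<and> (\<forall>u. y \<sqsubset> u \<longrightarrow> u \<sqsubseteq> z \<longrightarrow> u \<in> P e)" using y(3) by blast
  qed
  have P_convex: "z \<in> P e" if "a \<in> P e" "b \<in> P e" "a \<sqsubseteq> z" "z \<sqsubseteq> b" for a b z e
    using that I(2)[of a b z] le_trans[of z b e] less_le_trans[of _ a z] by (auto simp: P_def)
  have P_derived: "P e \<inter> derived k = {e}" if e: "e \<in> E" for e
  proof -
    have "z = e" if z: "z \<in> P e" "z \<in> derived k" for z
    proof (rule ccontr)
      assume "z \<noteq> e"
      then have "z \<sqsubset> e" using z(1) by (auto simp: P_def less_def)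
      moreover have "z \<in> E" using z PI Px[OF z(1) e] less_irrefl by (auto simp: E_def)
      ultimately show False using z(1) less_irrefl by (auto simp: P_def)
    qed
    then show ?thesis using eP[OF e] e by (auto simp: E_def)
  qed
  have "\<exists>f. f e = s (c e) \<and> realizes \<Phi> (P e) f \<and> (\<forall>z\<in>P e. acc (s (c e)) (f z))" if e: "e \<in> E" for e
  proof (rule IH[OF P_open[OF e] _ _ P_derived[OF e] c(1)])
    show "z \<sqsubseteq> e" if "z \<in> P e" for z using that by (simp add: P_def)
  qed (rule P_convex)
  then obtain F where F: "\<And>e. e \<in> E \<Longrightarrow> F e e = s (c e)" "\<And>e. e \<in> E \<Longrightarrow> realizes \<Phi> (P e) (F e)"
    "\<And>e z. e \<in> E \<Longrightarrow> z \<in> P e \<Longrightarrow> acc (s (c e)) (F e z)" by metis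
  define nx where "nx z = (THE e. e \<in> E \<and> z \<in> P e)" for z
  have nx: "nx z = e" if "e \<in> E" "z \<in> P e" for e z
    unfolding nx_def using that P_unique by (intro the_equality) blast+
  define f where "f z = (if z = x then w else F (nx z) z)" for z
  have fx: "f x = w" by (simp add: f_def)
  have fP: "f z = F e z" if "e \<in> E" "z \<in> P e" for e z
    using nx[OF that] Px[OF that(2,1)] less_irrefl by (auto simp: f_def)
  have accf: "acc w (f z)" if z: "z \<in> I" for z
  proof (cases "z = x")
    case True
    then show ?thesis using fx acc_refl[OF w] by simp
  next
    case False
    then obtain e where e: "e \<in> E" "z \<in> P e" using P_ex z by blast
    then show ?thesis using fP[OF e] F(3)[OF e] acc_trans[OF w] s[OF c(1)] by metis
  qed
  have "realizes \<Phi> I f"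
  proof (rule realizesI)
    fix z assume z: "z \<in> I"
    show "mcs L (f z)"
    proof (cases "z = x")
      case False
      then obtain e where e: "e \<in> E" "z \<in> P e" using P_ex z by blast
      then show ?thesis using fP[OF e] realizesD(1)[OF F(2)] by metis
    qed (use fx w in simp)
    show "\<exists>U. openin T U \<and> z \<in> U \<and> U \<subseteq> I \<and> (\<forall>u\<in>U. acc (f z) (f u))"
    proof (cases "z = x")
      case True
      then show ?thesis using I(1) accf fx z by (intro exI[of _ I]) simp
    next
      case False
      then obtain e where e: "e \<in> E" "z \<in> P e" using P_ex z by blast
      obtain U where U: "openin T U" "z \<in> U" "U \<subseteq> P e" "\<forall>u\<in>U. acc (F e z) (F e u)"
        using realizesD(2)[OF F(2)[OF e(1)] e(2)] by blast
      have "acc (f z) (f u)" if "u \<in> U" for u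
      proof -
        have "u \<in> P e" using U(3) that by blast
        then show ?thesis using U(4) that fP e by metis
      qed
      then show ?thesis using U PI by (intro exI[of _ U]) blast
    qed
    fix B U assume B: "B \<in> \<Phi>" "Box B \<notin> f z" and U: "openin T U" "z \<in> U"
    show "\<exists>u\<in>U \<inter> I. B \<notin> f u"
    proof (cases "z = x")
      case True
      show ?thesis
      proof (cases "B \<in> w")
        case False
        then show ?thesis using True U xI fx by auto
      next
        case Bw: True
        then have BC: "B \<in> C" using B True fx C(1) by simp
        obtain y where y: "y \<sqsubset> x" "\<And>u. y \<sqsubset> u \<Longrightarrow> u \<sqsubseteq> x \<Longrightarrow> u \<in> U"
          using U True xd unfolding openin_iff by auto
        obtain e where e: "e \<in> E" "y \<sqsubset> e" "c e = B" using cofinal_colour[OF y(1) BC] by blast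
        have "e \<in> U" using y(2)[OF e(2)] Ex[OF e(1)] less_imp_le by blast
        moreover have "B \<notin> f e" using fP[OF e(1) eP] F(1) e s[OF BC] by metis
        ultimately show ?thesis using EI[OF e(1)] by blast
      qed
    next
      case False
      then obtain e where e: "e \<in> E" "z \<in> P e" using P_ex z by blast
      then have "Box B \<notin> F e z" using B(2) fP by metis
      then obtain u where u: "u \<in> U \<inter> P e" "B \<notin> F e u"
        using realizesD(3)[OF F(2)[OF e(1)] e(2) B(1) _ U] by blast
      then have "B \<notin> f u" using fP[OF e(1)] by auto
      then show ?thesis using u(1) PI by blast
    qed
  qed
  then show ?thesis using fx accf by blast
qed

text \<open>
  The derivatives of \<open>r\<close> bound the available number of nested steps, and \<open>height_le\<close> the required one.
\<close>

lemma realize: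
  assumes "finite \<Phi>" "openin T I" "\<And>a b z. a \<in> I \<Longrightarrow> b \<in> I \<Longrightarrow> a \<sqsubseteq> z \<Longrightarrow> z \<sqsubseteq> b \<Longrightarrow> z \<in> I"
      "\<And>z. z \<in> I \<Longrightarrow> z \<sqsubseteq> x" "I \<inter> derived k = {x}" "mcs L w" "height_le \<Phi> k w"
  shows "\<exists>f. f x = w \<and> realizes \<Phi> I f \<and> (\<forall>z\<in>I. acc w (f z))"
  using assms(2-7)
proof (induction k arbitrary: I x w)
  case (0 I x w)
  have "Box B \<in> w" if B: "B \<in> \<Phi>" "B \<in> w" for B
  proof (rule ccontr)
    assume no: "Box B \<notin> w"
    obtain v where "mcs L v" "acc w v" "B \<notin> v" "Box (Imp B (Box B)) \<in> v"
      using grz_witness[OF 0(5) no] .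
    then have "selects \<Phi> w v" using B no unfolding selects_def by blast
    then show False using 0(6) by simp
  qed
  then have "realizes \<Phi> I (\<lambda>_. w)" by (rule realize_constant[OF 0(1,5)])
  then show ?case using acc_refl[OF 0(5)] by (intro exI[of _ "\<lambda>_. w"]) simp
next
  case (Suc k I x w)
  define C where "C = {B \<in> \<Phi>. B \<in> w \<and> Box B \<notin> w}"
  have finC: "finite C" using assms(1) by (simp add: C_def)
  show ?case
  proof (cases "C = {}")
    case True
    then have "realizes \<Phi> I (\<lambda>_. w)"
      unfolding C_def by (intro realize_constant[OF Suc.prems(1,5)]) blast
    then show ?thesis using acc_refl[OF Suc.prems(5)] by (intro exI[of _ "\<lambda>_. w"]) simp
  next
    case False
    have ex: "\<exists>v. mcs L v \<and> acc w v \<and> B \<notin> v \<and> height_le \<Phi> k v" if B: "B \<in> C" for B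
    proof -
      have "Box B \<notin> w" using B by (simp add: C_def)
      then obtain v where v: "mcs L v" "acc w v" "B \<notin> v" "Box (Imp B (Box B)) \<in> v"
        using grz_witness[OF Suc.prems(5)] by metis
      then have "selects \<Phi> w v" using B unfolding selects_def C_def by blast
      then show ?thesis using v Suc.prems(6) by auto
    qed
    define s where "s B = (SOME v. mcs L v \<and> acc w v \<and> B \<notin> v \<and> height_le \<Phi> k v)" for B
    have s: "mcs L (s B) \<and> acc w (s B) \<and> B \<notin> s B \<and> height_le \<Phi> k (s B)" if "B \<in> C" for B
      unfolding s_def by (rule someI_ex[OF ex[OF that]])
    show ?thesis
    proof (rule realize_step[OF Suc.prems(1-5) C_def finC False])
      show "acc w (s B) \<and> B \<notin> s B" if "B \<in> C" for B using s[OF that] by blast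
      show "\<exists>f. f e = s B \<and> realizes \<Phi> J f \<and> (\<forall>z\<in>J. acc (s B) (f z))"
        if "openin T J" "\<And>a b z. a \<in> J \<Longrightarrow> b \<in> J \<Longrightarrow> a \<sqsubseteq> z \<Longrightarrow> z \<sqsubseteq> b \<Longrightarrow> z \<in> J"
          "\<And>z. z \<in> J \<Longrightarrow> z \<sqsubseteq> e" "J \<inter> derived k = {e}" "B \<in> C" for J e B
        by (rule Suc.IH[OF that(1-4)]) (use s[OF that(5)] in simp_all)
    qed
  qed
qed

text \<open>
  A world refuting \<open>a\<close> can be put at the least point of \<open>derived k\<close>.
\<close>

lemma logic_of_subset:
  assumes k: "derived k \<noteq> {}" and a: "\<And>w. mcs L w \<Longrightarrow> height_le (boxed a) k w"
    and aT: "a \<in> logic_of T"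
  shows "a \<in> L"
proof (rule ccontr)
  assume "a \<notin> L"
  moreover have "theory_over L L" using mp unfolding theory_over_def by blast
  ultimately obtain w where w: "mcs L w" "a \<notin> w" using lindenbaum by metis
  obtain x where x: "x \<in> derived k" "\<And>z. z \<in> derived k \<Longrightarrow> x \<sqsubseteq> z"
    using derived_Field k by (rule ex_min) blast
  let ?I = "{z. z \<sqsubseteq> x}"
  have xF: "x \<in> Field r" using x(1) derived_Field by blast
  have IF: "?I \<subseteq> Field r" using le_Field by blast
  have "?I \<inter> derived k = {x}" using x le_refl[OF xF] le_antisym by blast
  then have "\<exists>f. f x = w \<and> realizes (boxed a) ?I f \<and> (\<forall>z\<in>?I. acc w (f z))"
    using le_trans by (intro realize[OF finite_boxed open_le[OF xF] _ _ _ w(1) a[OF w(1)]]) blast+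
  then obtain f where f: "f x = w" "realizes (boxed a) ?I f" by blast
  have "x \<notin> eval T (\<lambda>p. {z \<in> ?I. Var p \<in> f z}) a"
    using eval_realizes[OF f(2) order_refl _ IF] w(2) f(1) le_refl[OF xF] by simp
  moreover have "\<forall>p. {z \<in> ?I. Var p \<in> f z} \<subseteq> topspace T" using IF by auto
  ultimately show False using aT xF unfolding logic_of_def by auto
qed

end

context well_ordered_space
begin

lemma S4Grz_subset_logic_of: "S4Grz \<subseteq> logic_of T"
  unfolding S4Grz_def
  by (rule least_normal_logic_least[OF normal_logic_of]) (use S4_subset_logic_of grz_valid in simp)

theorem logic_of_unbounded:
  assumes "\<And>k. derived k \<noteq> {}"
  shows "logic_of T = S4Grz"
proof
  interpret canonical_realization r S4Grz
    by unfold_locales (simp_all add: S4Grz_def normal_least_normal_logic)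
  show "logic_of T \<subseteq> S4Grz"
  proof
    fix a assume a: "a \<in> logic_of T"
    show "a \<in> S4Grz"
    proof (rule logic_of_subset[OF assms _ a])
      show "height_le (boxed a) (card (boxed a)) w" if "mcs S4Grz w" for w
        by (rule height_le_card[OF finite_boxed that]) (auto intro: card_mono finite_boxed)
    qed
  qed
qed (rule S4Grz_subset_logic_of)

lemma logic_of_subset_S4Grz_bd:
  assumes "derived k \<noteq> {}"
  shows "logic_of T \<subseteq> S4Grz_bd (Suc k)"
proof -
  have sub: "insert (bd (Suc k)) S4Grz \<subseteq> S4Grz_bd (Suc k)"
    unfolding S4Grz_bd_def by (rule least_normal_logic_upper)
  interpret canonical_realization r "S4Grz_bd (Suc k)"
    using sub by unfold_locales (simp_all add: S4Grz_bd_def normal_least_normal_logic)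
  show "logic_of T \<subseteq> S4Grz_bd (Suc k)"
  proof
    fix a assume a: "a \<in> logic_of T"
    show "a \<in> S4Grz_bd (Suc k)"
      by (rule logic_of_subset[OF assms height_le_bd a]) (use sub in simp_all)
  qed
qed

theorem logic_of_bounded:
  assumes "derived k \<noteq> {}" "derived (Suc k) = {}"
  shows "logic_of T = S4Grz_bd (Suc k)"
proof
  show "logic_of T \<subseteq> S4Grz_bd (Suc k)" by (rule logic_of_subset_S4Grz_bd[OF assms(1)])
  show "S4Grz_bd (Suc k) \<subseteq> logic_of T"
    unfolding S4Grz_bd_def
    by (rule least_normal_logic_least[OF normal_logic_of])
      (use S4Grz_subset_logic_of bd_valid[OF assms(2)] in simp)
qed

lemma derived_decreasing: "derived (Suc k) \<subseteq> derived k"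
proof (induction k)
  case 0
  show ?case using derived_Field[of "Suc 0"] by (simp only: derived.simps(1))
next
  case (Suc k)
  then show ?case unfolding derived.simps(2)[of "Suc k"] derived.simps(2)[of k] by blast
qed

lemma derived_antimono: "j \<le> k \<Longrightarrow> derived k \<subseteq> derived j"
  using derived_decreasing by (rule lift_Suc_antimono_le)

text \<open>
  So the logic of a well-order depends only on the first derivative that is empty, if there is one.
\<close>

lemma logic_of_cases:
  assumes "Field r \<noteq> {}"
  obtains "\<And>k. derived k \<noteq> {}" "logic_of T = S4Grz"
  | k where "derived k \<noteq> {}" "derived (Suc k) = {}" "logic_of T = S4Grz_bd (Suc k)"
proof (cases "\<forall>k. derived k \<noteq> {}")
  case True
  then show ?thesis using that(1) logic_of_unbounded by blast
next
  case False
  define n where "n = (LEAST n. derived n = {})"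
  have n: "derived n = {}" unfolding n_def using False by (metis (mono_tags, lifting) LeastI)
  then have "n \<noteq> 0" using assms by (metis derived.simps(1))
  then obtain k where k: "n = Suc k" using not0_implies_Suc by blast
  have "derived k \<noteq> {}" using not_less_Least[of k "\<lambda>n. derived n = {}"] k unfolding n_def by simp
  then show ?thesis using that(2) n k logic_of_bounded by blast
qed

end


section \<open>Order isomorphisms\<close>

lemma topspace_interval_topology: "topspace (interval_topology r) = Field r"
  by (auto simp: interval_topology_def underS_def aboveS_def Field_def)

lemma continuous_map_order_isomorphism:
  assumes f: "bij_betw f (Field r) (Field s)"
    and iff: "\<And>x y. x \<in> Field r \<Longrightarrow> y \<in> Field r \<Longrightarrow> (x, y) \<in> r \<longleftrightarrow> (f x, f y) \<in> s"
  shows "continuous_map (interval_topology r) (interval_topology s) f"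
  unfolding interval_topology_def[of s]
proof (rule continuous_on_generated_topo)
  have inj: "x = y" if "f x = f y" "x \<in> Field r" "y \<in> Field r" for x y
    using f that by (auto simp: bij_betw_def inj_on_def)
  have img: "f ` Field r = Field s" using f by (simp add: bij_betw_def)
  have gen: "openin (interval_topology r) W"
    if "W \<in> insert (Field r) (underS r ` Field r \<union> aboveS r ` Field r)" for W
    using that unfolding interval_topology_def by (rule topology_generated_by_Basis)
  show "f ` topspace (interval_topology r) \<subseteq> \<Union> (insert (Field s) (underS s ` Field s \<union> aboveS s ` Field s))"
    using img by (simp add: topspace_interval_topology)
  have pre: "x \<in> f -` W \<inter> topspace (interval_topology r) \<longleftrightarrow> x \<in> Field r \<and> f x \<in> W" for x W
    by (auto simp: topspace_interval_topology)
  fix U assume "U \<in> insert (Field s) (underS s ` Field s \<union> aboveS s ` Field s)"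
  then have "U = Field s \<or> (\<exists>y\<in>Field s. U = underS s y) \<or> (\<exists>y\<in>Field s. U = aboveS s y)"
    by (simp only: insert_iff Un_iff image_iff)
  then show "openin (interval_topology r) (f -` U \<inter> topspace (interval_topology r))"
  proof (elim disjE bexE)
    assume "U = Field s"
    then have "f -` U \<inter> topspace (interval_topology r) = Field r"
      using img by (auto simp: topspace_interval_topology)
    then show ?thesis using gen[of "Field r"] by simp
  next
    fix y assume y: "y \<in> Field s" "U = underS s y"
    then obtain x where x: "x \<in> Field r" "y = f x" using img by (metis imageE)
    have "z \<in> f -` U \<inter> topspace (interval_topology r) \<longleftrightarrow> z \<in> underS r x" for z
      unfolding pre y(2) x(2) underS_def using iff[of z x] inj[of z x] x(1) FieldI1[of z x r] by auto
    then have "f -` U \<inter> topspace (interval_topology r) = underS r x" by (intro set_eqI)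
    then show ?thesis using gen[of "underS r x"] x(1) by simp
  next
    fix y assume y: "y \<in> Field s" "U = aboveS s y"
    then obtain x where x: "x \<in> Field r" "y = f x" using img by (metis imageE)
    have "z \<in> f -` U \<inter> topspace (interval_topology r) \<longleftrightarrow> z \<in> aboveS r x" for z
      unfolding pre y(2) x(2) aboveS_def using iff[of x z] inj[of x z] x(1) FieldI2[of x z r] by auto
    then have "f -` U \<inter> topspace (interval_topology r) = aboveS r x" by (intro set_eqI)
    then show ?thesis using gen[of "aboveS r x"] x(1) by simp
  qed
qed

lemma interval_topology_homeomorphic:
  assumes "iso r s f"
  shows "interval_topology r homeomorphic_space interval_topology s"
proof -
  have f: "bij_betw f (Field r) (Field s)"
    and iff: "\<And>x y. x \<in> Field r \<Longrightarrow> y \<in> Field r \<Longrightarrow> (x, y) \<in> r \<longleftrightarrow> (f x, f y) \<in> s"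
    using assms unfolding iso_iff2 by blast+
  let ?g = "inv_into (Field r) f"
  have g: "bij_betw ?g (Field s) (Field r)" by (rule bij_betw_inv_into[OF f])
  have gf: "?g (f x) = x" if "x \<in> Field r" for x by (rule bij_betw_inv_into_left[OF f that])
  have fg: "f (?g y) = y" if "y \<in> Field s" for y by (rule bij_betw_inv_into_right[OF f that])
  have gF: "?g y \<in> Field r" if "y \<in> Field s" for y using g that by (auto simp: bij_betw_def)
  have "(x, y) \<in> s \<longleftrightarrow> (?g x, ?g y) \<in> r" if "x \<in> Field s" "y \<in> Field s" for x y
    using iff[OF gF gF] fg that by metis
  then have "homeomorphic_maps (interval_topology r) (interval_topology s) f ?g"
    using continuous_map_order_isomorphism[OF f iff] continuous_map_order_isomorphism[OF g] gf fg
    unfolding homeomorphic_maps_def topspace_interval_topology by blast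
  then show ?thesis unfolding homeomorphic_space_def by blast
qed

lemma logic_of_stone_cech_iso:
  "iso r s f \<Longrightarrow> logic_of (\<beta> r) = logic_of (\<beta> s)"
  by (intro logic_of_homeomorphic stone_cech_homeomorphic interval_topology_homeomorphic)


section \<open>Powers of \<open>\<omega>\<close>\<close>

definition finsupp :: "'a rel \<Rightarrow> ('a \<Rightarrow> nat) set" where
  "finsupp \<alpha> = {f. finite {x. f x \<noteq> 0} \<and> {x. f x \<noteq> 0} \<subseteq> Field \<alpha>}"

lemma Field_omega_power: "Field (omega_power \<alpha>) = finsupp \<alpha>"
  unfolding omega_power_def finsupp_def Field_def by auto

lemma zero_finsupp: "(\<lambda>_. 0) \<in> finsupp \<alpha>"
  by (simp add: finsupp_def)

lemma finsupp_subset: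
  "f \<in> finsupp \<alpha> \<Longrightarrow> {x. h x \<noteq> 0} \<subseteq> insert z {x. f x \<noteq> 0} \<Longrightarrow> z \<in> Field \<alpha> \<Longrightarrow> h \<in> finsupp \<alpha>"
  unfolding finsupp_def by (auto intro: finite_subset)

context well_ordered_space
begin

abbreviation omega_less (infix "\<lhd>" 50) where
  "f \<lhd> g \<equiv> (f, g) \<in> omega_power r \<and> f \<noteq> g"

lemma omega_less_iff:
  "f \<lhd> g \<longleftrightarrow> f \<in> finsupp r \<and> g \<in> finsupp r \<and>
     (\<exists>z\<in>Field r. f z < g z \<and> (\<forall>x. z \<sqsubset> x \<longrightarrow> f x = g x))"
  unfolding omega_power_def finsupp_def less_def by (auto; metis)

lemma omega_lessI:
  "f \<in> finsupp r \<Longrightarrow> g \<in> finsupp r \<Longrightarrow> z \<in> Field r \<Longrightarrow> f z < g z \<Longrightarrow>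
     (\<And>x. z \<sqsubset> x \<Longrightarrow> f x = g x) \<Longrightarrow> f \<lhd> g"
  unfolding omega_less_iff by blast

lemma omega_lessE:
  assumes "f \<lhd> g"
  obtains z where "z \<in> Field r" "f z < g z" "\<And>x. z \<sqsubset> x \<Longrightarrow> f x = g x"
  using assms unfolding omega_less_iff by blast

lemma omega_less_trans:
  assumes "f \<lhd> g" "g \<lhd> h"
  shows "f \<lhd> h"
proof -
  obtain z where z: "z \<in> Field r" "f z < g z" "\<And>x. z \<sqsubset> x \<Longrightarrow> f x = g x"
    by (rule omega_lessE[OF assms(1)]) blast
  obtain y where y: "y \<in> Field r" "g y < h y" "\<And>x. y \<sqsubset> x \<Longrightarrow> g x = h x"
    by (rule omega_lessE[OF assms(2)]) blast
  have F: "f \<in> finsupp r" "h \<in> finsupp r" using assms unfolding omega_less_iff by blast+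
  consider "z = y" | "z \<sqsubset> y" | "y \<sqsubset> z" using le_total[OF z(1) y(1)] by (auto simp: less_def)
  then show ?thesis
  proof cases
    case 1
    then show ?thesis using z y by (intro omega_lessI[OF F z(1)]) auto
  next
    case 2
    then show ?thesis using z(3) y less_trans[OF 2] by (intro omega_lessI[OF F y(1)]) auto
  next
    case 3
    then show ?thesis using z y(3) less_trans[OF 3] by (intro omega_lessI[OF F z(1)]) auto
  qed
qed

lemma omega_less_irrefl: "\<not> f \<lhd> f" by simp

lemma omega_less_total:
  assumes "f \<in> finsupp r" "g \<in> finsupp r"
  shows "f = g \<or> f \<lhd> g \<or> g \<lhd> f"
proof (cases "f = g")
  case False
  let ?D = "{x. f x \<noteq> g x}"
  have "?D \<subseteq> {x. f x \<noteq> 0} \<union> {x. g x \<noteq> 0}" by auto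
  then have D: "finite ?D" "?D \<subseteq> Field r"
    using assms unfolding finsupp_def by (auto intro: finite_subset)
  have "?D \<noteq> {}" using False by auto
  then obtain z where z: "f z \<noteq> g z" "\<And>x. f x \<noteq> g x \<Longrightarrow> x \<sqsubseteq> z"
    using finite_max[OF D(1) _ D(2)] by blast
  have eq: "f x = g x" if "z \<sqsubset> x" for x using z(2)[of x] not_less_le[OF that] by blast
  have "z \<in> Field r" using z(1) D(2) by blast
  then have "f \<lhd> g \<or> g \<lhd> f"
    using z(1) eq omega_lessI[OF assms, of z] omega_lessI[OF assms(2,1), of z]
    by (metis linorder_neq_iff)
  then show ?thesis by blast
qed simp

text \<open>
  Well-foundedness of powers of \<open>\<omega>\<close> reduces to that of the multiset order: a function of finite
  support is a multiset of exponents, and the comparison at the largest difference implies the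
  comparison of multisets.
\<close>

lemma omega_less_mult:
  assumes "f \<lhd> g"
  shows "(Abs_multiset f, Abs_multiset g) \<in> mult (r - Id)"
proof -
  let ?M = "Abs_multiset f" and ?N = "Abs_multiset g"
  have F: "f \<in> finsupp r" "g \<in> finsupp r" using assms unfolding omega_less_iff by blast+
  then have M: "count ?M = f" and N: "count ?N = g"
    by (auto simp: finsupp_def intro!: count_Abs_multiset)
  obtain z where z: "z \<in> Field r" "f z < g z" "\<And>x. z \<sqsubset> x \<Longrightarrow> f x = g x"
    by (rule omega_lessE[OF assms]) blast
  have zJ: "z \<in># ?N - ?M" using z(2) M N by (simp add: in_diff_count)
  have "(k, z) \<in> r - Id" if k: "k \<in># ?M - ?N" for k
  proof -
    have gf: "g k < f k" using k M N by (simp add: in_diff_count)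
    then have "k \<in> Field r" using F(1) by (auto simp: finsupp_def)
    moreover have "\<not> z \<sqsubset> k" using z(3)[of k] gf by auto
    ultimately have "k \<sqsubseteq> z" using le_total z(1) by blast
    moreover have "k \<noteq> z" using gf z(2) by auto
    ultimately show ?thesis by simp
  qed
  then have "((?M \<inter># ?N) + (?M - ?N), (?M \<inter># ?N) + (?N - ?M)) \<in> mult (r - Id)"
    using zJ by (intro one_step_implies_mult) auto
  moreover have "(?M \<inter># ?N) + (?M - ?N) = ?M" "(?M \<inter># ?N) + (?N - ?M) = ?N"
    by (auto intro!: multiset_eqI)
  ultimately show ?thesis by simp
qed

lemma omega_power_well_order: "Well_order (omega_power r)"
proof -
  have "Refl (omega_power r)"
    unfolding refl_on_def Field_omega_power by (auto simp: omega_power_def finsupp_def)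
  moreover have "trans (omega_power r)"
    using omega_less_trans by (intro transI) metis
  moreover have "antisym (omega_power r)"
    using omega_less_trans omega_less_irrefl by (intro antisymI) metis
  moreover have "Total (omega_power r)"
    unfolding total_on_def Field_omega_power using omega_less_total by blast
  moreover have "wf (omega_power r - Id)"
  proof (rule wf_subset)
    have "wf (r - Id)" using well_order by (simp add: well_order_on_def)
    then show "wf (inv_image (mult (r - Id)) Abs_multiset)" by (intro wf_inv_image wf_mult)
    show "omega_power r - Id \<subseteq> inv_image (mult (r - Id)) Abs_multiset"
      using omega_less_mult by (auto simp: inv_image_def)
  qed
  moreover have "omega_power r \<subseteq> Field (omega_power r) \<times> Field (omega_power r)"
    by (auto simp: Field_def)
  ultimately show ?thesis by (simp add: well_order_on_def order_on_defs)
qed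

lemma zero_omega_less: "f \<in> finsupp r \<Longrightarrow> f \<noteq> (\<lambda>_. 0) \<Longrightarrow> (\<lambda>_. 0) \<lhd> f"
proof -
  assume f: "f \<in> finsupp r" "f \<noteq> (\<lambda>_. 0)"
  have "\<not> f \<lhd> (\<lambda>_. 0)" unfolding omega_less_iff by simp
  then show ?thesis using omega_less_total[OF zero_finsupp f(1)] f(2) by metis
qed

text \<open>
  Truncating \<open>f\<close> below \<open>\<nu>\<close> and increasing its value at \<open>\<nu>\<close> gives an element above \<open>f\<close> with least
  exponent \<open>\<nu>\<close>, and it stays below every element above \<open>f\<close> all of whose exponents exceed \<open>\<nu>\<close>.
\<close>

definition bump :: "'a \<Rightarrow> ('a \<Rightarrow> nat) \<Rightarrow> 'a \<Rightarrow> nat" where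
  "bump \<nu> f x = (if \<nu> \<sqsubset> x then f x else if x = \<nu> then Suc (f \<nu>) else 0)"

lemma bump:
  assumes f: "f \<in> finsupp r" and \<nu>: "\<nu> \<in> Field r"
  shows "bump \<nu> f \<in> finsupp r" "f \<lhd> bump \<nu> f" "bump \<nu> f \<noteq> (\<lambda>_. 0)"
    "\<And>x. bump \<nu> f x \<noteq> 0 \<Longrightarrow> \<nu> \<sqsubseteq> x"
    "\<And>g. f \<lhd> g \<Longrightarrow> (\<And>x. g x \<noteq> 0 \<Longrightarrow> \<nu> \<sqsubset> x) \<Longrightarrow> bump \<nu> f \<lhd> g"
proof -
  show fin: "bump \<nu> f \<in> finsupp r"
    by (rule finsupp_subset[OF f _ \<nu>]) (auto simp: bump_def)
  show "f \<lhd> bump \<nu> f"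
    by (rule omega_lessI[OF f fin \<nu>]) (auto simp: bump_def less_irrefl)
  show "bump \<nu> f \<noteq> (\<lambda>_. 0)" by (auto simp: bump_def less_irrefl fun_eq_iff intro!: exI[of _ \<nu>])
  show "\<nu> \<sqsubseteq> x" if "bump \<nu> f x \<noteq> 0" for x
    using that le_refl[OF \<nu>] by (auto simp: bump_def less_def split: if_splits)
  show "bump \<nu> f \<lhd> g" if g: "f \<lhd> g" "\<And>x. g x \<noteq> 0 \<Longrightarrow> \<nu> \<sqsubset> x" for g
  proof -
    obtain d where d: "d \<in> Field r" "f d < g d" "\<And>x. d \<sqsubset> x \<Longrightarrow> f x = g x"
      by (rule omega_lessE[OF g(1)]) blast
    have "\<nu> \<sqsubset> d" using g(2) d(2) by auto
    moreover have "g \<in> finsupp r" using g(1) unfolding omega_less_iff by blast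
    ultimately show ?thesis
      using d less_trans[of \<nu> d] by (intro omega_lessI[OF fin _ d(1)]) (auto simp: bump_def)
  qed
qed

end

text \<open>
  Functions are transported along \<open>h\<close> and extended by zero.
\<close>

lemma omega_power_iso:
  assumes \<alpha>: "Well_order \<alpha>" and \<alpha>': "Well_order \<alpha>'" and h: "iso \<alpha> \<alpha>' h"
  shows "\<exists>H. iso (omega_power \<alpha>) (omega_power \<alpha>') H"
proof -
  interpret A: well_ordered_space \<alpha> by (simp add: well_ordered_space_def \<alpha>)
  interpret B: well_ordered_space \<alpha>' by (simp add: well_ordered_space_def \<alpha>')
  have bij: "bij_betw h (Field \<alpha>) (Field \<alpha>')"
    and iff: "\<And>x y. x \<in> Field \<alpha> \<Longrightarrow> y \<in> Field \<alpha> \<Longrightarrow> (x, y) \<in> \<alpha> \<longleftrightarrow> (h x, h y) \<in> \<alpha>'"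
    using h unfolding iso_iff2 by blast+
  let ?k = "inv_into (Field \<alpha>) h"
  have kh: "?k (h x) = x" if "x \<in> Field \<alpha>" for x by (rule bij_betw_inv_into_left[OF bij that])
  have hk: "h (?k y) = y" if "y \<in> Field \<alpha>'" for y by (rule bij_betw_inv_into_right[OF bij that])
  have kF: "?k y \<in> Field \<alpha>" if "y \<in> Field \<alpha>'" for y
    using bij_betw_inv_into[OF bij] that by (auto simp: bij_betw_def)
  have hF: "h x \<in> Field \<alpha>'" if "x \<in> Field \<alpha>" for x using bij that by (auto simp: bij_betw_def)
  define H where "H f y = (if y \<in> Field \<alpha>' then f (?k y) else 0)" for f :: "'a \<Rightarrow> nat" and y
  define G where "G g x = (if x \<in> Field \<alpha> then g (h x) else 0)" for g :: "'b \<Rightarrow> nat" and x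
  have HF: "H f \<in> finsupp \<alpha>'" if f: "f \<in> finsupp \<alpha>" for f
  proof -
    have "{y. H f y \<noteq> 0} \<subseteq> h ` {x. f x \<noteq> 0}"
    proof
      fix y assume "y \<in> {y. H f y \<noteq> 0}"
      then have "y \<in> Field \<alpha>'" "f (?k y) \<noteq> 0" by (auto simp: H_def split: if_splits)
      then show "y \<in> h ` {x. f x \<noteq> 0}" by (intro image_eqI[of _ _ "?k y"]) (simp_all add: hk)
    qed
    then have "finite {y. H f y \<noteq> 0}" by (rule finite_surj[rotated]) (use f in \<open>simp add: finsupp_def\<close>)
    moreover have "{y. H f y \<noteq> 0} \<subseteq> Field \<alpha>'" by (auto simp: H_def)
    ultimately show ?thesis by (simp add: finsupp_def)
  qed
  have GF: "G g \<in> finsupp \<alpha>" if g: "g \<in> finsupp \<alpha>'" for g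
  proof -
    have "{x. G g x \<noteq> 0} \<subseteq> ?k ` {y. g y \<noteq> 0}"
    proof
      fix x assume "x \<in> {x. G g x \<noteq> 0}"
      then have "x \<in> Field \<alpha>" "g (h x) \<noteq> 0" by (auto simp: G_def split: if_splits)
      then show "x \<in> ?k ` {y. g y \<noteq> 0}" by (intro image_eqI[of _ _ "h x"]) (simp_all add: kh)
    qed
    then have "finite {x. G g x \<noteq> 0}" by (rule finite_surj[rotated]) (use g in \<open>simp add: finsupp_def\<close>)
    moreover have "{x. G g x \<noteq> 0} \<subseteq> Field \<alpha>" by (auto simp: G_def)
    ultimately show ?thesis by (simp add: finsupp_def)
  qed
  have out: "f x = 0" if "f \<in> finsupp \<gamma>" "x \<notin> Field \<gamma>" for f x and \<gamma> :: "'c rel"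
    using that by (auto simp: finsupp_def)
  have GH: "G (H f) = f" if "f \<in> finsupp \<alpha>" for f
  proof
    fix x show "G (H f) x = f x"
      by (cases "x \<in> Field \<alpha>") (simp_all add: G_def H_def hF kh out[OF that])
  qed
  have HG: "H (G g) = g" if "g \<in> finsupp \<alpha>'" for g
  proof
    fix y show "H (G g) y = g y"
      by (cases "y \<in> Field \<alpha>'") (simp_all add: G_def H_def kF hk out[OF that])
  qed
  have bijH: "bij_betw H (finsupp \<alpha>) (finsupp \<alpha>')"
    by (rule bij_betw_byWitness[of _ G]) (use GH HG HF GF in auto)
  have less: "H f \<in> finsupp \<alpha>' \<and> B.omega_less (H f) (H g)"
    if fg: "A.omega_less f g" for f g
  proof -
    have F: "f \<in> finsupp \<alpha>" "g \<in> finsupp \<alpha>" using fg unfolding A.omega_less_iff by blast+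
    obtain z where z: "z \<in> Field \<alpha>" "f z < g z" "\<And>x. A.less z x \<Longrightarrow> f x = g x"
      by (rule A.omega_lessE[OF fg]) blast
    have "H f y = H g y" if y: "B.less (h z) y" for y
    proof -
      have yF: "y \<in> Field \<alpha>'" using B.less_Field[OF y] by blast
      then have "A.less z (?k y)"
        using y iff[OF z(1) kF] hk kF unfolding A.less_def B.less_def by metis
      then show ?thesis using z(3) yF by (simp add: H_def)
    qed
    then have "B.omega_less (H f) (H g)"
      using z hF kh by (intro B.omega_lessI[OF HF[OF F(1)] HF[OF F(2)], of "h z"]) (auto simp: H_def)
    then show ?thesis using HF F by blast
  qed
  have "(f, g) \<in> omega_power \<alpha> \<longleftrightarrow> (H f, H g) \<in> omega_power \<alpha>'"
    if F: "f \<in> finsupp \<alpha>" "g \<in> finsupp \<alpha>" for f g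
  proof -
    have refl: "(f, f) \<in> omega_power \<alpha>" "(H f, H f) \<in> omega_power \<alpha>'"
      using F HF[OF F(1)] by (auto simp: omega_power_def finsupp_def)
    have "\<not> A.omega_less g f" if "(f, g) \<in> omega_power \<alpha>" "f \<noteq> g"
      using A.omega_less_trans[of f g f] that by blast
    moreover have "\<not> B.omega_less (H g) (H f)" if "(H f, H g) \<in> omega_power \<alpha>'" "H f \<noteq> H g"
      using B.omega_less_trans[of "H f" "H g" "H f"] that by blast
    moreover have "H f = H g \<Longrightarrow> f = g" using GH F by metis
    ultimately show ?thesis
      using A.omega_less_total[OF F] less[of f g] less[of g f] refl by metis
  qed
  then have "iso (omega_power \<alpha>) (omega_power \<alpha>') H"
    unfolding iso_iff2 Field_omega_power using bijH by blast
  then show ?thesis by blast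
qed

lemma L_omega_eq:
  assumes \<alpha>: "Well_order \<alpha>" and fin: "finite (Field \<alpha>)"
  shows "L_omega (card (Field \<alpha>)) = logic_of (\<beta> (omega_power \<alpha>))"
proof -
  let ?n = "card (Field \<alpha>)"
  obtain h where h: "bij_betw h {0..<?n} (Field \<alpha>)" using ex_bij_betw_nat_finite[OF fin] by blast
  have F: "Field (natLeq_on ?n) = {0..<?n}" by (auto simp: Field_natLeq_on)
  have "(natLeq_on ?n, dir_image (natLeq_on ?n) h) \<in> ordIso"
    using h by (intro dir_image_ordIso natLeq_on_Well_order) (simp add: F bij_betw_def)
  moreover have "(dir_image (natLeq_on ?n) h, \<alpha>) \<in> ordIso"
  proof (rule finite_well_order_on_ordIso[OF fin])
    have "Field (dir_image (natLeq_on ?n) h) = Field \<alpha>"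
      unfolding dir_image_Field F using h by (simp add: bij_betw_def)
    moreover have "Well_order (dir_image (natLeq_on ?n) h)"
      using h by (intro Well_order_dir_image natLeq_on_Well_order) (simp add: F bij_betw_def)
    ultimately show "well_order_on (Field \<alpha>) (dir_image (natLeq_on ?n) h)" by simp
  qed (rule \<alpha>)
  ultimately have "(natLeq_on ?n, \<alpha>) \<in> ordIso" by (rule ordIso_transitive)
  then obtain k where "iso (natLeq_on ?n) \<alpha> k" by (auto simp: ordIso_def)
  from omega_power_iso[OF natLeq_on_Well_order \<alpha> this]
  show ?thesis unfolding L_omega_def using logic_of_stone_cech_iso by blast
qed


section \<open>Derived sets of blocks\<close>

context well_ordered_space
begin

lemma well_ordered_Restr: "well_ordered_space (Restr r A)"
  by (simp add: well_ordered_space_def Well_order_Restr well_order)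

lemma Field_Restr: "A \<subseteq> Field r \<Longrightarrow> Field (Restr r A) = A"
  using Refl_Field_Restr2 linear by (auto simp: order_on_defs)

text \<open>
  The end \<open>p\<close> belongs to the data, because it is the point that inherits a rank from the block. The final
  block of a sum has no end and is not meant here.
\<close>

definition omega_block :: "'b rel \<Rightarrow> (('b \<Rightarrow> nat) \<Rightarrow> 'a) \<Rightarrow> 'a \<Rightarrow> bool" where
  "omega_block \<alpha> g p \<longleftrightarrow> p \<in> Field r \<and>
     (\<forall>f\<in>finsupp \<alpha>. \<forall>h\<in>finsupp \<alpha>. (f, h) \<in> omega_power \<alpha> \<longleftrightarrow> g f \<sqsubseteq> g h) \<and>
     g ` finsupp \<alpha> = {z. g (\<lambda>_. 0) \<sqsubseteq> z \<and> z \<sqsubset> p}"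

context
  fixes \<alpha> :: "'b rel" and g p
  assumes \<alpha>: "Well_order \<alpha>" and block: "omega_block \<alpha> g p"
begin

interpretation A: well_ordered_space \<alpha> by (simp add: well_ordered_space_def \<alpha>)

lemma block_p: "p \<in> Field r" using block by (simp add: omega_block_def)

lemma block_le:
  "f \<in> finsupp \<alpha> \<Longrightarrow> h \<in> finsupp \<alpha> \<Longrightarrow> g f \<sqsubseteq> g h \<longleftrightarrow> (f, h) \<in> omega_power \<alpha>"
  using block by (simp add: omega_block_def)

lemma block_image: "g ` finsupp \<alpha> = {z. g (\<lambda>_. 0) \<sqsubseteq> z \<and> z \<sqsubset> p}"
  using block by (simp add: omega_block_def)

lemma block_below_p: "f \<in> finsupp \<alpha> \<Longrightarrow> g f \<sqsubset> p" and block_zero_le: "f \<in> finsupp \<alpha> \<Longrightarrow> g (\<lambda>_. 0) \<sqsubseteq> g f"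
  using block_image by auto

lemma block_less:
  assumes "f \<in> finsupp \<alpha>" "h \<in> finsupp \<alpha>"
  shows "g f \<sqsubset> g h \<longleftrightarrow> A.omega_less f h"
proof -
  have "f = h" if "g f = g h"
  proof (rule ccontr)
    assume "f \<noteq> h"
    moreover have "g f \<sqsubseteq> g h" "g h \<sqsubseteq> g f"
      using that le_refl less_Field[OF block_below_p[OF assms(2)]] by auto
    ultimately have "A.omega_less f h" "A.omega_less h f" using block_le assms by auto
    then show False using A.omega_less_trans by blast
  qed
  then show ?thesis using block_le[OF assms] by (auto simp: less_def)
qed

text \<open>
  Points below a point of the block other than its first can be replaced by points of the block.
\<close>

lemma block_approx:
  assumes y: "y \<sqsubset> z" and z: "z = p \<or> (\<exists>f\<in>finsupp \<alpha>. f \<noteq> (\<lambda>_. 0) \<and> z = g f)"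
  shows "\<exists>h\<in>finsupp \<alpha>. y \<sqsubseteq> g h \<and> g h \<sqsubset> z"
proof -
  have zp: "z \<sqsubseteq> p" using z block_below_p less_imp_le le_refl[OF block_p] by auto
  show ?thesis
  proof (cases "y \<sqsubset> g (\<lambda>_. 0)")
    case True
    have "g (\<lambda>_. 0) \<sqsubset> z"
      using z block_below_p[OF zero_finsupp] block_less[OF zero_finsupp] A.zero_omega_less by auto
    then show ?thesis using True less_imp_le zero_finsupp by blast
  next
    case False
    then have "g (\<lambda>_. 0) \<sqsubseteq> y"
      using le_total less_Field[OF y] less_Field[OF block_below_p[OF zero_finsupp]] by blast
    then obtain h where h: "h \<in> finsupp \<alpha>" "y = g h"
      using block_image less_le_trans[OF y zp] by (metis (mono_tags, lifting) imageE mem_Collect_eq)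
    then show ?thesis using y le_refl less_Field[OF y] by blast
  qed
qed

text \<open>
  If at least \<open>k\<close> exponents are below all exponents of \<open>f\<close>, then \<open>g f\<close> has rank at least \<open>k\<close>: bumping at
  the greatest of these exponents gives points with \<open>k - 1\<close> exponents to spare that approach \<open>g f\<close>.
\<close>

lemma block_derived:
  assumes f: "f \<in> finsupp \<alpha>" "f \<noteq> (\<lambda>_. 0)"
    and S: "finite S" "S \<subseteq> Field \<alpha>" "card S = k" "\<And>x \<nu>. f x \<noteq> 0 \<Longrightarrow> \<nu> \<in> S \<Longrightarrow> A.less \<nu> x"
  shows "g f \<in> derived k"
  using f S
proof (induction k arbitrary: f S)
  case 0
  then show ?case using less_Field[OF block_below_p] by simp
next
  case (Suc k)
  have "S \<noteq> {}" using Suc.prems by auto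
  then obtain \<nu> where \<nu>: "\<nu> \<in> S" "\<And>x. x \<in> S \<Longrightarrow> A.le x \<nu>"
    using A.finite_max[OF Suc.prems(3) _ Suc.prems(4)] by blast
  have \<nu>F: "\<nu> \<in> Field \<alpha>" using \<nu>(1) Suc.prems(4) by blast
  have "\<exists>z\<in>derived k. y \<sqsubset> z \<and> z \<sqsubset> g f" if y: "y \<sqsubset> g f" for y
  proof -
    have "\<exists>h\<in>finsupp \<alpha>. y \<sqsubseteq> g h \<and> g h \<sqsubset> g f"
      by (rule block_approx[OF y]) (use Suc.prems(1,2) in blast)
    then obtain h where h: "h \<in> finsupp \<alpha>" "y \<sqsubseteq> g h" "g h \<sqsubset> g f" by blast
    note b = A.bump[OF h(1) \<nu>F]
    have "A.less \<nu>' x" if "A.bump \<nu> h x \<noteq> 0" "\<nu>' \<in> S - {\<nu>}" for x \<nu>'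
      using that \<nu>(2)[of \<nu>'] b(4)[OF that(1)] A.less_le_trans[of \<nu>' \<nu> x] by (auto simp: A.less_def)
    then have "g (A.bump \<nu> h) \<in> derived k"
      using Suc.prems(3-5) \<nu>(1) by (intro Suc.IH[OF b(1,3), of "S - {\<nu>}"]) auto
    moreover have "g h \<sqsubset> g (A.bump \<nu> h)" using b(2) block_less[OF h(1) b(1)] by blast
    then have "y \<sqsubset> g (A.bump \<nu> h)" by (rule le_less_trans[OF h(2)])
    moreover have "A.omega_less h f" using h(3) block_less[OF h(1) Suc.prems(1)] by blast
    then have "A.omega_less (A.bump \<nu> h) f" by (rule b(5)) (use Suc.prems(6) \<nu>(1) in blast)
    then have "g (A.bump \<nu> h) \<sqsubset> g f" using block_less[OF b(1) Suc.prems(1)] by blast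
    ultimately show ?thesis by blast
  qed
  moreover have "g (\<lambda>_. 0) \<sqsubset> g f"
    using block_less[OF zero_finsupp Suc.prems(1)] A.zero_omega_less[OF Suc.prems(1,2)] by blast
  ultimately show ?case by auto
qed

text \<open>
  The end of the block behaves like an element whose exponents exceed all of \<open>Field \<alpha>\<close>.
\<close>

lemma block_end_derived:
  assumes S: "finite S" "S \<subseteq> Field \<alpha>" "card S = k"
  shows "p \<in> derived k"
proof (cases k)
  case 0
  then show ?thesis using block_p by simp
next
  case (Suc j)
  then have "S \<noteq> {}" using S by auto
  then obtain \<nu> where \<nu>: "\<nu> \<in> S" "\<And>x. x \<in> S \<Longrightarrow> A.le x \<nu>"
    using A.finite_max[OF S(1) _ S(2)] by blast
  have \<nu>F: "\<nu> \<in> Field \<alpha>" using \<nu>(1) S(2) by blast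
  have "\<exists>z\<in>derived j. y \<sqsubset> z \<and> z \<sqsubset> p" if y: "y \<sqsubset> p" for y
  proof -
    obtain h where h: "h \<in> finsupp \<alpha>" "y \<sqsubseteq> g h" "g h \<sqsubset> p" using block_approx[OF y] by blast
    note b = A.bump[OF h(1) \<nu>F]
    have "A.less \<nu>' x" if "A.bump \<nu> h x \<noteq> 0" "\<nu>' \<in> S - {\<nu>}" for x \<nu>'
      using that \<nu>(2)[of \<nu>'] b(4)[OF that(1)] A.less_le_trans[of \<nu>' \<nu> x] by (auto simp: A.less_def)
    then have "g (A.bump \<nu> h) \<in> derived j"
      using S Suc \<nu>(1) by (intro block_derived[OF b(1,3), of "S - {\<nu>}"]) auto
    moreover have "g h \<sqsubset> g (A.bump \<nu> h)" using b(2) block_less[OF h(1) b(1)] by blast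
    then have "y \<sqsubset> g (A.bump \<nu> h)" by (rule le_less_trans[OF h(2)])
    ultimately show ?thesis using block_below_p[OF b(1)] by blast
  qed
  moreover have "g (\<lambda>_. 0) \<sqsubset> p" by (rule block_below_p[OF zero_finsupp])
  ultimately show ?thesis unfolding Suc by auto
qed

text \<open>
  Here \<open>\<mu>\<close> is the least exponent of \<open>f\<close>, and \<open>f'\<close> uses it once less. Everything strictly between \<open>f'\<close>
  and \<open>f\<close> agrees with \<open>f'\<close> from \<open>\<mu>\<close> upwards, so it must have an exponent below \<open>\<mu>\<close>.
\<close>

lemma omega_less_predecessor:
  assumes f: "f \<in> finsupp \<alpha>" "f \<noteq> (\<lambda>_. 0)"
  obtains f' \<mu> where "A.omega_less f' f" "f \<mu> \<noteq> 0" "\<And>x. f x \<noteq> 0 \<Longrightarrow> A.le \<mu> x"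
    "\<And>h. A.omega_less f' h \<Longrightarrow> A.omega_less h f \<Longrightarrow> \<exists>e. A.less e \<mu> \<and> h e \<noteq> 0"
proof -
  have "{x. f x \<noteq> 0} \<subseteq> Field \<alpha>" "{x. f x \<noteq> 0} \<noteq> {}" using f by (auto simp: finsupp_def)
  then obtain \<mu> where \<mu>: "f \<mu> \<noteq> 0" "\<And>x. f x \<noteq> 0 \<Longrightarrow> A.le \<mu> x" by (rule A.ex_min) blast
  have \<mu>F: "\<mu> \<in> Field \<alpha>" using f(1) \<mu>(1) by (auto simp: finsupp_def)
  define f' where "f' = f(\<mu> := f \<mu> - 1)"
  have f': "f' \<in> finsupp \<alpha>" by (rule finsupp_subset[OF f(1) _ \<mu>F]) (auto simp: f'_def)
  have "A.omega_less f' f"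
    by (rule A.omega_lessI[OF f' f(1) \<mu>F]) (use \<mu>(1) in \<open>auto simp: f'_def A.less_irrefl\<close>)
  moreover have "\<exists>e. A.less e \<mu> \<and> h e \<noteq> 0" if h: "A.omega_less f' h" "A.omega_less h f" for h
  proof -
    obtain d where d: "d \<in> Field \<alpha>" "h d < f d" "\<And>x. A.less d x \<Longrightarrow> h x = f x"
      by (rule A.omega_lessE[OF h(2)]) blast
    obtain e where e: "e \<in> Field \<alpha>" "f' e < h e" "\<And>x. A.less e x \<Longrightarrow> f' x = h x"
      by (rule A.omega_lessE[OF h(1)]) blast
    have \<mu>d: "A.le \<mu> d" using \<mu>(2)[of d] d(2) by simp
    have f'x: "f' x = f x" if "x \<noteq> \<mu>" for x using that by (simp add: f'_def)
    have "\<not> A.less d e"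
    proof
      assume de: "A.less d e"
      then have "e \<noteq> \<mu>" using A.not_less_le \<mu>d by blast
      then show False using f'x[of e] e(2) d(3)[OF de] by simp
    qed
    moreover have "e \<noteq> d" if "d \<noteq> \<mu>" using f'x[OF that] e(2) d(2) by auto
    moreover have "\<not> A.less e d" if "d \<noteq> \<mu>" using f'x[OF that] e(3)[of d] d(2) by auto
    ultimately have d\<mu>: "d = \<mu>" using A.le_total[OF e(1) d(1)] A.le_less by metis
    have "e \<noteq> \<mu>" using e(2) d(2) d\<mu> by (auto simp: f'_def)
    then have "A.less e \<mu>"
      using A.le_total[OF e(1) d(1)] \<open>\<not> A.less d e\<close> d\<mu> by (auto simp: A.less_def)
    then show ?thesis using e(2) by auto
  qed
  ultimately show ?thesis using that \<mu> by blast
qed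

text \<open>
  Conversely, the rank of \<open>g f\<close> is at most the number of exponents below all exponents of \<open>f\<close>, because
  \<open>omega_less_predecessor\<close> makes this number drop strictly near \<open>g f\<close>.
\<close>

lemma derived_block_subset:
  assumes least: "\<And>z. z \<in> Field r \<Longrightarrow> g (\<lambda>_. 0) \<sqsubseteq> z \<and> z \<sqsubseteq> p" and fin: "finite (Field \<alpha>)"
    and z: "z \<in> derived k"
  shows "z = p \<and> k \<le> card (Field \<alpha>) \<or>
    (\<exists>f\<in>finsupp \<alpha>. z = g f \<and> (f \<noteq> (\<lambda>_. 0) \<or> k = 0) \<and>
       k \<le> card {x \<in> Field \<alpha>. \<forall>y. f y \<noteq> 0 \<longrightarrow> A.less x y})"
  using z
proof (induction k arbitrary: z)
  case 0
  then have zF: "z \<in> Field r" by simp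
  show ?case
  proof (cases "z = p")
    case False
    then have "z \<in> g ` finsupp \<alpha>" using least[OF zF] block_image by (simp add: less_def)
    then show ?thesis by auto
  qed simp
next
  case (Suc k)
  have zF: "z \<in> Field r" using Suc.prems derived_Field by blast
  have ex: "\<exists>y. y \<sqsubset> z" and lim: "\<And>y. y \<sqsubset> z \<Longrightarrow> \<exists>u\<in>derived k. y \<sqsubset> u \<and> u \<sqsubset> z"
    using Suc.prems by auto
  have inner: "\<exists>f\<in>finsupp \<alpha>. u = g f \<and> f \<noteq> (\<lambda>_. 0) \<and>
       k \<le> card {x \<in> Field \<alpha>. \<forall>y. f y \<noteq> 0 \<longrightarrow> A.less x y}"
    if u: "u \<in> derived k" "g h \<sqsubset> u" "u \<sqsubset> z" "h \<in> finsupp \<alpha>" for u h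
  proof -
    have "u \<noteq> p" using u(3) least[OF zF] not_less_le by blast
    then obtain f where f: "f \<in> finsupp \<alpha>" "u = g f" "k \<le> card {x \<in> Field \<alpha>. \<forall>y. f y \<noteq> 0 \<longrightarrow> A.less x y}"
      using Suc.IH[OF u(1)] by blast
    moreover have "f \<noteq> (\<lambda>_. 0)" using u(2) f(2) block_zero_le[OF u(4)] not_less_le by blast
    ultimately show ?thesis by blast
  qed
  show ?case
  proof (cases "z = p")
    case True
    then obtain u where u: "u \<in> derived k" "g (\<lambda>_. 0) \<sqsubset> u" "u \<sqsubset> z"
      using lim[of "g (\<lambda>_. 0)"] block_below_p[OF zero_finsupp] by blast
    obtain f where f: "f \<in> finsupp \<alpha>" "f \<noteq> (\<lambda>_. 0)"
      and k: "k \<le> card {x \<in> Field \<alpha>. \<forall>y. f y \<noteq> 0 \<longrightarrow> A.less x y}"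
      using inner[OF u zero_finsupp] by blast
    obtain y where y: "f y \<noteq> 0" using f(2) by (auto simp: fun_eq_iff)
    then have "y \<in> Field \<alpha>" using f(1) by (auto simp: finsupp_def)
    then have "{x \<in> Field \<alpha>. \<forall>y. f y \<noteq> 0 \<longrightarrow> A.less x y} \<subset> Field \<alpha>"
      using y A.less_irrefl by blast
    then have "card {x \<in> Field \<alpha>. \<forall>y. f y \<noteq> 0 \<longrightarrow> A.less x y} < card (Field \<alpha>)"
      by (rule psubset_card_mono[OF fin])
    then show ?thesis using True k by simp
  next
    case False
    then have "z \<in> g ` finsupp \<alpha>" using least[OF zF] block_image by (simp add: less_def)
    then obtain f where f: "f \<in> finsupp \<alpha>" "z = g f" by auto
    have f0: "f \<noteq> (\<lambda>_. 0)"
    proof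
      assume "f = (\<lambda>_. 0)"
      then show False using ex f(2) least less_Field not_less_le by metis
    qed
    obtain f' \<mu> where f': "A.omega_less f' f" and \<mu>: "f \<mu> \<noteq> 0" "\<And>x. f x \<noteq> 0 \<Longrightarrow> A.le \<mu> x"
      and between: "\<And>h. A.omega_less f' h \<Longrightarrow> A.omega_less h f \<Longrightarrow> \<exists>e. A.less e \<mu> \<and> h e \<noteq> 0"
      using omega_less_predecessor[OF f(1) f0] by metis
    have f'F: "f' \<in> finsupp \<alpha>" using f' unfolding A.omega_less_iff by blast
    have "g f' \<sqsubset> z" using block_less[OF f'F f(1)] f' f(2) by blast
    then obtain u where u: "u \<in> derived k" "g f' \<sqsubset> u" "u \<sqsubset> z" using lim by blast
    obtain h where h: "h \<in> finsupp \<alpha>" "u = g h"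
      and k: "k \<le> card {x \<in> Field \<alpha>. \<forall>y. h y \<noteq> 0 \<longrightarrow> A.less x y}"
      using inner[OF u f'F] by blast
    have "A.omega_less f' h" "A.omega_less h f"
      using u(2,3) h block_less[OF f'F h(1)] block_less[OF h(1) f(1)] f(2) by blast+
    then obtain e where e: "A.less e \<mu>" "h e \<noteq> 0" using between by blast
    let ?S = "\<lambda>h. {x \<in> Field \<alpha>. \<forall>y. h y \<noteq> 0 \<longrightarrow> A.less x y}"
    have "?S h \<subseteq> ?S f"
      using e A.less_trans A.less_le_trans \<mu>(2) by (smt (verit, best) mem_Collect_eq subsetI)
    moreover have "e \<in> ?S f" using A.less_Field[OF e(1)] A.less_le_trans[OF e(1) \<mu>(2)] by blast
    moreover have "e \<notin> ?S h" using e(2) A.less_irrefl by blast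
    ultimately have "?S h \<subset> ?S f" by blast
    then have "card (?S h) < card (?S f)" using fin by (intro psubset_card_mono) auto
    then show ?thesis using k f f0 by auto
  qed
qed

lemma derived_block_empty:
  assumes "\<And>z. z \<in> Field r \<Longrightarrow> g (\<lambda>_. 0) \<sqsubseteq> z \<and> z \<sqsubseteq> p" "finite (Field \<alpha>)"
  shows "derived (Suc (card (Field \<alpha>))) = {}"
proof -
  have le: "card {x \<in> Field \<alpha>. \<forall>y. f y \<noteq> 0 \<longrightarrow> A.less x y} \<le> card (Field \<alpha>)" for f :: "'b \<Rightarrow> nat"
    by (rule card_mono[OF assms(2)]) blast
  have False if z: "z \<in> derived (Suc (card (Field \<alpha>)))" for z
  proof (rule derived_block_subset[OF _ assms(2) z, THEN disjE])
    show "g (\<lambda>_. 0) \<sqsubseteq> u \<and> u \<sqsubseteq> p" if "u \<in> Field r" for u by (rule assms(1)[OF that])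
  next
    assume "\<exists>f\<in>finsupp \<alpha>. z = g f \<and> (f \<noteq> (\<lambda>_. 0) \<or> Suc (card (Field \<alpha>)) = 0) \<and>
      Suc (card (Field \<alpha>)) \<le> card {x \<in> Field \<alpha>. \<forall>y. f y \<noteq> 0 \<longrightarrow> A.less x y}"
    then obtain f where "f \<in> finsupp \<alpha>"
      "Suc (card (Field \<alpha>)) \<le> card {x \<in> Field \<alpha>. \<forall>y. f y \<noteq> 0 \<longrightarrow> A.less x y}"
      by (elim bexE conjE)
    then show False using le[of f] by linarith
  qed simp
  then show ?thesis by blast
qed

end


section \<open>Splitting off the last block\<close>

text \<open>
  The interval \<open>[0, p]\<close> is clopen and compact, hence its own compactification.
\<close>

lemma logic_of_stone_cech_split:
  assumes p: "p \<in> Field r"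
  shows "logic_of (\<beta> r) =
    logic_of (interval_topology (Restr r {z. z \<sqsubseteq> p})) \<inter> logic_of (\<beta> (Restr r {z. p \<sqsubset> z}))"
proof -
  let ?A = "{z. z \<sqsubseteq> p}" and ?B = "{z. p \<sqsubset> z}"
  have B: "topspace T - ?A = ?B"
  proof (rule set_eqI)
    fix z show "z \<in> topspace T - ?A \<longleftrightarrow> z \<in> ?B"
      using le_total[OF _ p, of z] not_less_le[of p z] less_Field[of p z] by auto
  qed
  have TA: "subtopology T ?A = interval_topology (Restr r ?A)"
    by (rule subspace_eq_Restr[OF open_le[OF p]]) (metis le_trans mem_Collect_eq)
  have TB: "subtopology T ?B = interval_topology (Restr r ?B)"
    by (rule subspace_eq_Restr[OF open_above[OF p]]) (metis less_le_trans mem_Collect_eq)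
  interpret A: well_ordered_space "Restr r ?A" by (rule well_ordered_Restr)
  have FA: "Field (Restr r ?A) = ?A" using le_Field by (intro Field_Restr) auto
  have "logic_of (stone_cech A.T) = logic_of A.T"
    by (rule A.logic_of_stone_cech_compact[of p]) (use FA le_refl[OF p] in auto)
  then show ?thesis
    using logic_of_stone_cech_clopen[OF open_le[OF p] closed_le[OF p]] unfolding B TA TB by simp
qed

end

lemma singleton_logic:
  assumes "Well_order r" "Field r = {a}"
  shows "logic_of (interval_topology r) = S4Grz_bd (Suc 0)"
proof -
  interpret well_ordered_space r using assms(1) by (simp add: well_ordered_space_def)
  have "derived 0 \<noteq> {}" using assms by simp
  moreover have "derived (Suc 0) = {}" using less_Field assms(2) by (fastforce simp: less_def)
  ultimately show ?thesis by (rule logic_of_bounded)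
qed

lemma logic_of_subset_S4Grz_bd_1:
  assumes "Well_order r" "Field r \<noteq> {}"
  shows "logic_of (interval_topology r) \<subseteq> S4Grz_bd (Suc 0)"
proof -
  interpret well_ordered_space r using assms(1) by (simp add: well_ordered_space_def)
  show ?thesis by (rule logic_of_subset_S4Grz_bd) (use assms in simp)
qed

text \<open>
  This is the splitting at the least element, where the compact part is a single point.
\<close>

lemma omega_power_logic:
  assumes "Well_order \<alpha>"
  defines "W \<equiv> omega_power \<alpha>"
  shows "logic_of (\<beta> W) =
    S4Grz_bd (Suc 0) \<inter> logic_of (\<beta> (Restr W {z. ((\<lambda>_. 0), z) \<in> W \<and> (\<lambda>_. 0) \<noteq> z}))"
proof -
  interpret A: well_ordered_space \<alpha> using assms(1) by (simp add: well_ordered_space_def)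
  interpret W: well_ordered_space W
    using A.omega_power_well_order by (simp add: well_ordered_space_def W_def)
  have F: "(\<lambda>_. 0) \<in> Field W" by (simp add: W_def Field_omega_power zero_finsupp)
  have "{z. W.le z (\<lambda>_. 0)} = {\<lambda>_. 0}"
  proof -
    have "f = (\<lambda>_. 0)" if "W.le f (\<lambda>_. 0)" for f
    proof (rule ccontr)
      assume f: "f \<noteq> (\<lambda>_. 0)"
      have "f \<in> finsupp \<alpha>" using W.le_Field[OF that] by (simp add: W_def Field_omega_power)
      then have "A.omega_less (\<lambda>_. 0) f" by (rule A.zero_omega_less[OF _ f])
      then show False using that W.le_antisym f unfolding W_def by blast
    qed
    then show ?thesis using W.le_refl[OF F] by blast
  qed
  moreover have "logic_of (interval_topology (Restr W {\<lambda>_. 0})) = S4Grz_bd (Suc 0)"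
  proof (rule singleton_logic)
    show "Well_order (Restr W {\<lambda>_. 0})"
      using W.well_ordered_Restr by (simp only: well_ordered_space_def)
    show "Field (Restr W {\<lambda>_. 0}) = {\<lambda>_. 0}" by (rule W.Field_Restr) (use F in simp)
  qed
  ultimately show ?thesis using W.logic_of_stone_cech_split[OF F] by (simp add: W.less_def)
qed

context well_ordered_space
begin

text \<open>
  Comparing the splitting of \<open>r\<close> at \<open>p\<close> with the splitting of the final block at its least element,
  both have the same second part, and the logic of \<open>[0, p]\<close> lies below that of a point.
\<close>

theorem logic_of_final_block:
  assumes p: "p \<in> Field r" and \<alpha>: "Well_order \<alpha>"
    and le: "\<And>f h. f \<in> finsupp \<alpha> \<Longrightarrow> h \<in> finsupp \<alpha> \<Longrightarrow> (f, h) \<in> omega_power \<alpha> \<longleftrightarrow> g f \<sqsubseteq> g h"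
    and img: "g ` finsupp \<alpha> = {z. p \<sqsubseteq> z}" and zero: "g (\<lambda>_. 0) = p"
  shows "logic_of (\<beta> r) =
    logic_of (interval_topology (Restr r {z. z \<sqsubseteq> p})) \<inter> logic_of (\<beta> (omega_power \<alpha>))"
proof -
  let ?A = "{z. z \<sqsubseteq> p}" and ?B = "{z. p \<sqsubset> z}"
  define W where "W = omega_power \<alpha>"
  interpret A: well_ordered_space \<alpha> using \<alpha> by (simp add: well_ordered_space_def)
  interpret W: well_ordered_space W
    using A.omega_power_well_order by (simp add: well_ordered_space_def W_def)
  let ?C = "{z. ((\<lambda>_. 0), z) \<in> W \<and> (\<lambda>_. 0) \<noteq> z}"
  have FW: "Field W = finsupp \<alpha>" by (simp add: W_def Field_omega_power)
  have inj: "f = h" if "f \<in> finsupp \<alpha>" "h \<in> finsupp \<alpha>" "g f = g h" for f h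
  proof -
    have "g f \<sqsubseteq> g h" "g h \<sqsubseteq> g f" using that img le_Field le_refl by auto
    then show ?thesis using le that W.le_antisym unfolding W_def by metis
  qed
  have C: "?C \<subseteq> Field W" using W.le_Field by blast
  have FC: "Field (Restr W ?C) = ?C" by (rule W.Field_Restr[OF C])
  have FB: "Field (Restr r ?B) = ?B" using less_Field by (intro Field_Restr) auto
  have gC: "f \<in> ?C \<longleftrightarrow> g f \<in> ?B" if f: "f \<in> finsupp \<alpha>" for f
    using le[OF zero_finsupp f] inj[OF zero_finsupp f] zero by (auto simp: W_def less_def)
  have "bij_betw g ?C ?B"
    unfolding bij_betw_def
  proof
    show "inj_on g ?C" using inj C FW by (intro inj_onI) blast
    show "g ` ?C = ?B"
    proof
      show "g ` ?C \<subseteq> ?B" using gC C FW by blast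
      show "?B \<subseteq> g ` ?C"
      proof
        fix z assume z: "z \<in> ?B"
        then have "z \<in> g ` finsupp \<alpha>" unfolding img using less_imp_le by simp
        then obtain f where "f \<in> finsupp \<alpha>" "z = g f" by (elim imageE)
        then show "z \<in> g ` ?C" using gC z by blast
      qed
    qed
  qed
  moreover have "(f, h) \<in> Restr W ?C \<longleftrightarrow> (g f, g h) \<in> Restr r ?B" if "f \<in> ?C" "h \<in> ?C" for f h
  proof -
    have F: "f \<in> finsupp \<alpha>" "h \<in> finsupp \<alpha>" using that C FW by blast+
    have "g f \<in> ?B" "g h \<in> ?B" using gC[OF F(1)] gC[OF F(2)] that by blast+
    then show ?thesis using le[OF F] that unfolding W_def by blast
  qed
  ultimately have "iso (Restr W ?C) (Restr r ?B) g" unfolding iso_iff2 FC FB by blast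
  then have eq: "logic_of (\<beta> (Restr W ?C)) = logic_of (\<beta> (Restr r ?B))"
    by (rule logic_of_stone_cech_iso)
  have "logic_of (interval_topology (Restr r ?A)) \<subseteq> S4Grz_bd (Suc 0)"
  proof (rule logic_of_subset_S4Grz_bd_1)
    show "Well_order (Restr r ?A)" using well_ordered_Restr by (simp only: well_ordered_space_def)
    have "Field (Restr r ?A) = ?A" using le_Field by (intro Field_Restr) auto
    then show "Field (Restr r ?A) \<noteq> {}" using le_refl[OF p] by blast
  qed
  then show ?thesis
    using logic_of_stone_cech_split[OF p] omega_power_logic[OF \<alpha>] eq unfolding W_def by blast
qed

end


section \<open>Sums of powers of \<open>\<omega>\<close>\<close>

lemma Field_ord_sum:
  assumes "\<forall>r\<in>set rs. Well_order r"
  shows "Field (ord_sum rs) = {(i, x). i < length rs \<and> x \<in> Field (rs ! i)}"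
proof -
  have "(x, x) \<in> rs ! i" if "i < length rs" "x \<in> Field (rs ! i)" for i x
    using assms nth_mem[OF that(1)] that(2) by (auto simp: well_order_on_def order_on_defs refl_on_def)
  then have "((i, x), (i, x)) \<in> ord_sum rs" if "i < length rs" "x \<in> Field (rs ! i)" for i x
    using that by (simp add: ord_sum_def)
  then have "{(i, x). i < length rs \<and> x \<in> Field (rs ! i)} \<subseteq> Field (ord_sum rs)"
    by (auto intro: FieldI1)
  moreover have "Field (ord_sum rs) \<subseteq> {(i, x). i < length rs \<and> x \<in> Field (rs ! i)}"
    by (auto simp: Field_def ord_sum_def)
  ultimately show ?thesis by (rule subset_antisym[rotated])
qed

lemma ord_sum_iff:
  "((i, x), (j, y)) \<in> ord_sum rs \<longleftrightarrow> i < length rs \<and> j < length rs \<and>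
     x \<in> Field (rs ! i) \<and> y \<in> Field (rs ! j) \<and> (i < j \<or> i = j \<and> (x, y) \<in> rs ! i)"
  by (simp add: ord_sum_def)

lemma ord_sum_well_order:
  assumes wo: "\<forall>r\<in>set rs. Well_order r"
  shows "Well_order (ord_sum rs)"
proof -
  let ?R = "ord_sum rs"
  have ws: "well_ordered_space (rs ! i)" if "i < length rs" for i
    using wo that by (simp add: well_ordered_space_def)
  note F = Field_ord_sum[OF wo]
  have refl: "Refl ?R"
    unfolding refl_on_def F using well_ordered_space.le_refl[OF ws] by (auto simp: ord_sum_iff)
  have sub: "?R \<subseteq> Field ?R \<times> Field ?R" by (auto simp: Field_def)
  have trans: "trans ?R"
  proof (rule transI)
    fix a b c assume ab: "(a, b) \<in> ?R" and bc: "(b, c) \<in> ?R"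
    obtain i x j y k z where [simp]: "a = (i, x)" "b = (j, y)" "c = (k, z)" by (metis surj_pair)
    show "(a, c) \<in> ?R"
      using ab bc well_ordered_space.le_trans[OF ws[of i], of x y z] by (auto simp: ord_sum_iff)
  qed
  have antisym: "antisym ?R"
  proof (rule antisymI)
    fix a b assume ab: "(a, b) \<in> ?R" and ba: "(b, a) \<in> ?R"
    obtain i x j y where [simp]: "a = (i, x)" "b = (j, y)" by (metis surj_pair)
    show "a = b"
      using ab ba well_ordered_space.le_antisym[OF ws[of i], of x y] by (auto simp: ord_sum_iff)
  qed
  have total: "Total ?R"
    unfolding total_on_def
  proof (intro ballI impI)
    fix a b assume ab: "a \<in> Field ?R" "b \<in> Field ?R"
    obtain i x j y where [simp]: "a = (i, x)" "b = (j, y)" by (metis surj_pair)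
    have *: "i < length rs" "j < length rs" "x \<in> Field (rs ! i)" "y \<in> Field (rs ! j)"
      using ab by (auto simp: F)
    have "i < j \<or> j < i \<or> i = j" by auto
    moreover have "(x, y) \<in> rs ! i \<or> (y, x) \<in> rs ! i" if "i = j"
      using well_ordered_space.le_total[OF ws[OF *(1)], of x y]
        well_ordered_space.less_imp_le[OF ws[OF *(1)], of y x] * that by blast
    ultimately show "(a, b) \<in> ?R \<or> (b, a) \<in> ?R" using * by (auto simp: ord_sum_iff)
  qed
  have lin: "Linear_order ?R" using refl sub trans antisym total by (simp add: order_on_defs)
  have "\<exists>a\<in>A. \<forall>a'\<in>A. (a, a') \<in> ?R" if A: "A \<subseteq> Field ?R" "A \<noteq> {}" for A
  proof -
    define i where "i = (LEAST i. \<exists>x. (i, x) \<in> A)"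
    have "\<exists>i x. (i, x) \<in> A" using A(2) by auto
    then have ex: "\<exists>x. (i, x) \<in> A" unfolding i_def by (rule LeastI_ex)
    have least: "i \<le> j" if "(j, y) \<in> A" for j y
      unfolding i_def using that by (intro Least_le) blast
    have i: "i < length rs" using ex A(1) by (auto simp: F)
    have S: "{x. (i, x) \<in> A} \<subseteq> Field (rs ! i)" "{x. (i, x) \<in> A} \<noteq> {}"
      using A(1) ex by (auto simp: F)
    obtain x where x: "x \<in> {x. (i, x) \<in> A}" "\<And>y. y \<in> {x. (i, x) \<in> A} \<Longrightarrow> (x, y) \<in> rs ! i"
      by (rule well_ordered_space.ex_min[OF ws[OF i] S]) blast
    have "((i, x), a') \<in> ?R" if a': "a' \<in> A" for a'
    proof -
      obtain j y where [simp]: "a' = (j, y)" by (metis surj_pair)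
      have "j < length rs" "y \<in> Field (rs ! j)" using a' A(1) by (auto simp: F)
      moreover have "x \<in> Field (rs ! i)" using x(1) S(1) by blast
      moreover have "i < j \<or> i = j \<and> (x, y) \<in> rs ! i"
        using least[of j y] x(2)[of y] a' by (cases "i = j") auto
      ultimately show ?thesis using i by (simp add: ord_sum_iff)
    qed
    then show ?thesis using x(1) by (intro bexI[of _ "(i, x)"]) auto
  qed
  then show ?thesis unfolding Linear_order_Well_order_iff[OF lin] by blast
qed

definition cnf_order :: "('a rel \<times> nat) list \<Rightarrow> (nat \<times> nat \<times> ('a \<Rightarrow> nat)) rel" where
  "cnf_order cs = ord_sum (map (\<lambda>(\<alpha>, n). ord_times (omega_power \<alpha>) n) cs)"

locale omega_power_sum =
  fixes cs :: "('a rel \<times> nat) list"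
  assumes nonempty: "cs \<noteq> []"
    and exponent: "i < length cs \<Longrightarrow> Well_order (fst (cs ! i))"
    and coefficient: "i < length cs \<Longrightarrow> 0 < snd (cs ! i)"
begin

lemma power_well_order: "i < length cs \<Longrightarrow> Well_order (omega_power (fst (cs ! i)))"
  using exponent well_ordered_space.omega_power_well_order by (auto simp: well_ordered_space_def)

lemma times_well_order:
  assumes "i < length cs"
  shows "Well_order (ord_times (omega_power (fst (cs ! i))) n)"
    and "Field (ord_times (omega_power (fst (cs ! i))) n) = {(j, f). j < n \<and> f \<in> finsupp (fst (cs ! i))}"
proof -
  have *: "\<forall>r\<in>set (replicate n (omega_power (fst (cs ! i)))). Well_order r"
    using power_well_order[OF assms] by auto
  show "Well_order (ord_times (omega_power (fst (cs ! i))) n)"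
    unfolding ord_times_def by (rule ord_sum_well_order[OF *])
  show "Field (ord_times (omega_power (fst (cs ! i))) n) = {(j, f). j < n \<and> f \<in> finsupp (fst (cs ! i))}"
    unfolding ord_times_def Field_ord_sum[OF *] by (auto simp: Field_omega_power)
qed

lemma nth_summand:
  "i < length cs \<Longrightarrow> map (\<lambda>(\<alpha>, n). ord_times (omega_power \<alpha>) n) cs ! i =
     ord_times (omega_power (fst (cs ! i))) (snd (cs ! i))"
  by (simp add: case_prod_beta)

lemma summand_well_order:
  "\<forall>r\<in>set (map (\<lambda>(\<alpha>, n). ord_times (omega_power \<alpha>) n) cs). Well_order r"
proof
  fix r assume "r \<in> set (map (\<lambda>(\<alpha>, n). ord_times (omega_power \<alpha>) n) cs)"
  then obtain i where "i < length cs" "r = ord_times (omega_power (fst (cs ! i))) (snd (cs ! i))"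
    by (auto simp: in_set_conv_nth case_prod_beta)
  then show "Well_order r" using times_well_order(1) by simp
qed

sublocale well_ordered_space "cnf_order cs"
  by (simp add: well_ordered_space_def cnf_order_def ord_sum_well_order[OF summand_well_order])

notation le (infix "\<sqsubseteq>" 50) and less (infix "\<sqsubset>" 50)

lemma Field_cnf_order:
  "Field (cnf_order cs) = {(i, j, f). i < length cs \<and> j < snd (cs ! i) \<and> f \<in> finsupp (fst (cs ! i))}"
  unfolding cnf_order_def Field_ord_sum[OF summand_well_order]
  using nth_summand times_well_order(2) by auto

lemma cnf_order_iff:
  "((i, j, f), (i', j', h)) \<in> cnf_order cs \<longleftrightarrow>
     (i, j, f) \<in> Field (cnf_order cs) \<and> (i', j', h) \<in> Field (cnf_order cs) \<and>
     (i < i' \<or> i = i' \<and> (j < j' \<or> j = j' \<and> (f, h) \<in> omega_power (fst (cs ! i))))"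
proof -
  have "((j, f), (j', h)) \<in> ord_times (omega_power (fst (cs ! i))) n \<longleftrightarrow>
      j < n \<and> j' < n \<and> f \<in> finsupp (fst (cs ! i)) \<and> h \<in> finsupp (fst (cs ! i)) \<and>
      (j < j' \<or> j = j' \<and> (f, h) \<in> omega_power (fst (cs ! i)))" for n
    unfolding ord_times_def ord_sum_iff by (auto simp: Field_omega_power)
  then show ?thesis
    unfolding Field_cnf_order unfolding cnf_order_def ord_sum_iff
    using nth_summand times_well_order(2) by auto
qed

lemma zero_least:
  assumes i: "i < length cs" and f: "f \<in> finsupp (fst (cs ! i))"
  shows "((\<lambda>_. 0), f) \<in> omega_power (fst (cs ! i))"
    and "(f, (\<lambda>_. 0)) \<in> omega_power (fst (cs ! i)) \<Longrightarrow> f = (\<lambda>_. 0)"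
proof -
  interpret A: well_ordered_space "fst (cs ! i)"
    using exponent[OF i] by (simp add: well_ordered_space_def)
  show "((\<lambda>_. 0), f) \<in> omega_power (fst (cs ! i))"
    using A.zero_omega_less[OF f] f by (cases "f = (\<lambda>_. 0)") (auto simp: omega_power_def finsupp_def)
  show "f = (\<lambda>_. 0)" if "(f, (\<lambda>_. 0)) \<in> omega_power (fst (cs ! i))"
  proof (rule ccontr)
    assume "f \<noteq> (\<lambda>_. 0)"
    then have "A.omega_less f f" using A.omega_less_trans[OF conjI A.zero_omega_less[OF f]] that by blast
    then show False by simp
  qed
qed

definition "last_point = (length cs - 1, snd (last cs) - 1, (\<lambda>_ :: 'a. 0 :: nat))"

abbreviation "initial_part \<equiv> Restr (cnf_order cs) {z. z \<sqsubseteq> last_point}"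

lemma last_index: "length cs - 1 < length cs" "cs ! (length cs - 1) = last cs"
  using nonempty by (auto simp: last_conv_nth)

lemma last_point_Field: "last_point \<in> Field (cnf_order cs)"
  unfolding last_point_def Field_cnf_order
  using last_index coefficient[OF last_index(1)] zero_finsupp by auto

lemma Field_initial_part: "Field initial_part = {z. z \<sqsubseteq> last_point}"
  by (rule Field_Restr) (use le_Field in blast)

sublocale initial: well_ordered_space initial_part
  by (rule well_ordered_Restr)

lemma logic_of_cnf_order:
  "logic_of (\<beta> (cnf_order cs)) =
     logic_of (interval_topology initial_part) \<inter> logic_of (\<beta> (omega_power (fst (last cs))))"
proof (rule logic_of_final_block[OF last_point_Field, where g = "\<lambda>f. (length cs - 1, snd (last cs) - 1, f)"])
  let ?i = "length cs - 1" and ?j = "snd (last cs) - 1" and ?\<alpha> = "fst (last cs)"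
  have j: "?j < snd (last cs)" using coefficient[OF last_index(1)] last_index(2) by simp
  have mem: "f \<in> finsupp ?\<alpha> \<Longrightarrow> (?i, ?j, f) \<in> Field (cnf_order cs)" for f
    using j last_index by (auto simp: Field_cnf_order)
  show "Well_order ?\<alpha>" using exponent[OF last_index(1)] last_index(2) by simp
  show "(f, h) \<in> omega_power ?\<alpha> \<longleftrightarrow> (?i, ?j, f) \<sqsubseteq> (?i, ?j, h)"
    if "f \<in> finsupp ?\<alpha>" "h \<in> finsupp ?\<alpha>" for f h
    using mem that last_index(2) by (simp add: cnf_order_iff)
  show "(\<lambda>f. (?i, ?j, f)) ` finsupp ?\<alpha> = {z. last_point \<sqsubseteq> z}"
  proof
    show "(\<lambda>f. (?i, ?j, f)) ` finsupp ?\<alpha> \<subseteq> {z. last_point \<sqsubseteq> z}"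
      using mem mem[OF zero_finsupp] zero_least(1)[OF last_index(1)] last_index(2)
      by (auto simp: last_point_def cnf_order_iff)
    show "{z. last_point \<sqsubseteq> z} \<subseteq> (\<lambda>f. (?i, ?j, f)) ` finsupp ?\<alpha>"
    proof
      fix z assume z: "z \<in> {z. last_point \<sqsubseteq> z}"
      obtain a b f where [simp]: "z = (a, b, f)" by (metis surj_pair)
      have F: "a < length cs" "b < snd (cs ! a)" "f \<in> finsupp (fst (cs ! a))"
        and le: "?i < a \<or> ?i = a \<and> ?j \<le> b"
        using z by (auto simp: last_point_def cnf_order_iff Field_cnf_order)
      have a: "a = ?i" using F(1) le by auto
      then have "b = ?j" using F(2) le last_index(2) by auto
      then show "z \<in> (\<lambda>f. (?i, ?j, f)) ` finsupp ?\<alpha>" using F(3) a last_index(2) by auto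
    qed
  qed
  show "(?i, ?j, (\<lambda>_. 0)) = last_point" by (simp add: last_point_def)
qed

text \<open>
  The block at the position \<open>(i, j)\<close> immediately before the last one ends at the first point of the
  last block. Either it belongs to the last term of the normal form, or that term has coefficient 1
  and it is the final block of the term before.
\<close>

lemma preceding_block:
  assumes i: "i < length cs" "j < snd (cs ! i)"
    and consecutive: "Suc i = length cs \<and> Suc (Suc j) = snd (cs ! i) \<or>
      Suc (Suc i) = length cs \<and> Suc j = snd (cs ! i) \<and> snd (last cs) = 1"
  shows "initial.omega_block (fst (cs ! i)) (\<lambda>f. (i, j, f)) last_point"
proof -
  let ?\<alpha> = "fst (cs ! i)" and ?i = "length cs - 1" and ?j = "snd (last cs) - 1"
  have mem: "f \<in> finsupp ?\<alpha> \<Longrightarrow> (i, j, f) \<in> Field (cnf_order cs)" for f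
    using i by (simp add: Field_cnf_order)
  have li: "cs ! i = last cs" if "Suc i = length cs" using last_index(2) that by (metis diff_Suc_1)
  have before: "i < ?i \<or> i = ?i \<and> j < ?j"
    using consecutive li by auto
  have below: "(i, j, f) \<sqsubseteq> last_point" "(i, j, f) \<noteq> last_point" if "f \<in> finsupp ?\<alpha>" for f
    using mem[OF that] last_point_Field before unfolding last_point_def by (auto simp: cnf_order_iff)
  have less: "initial.less x y \<longleftrightarrow> x \<sqsubset> y \<and> y \<sqsubseteq> last_point" for x y
    unfolding initial.less_def less_def using le_trans[of x y last_point] by blast
  have "(\<lambda>f. (i, j, f)) ` finsupp ?\<alpha> =
      {z. (i, j, (\<lambda>_. 0)) \<sqsubseteq> z \<and> z \<sqsubset> last_point}"
  proof
    show "(\<lambda>f. (i, j, f)) ` finsupp ?\<alpha> \<subseteq> {z. (i, j, (\<lambda>_. 0)) \<sqsubseteq> z \<and> z \<sqsubset> last_point}"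
      using mem mem[OF zero_finsupp] zero_least(1)[OF i(1)] below by (auto simp: cnf_order_iff less_def)
    show "{z. (i, j, (\<lambda>_. 0)) \<sqsubseteq> z \<and> z \<sqsubset> last_point} \<subseteq> (\<lambda>f. (i, j, f)) ` finsupp ?\<alpha>"
    proof
      fix z assume z: "z \<in> {z. (i, j, (\<lambda>_. 0)) \<sqsubseteq> z \<and> z \<sqsubset> last_point}"
      obtain a b f where [simp]: "z = (a, b, f)" by (metis surj_pair)
      have F: "a < length cs" "b < snd (cs ! a)" "f \<in> finsupp (fst (cs ! a))"
        and lower: "i < a \<or> i = a \<and> j \<le> b"
        using z by (auto simp: cnf_order_iff Field_cnf_order)
      have upper: "a < ?i \<or> a = ?i \<and> (b < ?j \<or> b = ?j \<and> (f, (\<lambda>_. 0)) \<in> omega_power (fst (cs ! a)))"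
        and ne: "z \<noteq> last_point"
        using z by (auto simp: less_def last_point_def cnf_order_iff)
      have "\<not> (a = ?i \<and> b = ?j)"
      proof
        assume "a = ?i \<and> b = ?j"
        then have "f = (\<lambda>_. 0)" using upper zero_least(2)[OF F(1,3)] by auto
        then show False using ne \<open>a = ?i \<and> b = ?j\<close> by (simp add: last_point_def)
      qed
      then have "a < ?i \<or> a = ?i \<and> b < ?j" using upper by blast
      then have "a = i \<and> b = j" using lower consecutive F(2) li by auto
      then show "z \<in> (\<lambda>f. (i, j, f)) ` finsupp ?\<alpha>" using F(3) by auto
    qed
  qed
  moreover have "(i, j, (\<lambda>_. 0)) \<sqsubseteq> z \<and> z \<sqsubset> last_point \<longleftrightarrow>
      initial.le (i, j, (\<lambda>_. 0)) z \<and> initial.less z last_point" for z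
    unfolding less
    using le_refl[OF last_point_Field] below[OF zero_finsupp] less_imp_le[of z last_point] by blast
  moreover have "last_point \<in> Field initial_part"
    unfolding Field_initial_part using le_refl[OF last_point_Field] by simp
  moreover have "(f, h) \<in> omega_power ?\<alpha> \<longleftrightarrow> initial.le (i, j, f) (i, j, h)"
    if "f \<in> finsupp ?\<alpha>" "h \<in> finsupp ?\<alpha>" for f h
    using mem that below by (simp add: cnf_order_iff)
  ultimately show ?thesis unfolding initial.omega_block_def by presburger
qed

lemma initial_part_nonempty: "Field initial_part \<noteq> {}"
  unfolding Field_initial_part using le_refl[OF last_point_Field] by blast

lemma initial_part_logic_subset: "logic_of (interval_topology initial_part) \<subseteq> S4Grz_bd (Suc 0)"
  using initial_part_nonempty initial.well_order by (intro logic_of_subset_S4Grz_bd_1)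

lemma initial_part_single:
  assumes "length cs = 1" "snd (last cs) = 1"
  shows "logic_of (interval_topology initial_part) = S4Grz_bd (Suc 0)"
proof (rule singleton_logic[OF initial.well_order])
  have "z = last_point" if "z \<sqsubseteq> last_point" for z
  proof -
    obtain a b f where [simp]: "z = (a, b, f)" by (metis surj_pair)
    have F: "a < length cs" "f \<in> finsupp (fst (cs ! a))"
      and "a < 0 \<or> a = 0 \<and> (b < 0 \<or> b = 0 \<and> (f, (\<lambda>_. 0)) \<in> omega_power (fst (cs ! a)))"
      using that assms by (auto simp: last_point_def cnf_order_iff Field_cnf_order)
    then show ?thesis using zero_least(2)[OF F] assms by (simp add: last_point_def)
  qed
  then show "Field initial_part = {last_point}"
    unfolding Field_initial_part using le_refl[OF last_point_Field] by blast
qed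

end

lemma omega_power_logic_subset:
  "Well_order \<alpha> \<Longrightarrow> logic_of (\<beta> (omega_power \<alpha>)) \<subseteq> S4Grz_bd (Suc 0)"
  using omega_power_logic by blast

lemma L_omega_0: "L_omega 0 = S4Grz_bd (Suc 0)"
proof -
  have wo: "Well_order ({} :: nat rel)" by simp
  interpret W: well_ordered_space "omega_power ({} :: nat rel)"
    using well_ordered_space.omega_power_well_order[of "{} :: nat rel"] wo
    by (simp add: well_ordered_space_def)
  have F: "Field (omega_power ({} :: nat rel)) = {\<lambda>_. 0}"
    by (auto simp: Field_omega_power finsupp_def)
  have "logic_of (\<beta> (omega_power ({} :: nat rel))) = logic_of W.T"
    by (rule W.logic_of_stone_cech_compact[of "\<lambda>_. 0"]) (use F W.le_refl in auto)
  then show ?thesis using L_omega_eq[OF wo] singleton_logic[OF W.well_order F] by simp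
qed


section \<open>Classification\<close>

lemma cantor_normal_form_sum:
  assumes "cantor_normal_form \<gamma> cs"
  shows "omega_power_sum cs" "(\<gamma>, cnf_order cs) \<in> ordIso"
  using assms nth_mem[of _ cs] unfolding omega_power_sum_def cantor_normal_form_def cnf_order_def
  by (auto simp: case_prod_beta)

lemma logic_of_ordIso:
  assumes "(\<gamma>, \<delta>) \<in> ordIso" shows "logic_of (\<beta> \<gamma>) = logic_of (\<beta> \<delta>)"
  using assms logic_of_stone_cech_iso unfolding ordIso_def by blast

text \<open>
  Used for exponents: one that exceeds a finite exponent has at least as many elements.
\<close>

lemma ordLess_subset_of_card:
  assumes "(\<alpha>, \<alpha>') \<in> ordLess" "finite (Field \<alpha>)"
  obtains S where "finite S" "S \<subseteq> Field \<alpha>'" "card S = card (Field \<alpha>)"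
proof -
  have "(card_of (Field \<alpha>), card_of (Field \<alpha>')) \<in> ordLeq"
    by (rule card_of_mono2[OF ordLess_imp_ordLeq[OF assms(1)]])
  then obtain f where f: "inj_on f (Field \<alpha>)" "f ` Field \<alpha> \<subseteq> Field \<alpha>'"
    unfolding card_of_ordLeq[symmetric] by blast
  show ?thesis by (rule that[of "f ` Field \<alpha>"]) (use f assms(2) card_image in auto)
qed

text \<open>
  The logic is that of \<open>[0, p]\<close> intersected with \<open>L_omega m\<close>. The first factor is contained in the
  second if \<open>m = 0\<close>, and contains it if there is only one block. Otherwise the block before \<open>p\<close>
  has an exponent of at least \<open>m\<close>, so that \<open>p\<close> has rank at least \<open>m\<close>, which gives \<open>m < n\<close>.
\<close>

theorem logic_of_finite_least_exponent:
  assumes cnf: "cantor_normal_form \<gamma> cs" and fin: "finite (Field (fst (last cs)))"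
  defines "L \<equiv> logic_of (\<beta> \<gamma>)"
  shows "(\<exists>m>0. L = L_omega m) \<or> (L = S4Grz \<or> (\<exists>n>0. L = S4Grz_bd n)) \<or>
    ((\<exists>m>0. L = S4Grz \<inter> L_omega m) \<or> (\<exists>m n. 0 < m \<and> m < n \<and> L = S4Grz_bd n \<inter> L_omega m))"
proof -
  interpret omega_power_sum cs by (rule cantor_normal_form_sum(1)[OF cnf])
  let ?\<alpha> = "fst (last cs)" and ?X = "logic_of (interval_topology initial_part)"
  define m where "m = card (Field ?\<alpha>)"
  have \<alpha>: "Well_order ?\<alpha>" using exponent[OF last_index(1)] last_index(2) by simp
  have m: "logic_of (\<beta> (omega_power ?\<alpha>)) = L_omega m"
    unfolding m_def by (rule L_omega_eq[OF \<alpha> fin, symmetric])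
  have L: "L = ?X \<inter> L_omega m"
    unfolding L_def logic_of_ordIso[OF cantor_normal_form_sum(2)[OF cnf]] logic_of_cnf_order m ..
  have Lm: "L_omega m \<subseteq> S4Grz_bd (Suc 0)" using omega_power_logic_subset[OF \<alpha>] m by simp
  show ?thesis
  proof (cases "m = 0")
    case True
    then have "L = ?X" using L initial_part_logic_subset L_omega_0 by auto
    then show ?thesis by (rule_tac initial.logic_of_cases[OF initial_part_nonempty]) blast+
  next
    case m0: False
    show ?thesis
    proof (cases "length cs = 1 \<and> snd (last cs) = 1")
      case True
      then have "L = L_omega m" using L Lm initial_part_single by auto
      then show ?thesis using m0 by auto
    next
      case False
      have "\<exists>i j S. i < length cs \<and> initial.omega_block (fst (cs ! i)) (\<lambda>f. (i, j, f)) last_point \<and>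
          finite S \<and> S \<subseteq> Field (fst (cs ! i)) \<and> card S = m"
      proof (cases "snd (last cs) = 1")
        case one: True
        have len: "length cs \<ge> 2" using False one nonempty by (cases cs) (auto simp: Suc_le_eq)
        let ?i = "length cs - 2"
        have i: "?i < length cs" "?i < length cs - 1" using len by auto
        have "sorted_wrt (\<lambda>c c'. (fst c', fst c) \<in> ordLess) cs"
          using cnf by (simp add: cantor_normal_form_def)
        then have "(fst (cs ! (length cs - 1)), fst (cs ! ?i)) \<in> ordLess"
          using i last_index(1) unfolding sorted_wrt_iff_nth_less by blast
        then obtain S where "finite S" "S \<subseteq> Field (fst (cs ! ?i))" "card S = m"
          unfolding last_index(2) m_def by (rule ordLess_subset_of_card[OF _ fin]) blast
        moreover have "initial.omega_block (fst (cs ! ?i)) (\<lambda>f. (?i, snd (cs ! ?i) - 1, f)) last_point"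
          using coefficient[OF i(1)] i len one by (intro preceding_block) auto
        ultimately show ?thesis using i(1) by blast
      next
        case more: False
        have "snd (last cs) \<ge> 2"
          using more coefficient[OF last_index(1)] last_index(2) by auto
        then have "initial.omega_block (fst (cs ! (length cs - 1)))
            (\<lambda>f. (length cs - 1, snd (last cs) - 2, f)) last_point"
          using last_index nonempty by (intro preceding_block) auto
        then show ?thesis
          using fin m_def last_index
          by (intro exI[of _ "length cs - 1"] exI[of _ "snd (last cs) - 2"] exI[of _ "Field ?\<alpha>"]) simp
      qed
      then obtain i j S where i: "i < length cs"
        and b: "initial.omega_block (fst (cs ! i)) (\<lambda>f. (i, j, f)) last_point"
        and S: "finite S" "S \<subseteq> Field (fst (cs ! i))" "card S = m" by blast
      have dm: "initial.derived m \<noteq> {}"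
        using initial.block_end_derived[OF exponent[OF i] b S] by blast
      show ?thesis
      proof (rule initial.logic_of_cases[OF initial_part_nonempty])
        assume "?X = S4Grz"
        then show ?thesis using L m0 by blast
      next
        fix k assume k: "initial.derived (Suc k) = {}" "?X = S4Grz_bd (Suc k)"
        have "m < Suc k"
        proof (rule ccontr)
          assume "\<not> m < Suc k"
          then have "initial.derived m \<subseteq> initial.derived (Suc k)"
            by (intro initial.derived_antimono) simp
          then show False unfolding k(1) using dm by blast
        qed
        then show ?thesis using L k(2) m0 by blast
      qed
    qed
  qed
qed

text \<open>
  A function of finite support is determined by the finite graph of its nonzero part.
\<close>

lemma countable_finsupp:
  assumes "countable (Field \<alpha>)"
  shows "countable (finsupp \<alpha>)"
proof -
  let ?G = "\<lambda>f. {(x, f x) | x. f x \<noteq> (0 :: nat)}"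
  have "inj_on ?G (finsupp \<alpha>)"
  proof (rule inj_onI)
    fix f h assume eq: "?G f = ?G h"
    show "f = h"
    proof
      fix x
      have "(x, f x) \<in> ?G f \<longleftrightarrow> (x, f x) \<in> ?G h" "(x, h x) \<in> ?G f \<longleftrightarrow> (x, h x) \<in> ?G h"
        unfolding eq by simp_all
      then show "f x = h x" by auto
    qed
  qed
  moreover have "countable (?G ` finsupp \<alpha>)"
  proof (rule countable_subset)
    have "finite (?G f)" "?G f \<subseteq> Field \<alpha> \<times> UNIV" if f: "f \<in> finsupp \<alpha>" for f
    proof -
      have "?G f = (\<lambda>x. (x, f x)) ` {x. f x \<noteq> 0}" by auto
      then show "finite (?G f)" using f by (simp add: finsupp_def)
      show "?G f \<subseteq> Field \<alpha> \<times> UNIV" using f by (auto simp: finsupp_def)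
    qed
    then show "?G ` finsupp \<alpha> \<subseteq> {S. finite S \<and> S \<subseteq> Field \<alpha> \<times> UNIV}" by blast
    show "countable {S. finite S \<and> S \<subseteq> Field \<alpha> \<times> (UNIV :: nat set)}"
      using assms by (intro countable_Collect_finite_subset) auto
  qed
  ultimately show ?thesis by (rule countable_image_inj_on[rotated])
qed

text \<open>
  The sum has only countably many elements, so it has a copy on any infinite type.
\<close>

lemma ex_ordinal_with_cnf:
  fixes cs :: "('a rel \<times> nat) list"
  assumes inf: "infinite (UNIV :: 'a set)" and "omega_power_sum cs"
    and count: "\<And>i. i < length cs \<Longrightarrow> countable (Field (fst (cs ! i)))"
    and sorted: "sorted_wrt (\<lambda>c c'. (fst c', fst c) \<in> ordLess) cs"
  shows "\<exists>\<gamma> :: 'a rel. Well_order \<gamma> \<and> Field \<gamma> \<noteq> {} \<and> cantor_normal_form \<gamma> cs"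
proof -
  interpret omega_power_sum cs by fact
  have "Field (cnf_order cs) \<subseteq> (\<Union>i\<in>{..<length cs}. {i} \<times> (UNIV \<times> finsupp (fst (cs ! i))))"
    by (auto simp: Field_cnf_order)
  moreover have "countable (\<Union>i\<in>{..<length cs}. {i} \<times> ((UNIV :: nat set) \<times> finsupp (fst (cs ! i))))"
    using count by (intro countable_UN countable_SIGMA countable_finsupp) auto
  ultimately have "countable (Field (cnf_order cs))" by (rule countable_subset)
  then obtain k :: "_ \<Rightarrow> nat" where k: "inj_on k (Field (cnf_order cs))" by (auto simp: countable_def)
  obtain e :: "nat \<Rightarrow> 'a" where e: "inj e" using inf infinite_countable_subset by blast
  let ?\<gamma> = "dir_image (cnf_order cs) (e \<circ> k)"
  have inj: "inj_on (e \<circ> k) (Field (cnf_order cs))"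
    using k e by (auto intro: comp_inj_on inj_on_subset)
  have "(cnf_order cs, ?\<gamma>) \<in> ordIso" by (rule dir_image_ordIso[OF well_order inj])
  then have iso: "(?\<gamma>, cnf_order cs) \<in> ordIso" by (rule ordIso_symmetric)
  then have "Well_order ?\<gamma>" by (simp add: ordIso_def)
  moreover have "Field ?\<gamma> \<noteq> {}" unfolding dir_image_Field using last_point_Field by blast
  moreover have "cantor_normal_form ?\<gamma> cs"
    using nonempty exponent coefficient sorted iso
    unfolding cantor_normal_form_def cnf_order_def by (auto simp: in_set_conv_nth; metis fst_conv snd_conv)
  ultimately show ?thesis by blast
qed

lemma finite_ordLess_card_of:
  assumes "finite M" "infinite A \<or> card M < card A"
  shows "(card_of M, card_of A) \<in> ordLess"
proof -
  have wo: "Well_order (card_of M)" "Well_order (card_of A)" by (rule card_of_Well_order)+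
  have "(card_of A, card_of M) \<notin> ordLeq"
  proof
    assume "(card_of A, card_of M) \<in> ordLeq"
    then obtain f where f: "inj_on f A" "f ` A \<subseteq> M" unfolding card_of_ordLeq[symmetric] by blast
    then have "finite A" using assms(1) inj_on_finite by blast
    moreover have "card A \<le> card M" by (rule card_inj_on_le[OF f assms(1)])
    ultimately show False using assms(2) by simp
  qed
  then show ?thesis using not_ordLess_iff_ordLeq[OF wo(2,1)] by blast
qed

lemma ex_ordinal_single:
  assumes inf: "infinite (UNIV :: 'a set)"
  shows "\<exists>\<gamma> :: 'a rel. Well_order \<gamma> \<and> Field \<gamma> \<noteq> {} \<and> least_exponent_finite \<gamma> \<and>
    logic_of (\<beta> \<gamma>) = L_omega m"
proof -
  obtain M :: "'a set" where M: "finite M" "card M = m"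
    using infinite_arbitrarily_large[OF inf] by blast
  let ?cs = "[(card_of M, 1)] :: ('a rel \<times> nat) list"
  have sum: "omega_power_sum ?cs" by unfold_locales (auto simp: card_of_Well_order)
  interpret omega_power_sum ?cs by (rule sum)
  have "\<exists>\<gamma> :: 'a rel. Well_order \<gamma> \<and> Field \<gamma> \<noteq> {} \<and> cantor_normal_form \<gamma> ?cs"
    using M by (intro ex_ordinal_with_cnf[OF inf sum]) (auto simp: Field_card_of countable_finite)
  then obtain \<gamma> :: "'a rel" where \<gamma>: "Well_order \<gamma>" "Field \<gamma> \<noteq> {}" "cantor_normal_form \<gamma> ?cs" by blast
  have "L_omega m = logic_of (\<beta> (omega_power (card_of M)))"
    using L_omega_eq[OF card_of_Well_order[of M]] M by (simp add: Field_card_of)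
  then have "logic_of (\<beta> \<gamma>) = L_omega m"
    using logic_of_ordIso[OF cantor_normal_form_sum(2)[OF \<gamma>(3)]] logic_of_cnf_order
      initial_part_single omega_power_logic_subset[OF card_of_Well_order[of M]] by auto
  moreover have "least_exponent_finite \<gamma>"
    unfolding least_exponent_finite_def using \<gamma>(3) M by (intro exI[of _ ?cs]) (simp add: Field_card_of)
  ultimately show ?thesis using \<gamma> by blast
qed

text \<open>
  The witness is \<open>\<omega>\<^sup>a + \<omega>\<^sup>m\<close> with an exponent \<open>a\<close> on the set \<open>A\<close>; for \<open>a = m\<close> its normal form is the
  single term \<open>\<omega>\<^sup>m 2\<close>.
\<close>

lemma ex_ordinal_two_blocks:
  fixes A :: "'a set"
  assumes inf: "infinite (UNIV :: 'a set)" and A: "countable A" "infinite A \<or> m \<le> card A"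
  defines "X \<equiv> if finite A then S4Grz_bd (Suc (card A)) else S4Grz"
  shows "\<exists>\<gamma> :: 'a rel. Well_order \<gamma> \<and> Field \<gamma> \<noteq> {} \<and> least_exponent_finite \<gamma> \<and>
    logic_of (\<beta> \<gamma>) = X \<inter> L_omega m \<and> X \<subseteq> S4Grz_bd (Suc 0)"
proof -
  obtain M :: "'a set" where M: "finite M" "card M = m"
    using infinite_arbitrarily_large[OF inf] by blast
  define cs :: "('a rel \<times> nat) list" where
    "cs = (if finite A \<and> card A = m then [(card_of A, 2)] else [(card_of A, 1), (card_of M, 1)])"
  have sum: "omega_power_sum cs"
    by unfold_locales (auto simp: cs_def card_of_Well_order nth_Cons' split: if_splits)
  interpret omega_power_sum cs by (rule sum)
  have "\<exists>\<gamma> :: 'a rel. Well_order \<gamma> \<and> Field \<gamma> \<noteq> {} \<and> cantor_normal_form \<gamma> cs"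
  proof (rule ex_ordinal_with_cnf[OF inf sum])
    show "countable (Field (fst (cs ! i)))" if "i < length cs" for i
      using that A(1) M by (auto simp: cs_def Field_card_of countable_finite nth_Cons' split: if_splits)
    show "sorted_wrt (\<lambda>c c'. (fst c', fst c) \<in> ordLess) cs"
      using finite_ordLess_card_of[OF M(1), of A] A(2) M(2) by (auto simp: cs_def)
  qed
  then obtain \<gamma> :: "'a rel" where \<gamma>: "Well_order \<gamma>" "Field \<gamma> \<noteq> {}" "cantor_normal_form \<gamma> cs" by blast
  have last: "finite (Field (fst (last cs)))" "card (Field (fst (last cs))) = m"
    using M by (auto simp: cs_def Field_card_of)
  have hd: "0 < length cs" "Field (fst (cs ! 0)) = A"
    by (auto simp: cs_def Field_card_of)
  have block: "initial.omega_block (fst (cs ! 0)) (\<lambda>f. (0, 0, f)) last_point"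
    by (rule preceding_block) (auto simp: cs_def)
  have least: "initial.le (0, 0, (\<lambda>_. 0)) z \<and> initial.le z last_point" if z: "z \<in> Field initial_part" for z
  proof -
    have zl: "z \<sqsubseteq> last_point" using z unfolding Field_initial_part by simp
    have "(0, 0, (\<lambda>_. 0)) \<sqsubseteq> z"
    proof -
      obtain a b f where [simp]: "z = (a, b, f)" by (metis surj_pair)
      have "z \<in> Field (cnf_order cs)" using le_Field[OF zl] by blast
      moreover have "(0, 0, (\<lambda>_. 0)) \<in> Field (cnf_order cs)"
        using hd coefficient[OF hd(1)] zero_finsupp by (simp add: Field_cnf_order)
      ultimately show ?thesis
        using zero_least(1)[OF hd(1)] by (auto simp: cnf_order_iff Field_cnf_order)
    qed
    then show ?thesis
      using zl le_trans[of _ z last_point] le_refl[OF last_point_Field] by blast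
  qed
  have X: "logic_of (interval_topology initial_part) = X"
  proof (cases "finite A")
    case True
    have "initial.derived (card A) \<noteq> {}"
      using initial.block_end_derived[OF exponent[OF hd(1)] block True, of "card A"] hd(2) by blast
    moreover have "initial.derived (Suc (card A)) = {}"
      using initial.derived_block_empty[OF exponent[OF hd(1)] block least] hd(2) True by simp
    ultimately show ?thesis using initial.logic_of_bounded True unfolding X_def by simp
  next
    case False
    have "initial.derived k \<noteq> {}" for k
    proof -
      obtain S where "S \<subseteq> A" "finite S" "card S = k"
        using infinite_arbitrarily_large[OF False, of k] by blast
      then show ?thesis
        using initial.block_end_derived[OF exponent[OF hd(1)] block, of S k] hd(2) by blast
    qed
    then show ?thesis using initial.logic_of_unbounded False unfolding X_def by simp
  qed
  have "Well_order (fst (last cs))" using exponent[OF last_index(1)] last_index(2) by simp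
  then have "L_omega m = logic_of (\<beta> (omega_power (fst (last cs))))"
    using L_omega_eq[of "fst (last cs)"] last by simp
  then have "logic_of (\<beta> \<gamma>) = X \<inter> L_omega m"
    using logic_of_ordIso[OF cantor_normal_form_sum(2)[OF \<gamma>(3)]] logic_of_cnf_order X by simp
  moreover have "least_exponent_finite \<gamma>"
    unfolding least_exponent_finite_def using \<gamma>(3) last(1) by blast
  moreover have "X \<subseteq> S4Grz_bd (Suc 0)" using initial_part_logic_subset X by simp
  ultimately show ?thesis using \<gamma> by blast
qed

theorem corollary4p6:
  fixes L :: "fm set"
  assumes "infinite (UNIV :: 'a set)"
    and "logic_above_S4 L"
  shows "(\<exists>\<gamma> :: 'a rel. Well_order \<gamma> \<and> Field \<gamma> \<noteq> {} \<and>
            L = logic_of (\<beta> \<gamma>) \<and> least_exponent_finite \<gamma>)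
     \<longleftrightarrow>
       (\<exists>m>0. L = L_omega m) \<or>
       (L = S4Grz \<or> (\<exists>n>0. L = S4Grz_bd n)) \<or>
       ((\<exists>m>0. L = S4Grz \<inter> L_omega m) \<or>
        (\<exists>m n. 0 < m \<and> m < n \<and> L = S4Grz_bd n \<inter> L_omega m))"
    (is "?ordinal \<longleftrightarrow> ?listed")
proof
  assume ?ordinal
  then obtain \<gamma> :: "'a rel" and cs where "L = logic_of (\<beta> \<gamma>)" "cantor_normal_form \<gamma> cs"
    "finite (Field (fst (last cs)))"
    unfolding least_exponent_finite_def by blast
  then show ?listed using logic_of_finite_least_exponent by simp
next
  obtain C :: "'a set" where C: "infinite C" "countable C"
    using assms(1) infinite_countable_subset' by blast
  have unbounded: "\<exists>\<gamma> :: 'a rel. Well_order \<gamma> \<and> Field \<gamma> \<noteq> {} \<and> least_exponent_finite \<gamma> \<and>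
      logic_of (\<beta> \<gamma>) = S4Grz \<inter> L_omega m \<and> S4Grz \<subseteq> S4Grz_bd (Suc 0)" for m
    using ex_ordinal_two_blocks[OF assms(1) C(2), of m] C(1) by simp
  have bounded: "\<exists>\<gamma> :: 'a rel. Well_order \<gamma> \<and> Field \<gamma> \<noteq> {} \<and> least_exponent_finite \<gamma> \<and>
      logic_of (\<beta> \<gamma>) = S4Grz_bd n \<inter> L_omega m \<and> S4Grz_bd n \<subseteq> S4Grz_bd (Suc 0)"
    if "m < n" for m n
  proof -
    obtain A :: "'a set" where A: "finite A" "card A = n - 1"
      using infinite_arbitrarily_large[OF assms(1)] by blast
    then show ?thesis
      using ex_ordinal_two_blocks[OF assms(1) countable_finite[OF A(1)], of m] that by auto
  qed
  assume ?listed
  then consider m where "m > 0" "L = L_omega m" | "L = S4Grz" | n where "n > 0" "L = S4Grz_bd n"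
    | m where "L = S4Grz \<inter> L_omega m" | m n where "m < n" "L = S4Grz_bd n \<inter> L_omega m"
    by blast
  then show ?ordinal
  proof cases
    case 1
    then show ?thesis using ex_ordinal_single[OF assms(1), of m] by auto
  next
    case 2
    then have "S4Grz \<inter> L_omega 0 = L" using unbounded[of 0] L_omega_0 by blast
    then show ?thesis using unbounded[of 0] by auto
  next
    case (3 n)
    then have "S4Grz_bd n \<inter> L_omega 0 = L" using bounded[of 0 n] L_omega_0 by blast
    then show ?thesis using bounded[OF 3(1)] by auto
  next
    case (4 m)
    then show ?thesis using unbounded[of m] by auto
  next
    case (5 m n)
    then show ?thesis using bounded[OF 5(1)] by auto
  qed
qed

end
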